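(* A repetitive Meyer set $\Lambda$ in $\mathbb{R}^d$ is a regular inter-model set with Euclidean internal space if and only if $\operatorname{rank}(\langle\Lambda-\Lambda\rangle)>d$ and the address system of $\Lambda$ is a topological factor of $(\Omega_\Lambda,\mathbb{R}^d)$ such that the set of points in the address system with a unique preimage under the factor map has full measure for the unique ergodic measure of the address system.
   Context: Delone sets and hull. A Delone set in $\mathbb{R}^d$ is a subset that is uniformly discrete (for some $r>0$ every closed ball of radius $r$ contains at most one of its points) and relatively dense (for some $R>0$ every closed ball of radius $R$ contains at least one of its points). A $\rho$-patch of $\Lambda$ centered at $t\in\mathbb{R}^d$ is $\Lambda\cap\overline{B(t,\rho)}$. $\Lambda$ is repetitive if for each $\rho>0$ there is $M>0$ such that every closed ball of radius $M$ contains the center of a translated copy of every $\rho$-patch of $\Lambda$. A Meyer set is a Delone set $\Lambda$ such that $\Lambda-\Lambda$ is a Delone set. $\langle A\rangle$ is the subgroup of $\mathbb{R}^d$ generated by $A$; for a repetitive Meyer set, $\langle\Lambda-\Lambda\rangle$ is a finitely generated free Abelian group. The hull $\Omega_\Lambda$ is the set of all Delone sets whose $\rho$-patches, for every $\rho>0$, are $\rho$-patches of $\Lambda$ up to translation. A basis of neighborhoods of $\Lambda'\in\Omega_\Lambda$ is given by the sets $\{\widetilde\Lambda-t : \widetilde\Lambda\in\Omega_\Lambda,\ \widetilde\Lambda\cap\overline{B(0,R)}=\Lambda'\cap\overline{B(0,R)},\ t\in B(0,\varepsilon)\}$, $0<\varepsilon<R/2$; then $\Omega_\Lambda$ is compact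 metrizable and $\mathbb{R}^d$ acts continuously by $(\Lambda',t)\mapsto\Lambda'-t$. The transversal is $\Xi_\Lambda=\{\Lambda'\in\Omega_\Lambda:0\in\Lambda'\}$. Address system. Let $s=\operatorname{rank}\langle\Lambda-\Lambda\rangle$, let $\mathcal{B}$ be a basis of $\langle\Lambda-\Lambda\rangle$ and $\varphi:\langle\Lambda-\Lambda\rangle\to\mathbb{Z}^s$ the coordinate map in this basis. There is a unique linear map $\ell:\mathbb{R}^d\to\mathbb{R}^s$ for which there is $C>0$ with $\|\varphi(t)-\ell(t)\|\le C$ for all $\Lambda_0\in\Xi_\Lambda$ and $t\in\Lambda_0$. The address system of $\Lambda$ is the torus $\mathbb{T}^s=\mathbb{R}^s/\mathbb{Z}^s$ with the $\mathbb{R}^d$-action $(w,t)\mapsto w+[\ell(t)]_{\mathbb{Z}^s}$. There is a continuous map (the address homomorphism) $\pi_{\mathrm{Ad}}:\Omega_\Lambda\to\mathbb{T}^s$ with $\pi_{\mathrm{Ad}}(\Lambda'-t)=\pi_{\mathrm{Ad}}(\Lambda')+[\ell(t)]_{\mathbb{Z}^s}$ for all $\Lambda'\in\Omega_\Lambda$, $t\in\mathbb{R}^d$. The address system and $\pi_{\mathrm{Ad}}$ are well defined up to topological conjugacy. The address system is a topological factor of $(\Omega_\Lambda,\mathbb{R}^d)$ when $\pi_{\mathrm{Ad}}$ is surjective, and then $\pi_{\mathrm{Ad}}$ is the factor map; in that case the address system is minimal and hence uniquely ergodic (its unique invariant probability measure is Haar measure on $\mathbb{T}^s$). Inter-model sets.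 A Euclidean cut and project scheme (CPS) over $\mathbb{R}^d$ is a triple $(\mathbb{R}^n,\Gamma,s_{\mathbb{R}^n})$ with $n$ a positive integer, $\Gamma$ a countable subgroup of $\mathbb{R}^d$ and $s_{\mathbb{R}^n}:\Gamma\to\mathbb{R}^n$ a group morphism with dense range whose graph $\{(\gamma,s_{\mathbb{R}^n}(\gamma)):\gamma\in\Gamma\}$ is discrete and co-compact in $\mathbb{R}^d\times\mathbb{R}^n$. A window is a compact set $W\subseteq\mathbb{R}^n$ that is the closure of its interior. For $V\subseteq\mathbb{R}^n$ and $w\in\mathbb{R}^n$ put $\curlywedge(w+V)=\{t\in\Gamma: s_{\mathbb{R}^n}(t)\in w+V\}$. A Delone set $\Lambda\subseteq\mathbb{R}^d$ is an inter-model set with Euclidean internal space if for some Euclidean CPS, some window $W$, and some $t\in\mathbb{R}^d$, $w\in\mathbb{R}^n$, one has $\curlywedge(w+\operatorname{int}(W))-t\subseteq\Lambda\subseteq\curlywedge(w+W)-t$. It is regular if these can be chosen so that the boundary of $w+W$ (equivalently of $W$) has zero Haar (Lebesgue) measure. *)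

theory Defs
  imports "HOL-Probability.Probability_Measure" "HOL-Computational_Algebra.Group_Closure"
begin

section \<open>Delone sets, Meyer sets and repetitivity\<close>

definition shift :: "'a::euclidean_space \<Rightarrow> 'a set \<Rightarrow> 'a set" where
  "shift t \<Lambda> = (\<lambda>x. x - t) ` \<Lambda>"

definition uniformly_discrete :: "'a::euclidean_space set \<Rightarrow> bool" where
  "uniformly_discrete \<Lambda> \<longleftrightarrow>
     (\<exists>r>0. \<forall>x. \<forall>p\<in>\<Lambda> \<inter> cball x r. \<forall>q\<in>\<Lambda> \<inter> cball x r. p = q)"

definition relatively_dense :: "'a::euclidean_space set \<Rightarrow> bool" where
  "relatively_dense \<Lambda> \<longleftrightarrow> (\<exists>R>0. \<forall>x. \<Lambda> \<inter> cball x R \<noteq> {})"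

definition delone :: "'a::euclidean_space set \<Rightarrow> bool" where
  "delone \<Lambda> \<longleftrightarrow> uniformly_discrete \<Lambda> \<and> relatively_dense \<Lambda>"

definition differences :: "'a::euclidean_space set \<Rightarrow> 'a set" where
  "differences \<Lambda> = {x - y | x y. x \<in> \<Lambda> \<and> y \<in> \<Lambda>}"

definition meyer :: "'a::euclidean_space set \<Rightarrow> bool" where
  "meyer \<Lambda> \<longleftrightarrow> delone \<Lambda> \<and> delone (differences \<Lambda>)"

text \<open>The patch of radius \<open>\<rho>\<close> of \<open>\<Lambda>\<close> at \<open>t\<close>, moved so that its center is the origin.
  Two patches agree up to a translation matching their centers iff their \<open>cpatch\<close> are equal.\<close>

definition cpatch :: "real \<Rightarrow> 'a::euclidean_space set \<Rightarrow> 'a \<Rightarrow> 'a set" where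
  "cpatch \<rho> \<Lambda> t = shift t (\<Lambda> \<inter> cball t \<rho>)"

definition repetitive :: "'a::euclidean_space set \<Rightarrow> bool" where
  "repetitive \<Lambda> \<longleftrightarrow>
     (\<forall>\<rho>>0. \<exists>M>0. \<forall>y t. \<exists>t'\<in>cball y M. cpatch \<rho> \<Lambda> t' = cpatch \<rho> \<Lambda> t)"

section \<open>The hull and its transversal\<close>

definition hull_set :: "'a::euclidean_space set \<Rightarrow> 'a set set" where
  "hull_set \<Lambda> = {\<Lambda>'. delone \<Lambda>' \<and> (\<forall>\<rho>>0. \<forall>t. \<exists>t'. cpatch \<rho> \<Lambda>' t = cpatch \<rho> \<Lambda> t')}"

definition hull_nbhd :: "'a::euclidean_space set \<Rightarrow> 'a set \<Rightarrow> real \<Rightarrow> real \<Rightarrow> 'a set set" where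
  "hull_nbhd \<Lambda> \<Lambda>' R \<epsilon> =
     {shift t \<Lambda>'' | \<Lambda>'' t. \<Lambda>'' \<in> hull_set \<Lambda> \<and> \<Lambda>'' \<inter> cball 0 R = \<Lambda>' \<inter> cball 0 R \<and> t \<in> ball 0 \<epsilon>}"

text \<open>The topology on the hull whose neighborhoods of \<open>\<Lambda>'\<close> are generated by the sets
  \<open>hull_nbhd \<Lambda> \<Lambda>' R \<epsilon>\<close>: a set is open iff it contains such a set around each of its points.\<close>

definition hull_open :: "'a::euclidean_space set \<Rightarrow> 'a set set \<Rightarrow> bool" where
  "hull_open \<Lambda> U \<longleftrightarrow> U \<subseteq> hull_set \<Lambda> \<and>
     (\<forall>\<Lambda>'\<in>U. \<exists>R \<epsilon>. 0 < \<epsilon> \<and> \<epsilon> < R / 2 \<and> hull_nbhd \<Lambda> \<Lambda>' R \<epsilon> \<subseteq> U)"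

definition hull_topology :: "'a::euclidean_space set \<Rightarrow> 'a set topology" where
  "hull_topology \<Lambda> = topology (hull_open \<Lambda>)"

definition transversal :: "'a::euclidean_space set \<Rightarrow> 'a set set" where
  "transversal \<Lambda> = {\<Lambda>' \<in> hull_set \<Lambda>. 0 \<in> \<Lambda>'}"

lemma hull_nbhd_mono:
  assumes "R' \<ge> R" "\<epsilon>' \<le> \<epsilon>"
  shows "hull_nbhd \<Lambda> \<Lambda>' R' \<epsilon>' \<subseteq> hull_nbhd \<Lambda> \<Lambda>' R \<epsilon>"
proof
  fix X assume "X \<in> hull_nbhd \<Lambda> \<Lambda>' R' \<epsilon>'"
  then obtain L t where X: "X = shift t L" "L \<in> hull_set \<Lambda>"
      "L \<inter> cball 0 R' = \<Lambda>' \<inter> cball 0 R'" "t \<in> ball 0 \<epsilon>'"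
    unfolding hull_nbhd_def by auto
  have "cball 0 R' \<inter> cball 0 R = (cball 0 R :: 'a set)"
    using assms by auto
  then have "L \<inter> cball 0 R = \<Lambda>' \<inter> cball 0 R"
    using X(3) by blast
  moreover have "t \<in> ball 0 \<epsilon>"
    using X(4) assms(2) by auto
  ultimately show "X \<in> hull_nbhd \<Lambda> \<Lambda>' R \<epsilon>"
    unfolding hull_nbhd_def using X(1,2) by blast
qed

lemma istopology_hull_open: "istopology (hull_open \<Lambda>)"
  unfolding istopology_def
proof (intro conjI allI impI)
  fix U V assume U: "hull_open \<Lambda> U" and V: "hull_open \<Lambda> V"
  show "hull_open \<Lambda> (U \<inter> V)"
    unfolding hull_open_def
  proof (intro conjI ballI)
    show "U \<inter> V \<subseteq> hull_set \<Lambda>" using U unfolding hull_open_def by auto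
    fix L assume L: "L \<in> U \<inter> V"
    obtain R1 e1 where 1: "0 < e1" "e1 < R1/2" "hull_nbhd \<Lambda> L R1 e1 \<subseteq> U"
      using L U unfolding hull_open_def by blast
    obtain R2 e2 where 2: "0 < e2" "e2 < R2/2" "hull_nbhd \<Lambda> L R2 e2 \<subseteq> V"
      using L V unfolding hull_open_def by blast
    have "hull_nbhd \<Lambda> L (max R1 R2) (min e1 e2) \<subseteq> U \<inter> V"
      using hull_nbhd_mono[of R1 "max R1 R2" "min e1 e2" e1 \<Lambda> L]
            hull_nbhd_mono[of R2 "max R1 R2" "min e1 e2" e2 \<Lambda> L] 1(3) 2(3) by auto
    moreover have "0 < min e1 e2" "min e1 e2 < max R1 R2 / 2"
      using 1 2 by auto
    ultimately show "\<exists>R e. 0 < e \<and> e < R/2 \<and> hull_nbhd \<Lambda> L R e \<subseteq> U \<inter> V"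
      by blast
  qed
next
  fix K assume K: "\<forall>U\<in>K. hull_open \<Lambda> U"
  show "hull_open \<Lambda> (\<Union>K)"
    unfolding hull_open_def
  proof (intro conjI ballI)
    show "\<Union>K \<subseteq> hull_set \<Lambda>" using K unfolding hull_open_def by auto
    fix L assume "L \<in> \<Union>K"
    then obtain U where U: "U \<in> K" "L \<in> U" by auto
    then obtain R e where "0 < e" "e < R/2" "hull_nbhd \<Lambda> L R e \<subseteq> U"
      using K unfolding hull_open_def by blast
    with U show "\<exists>R e. 0 < e \<and> e < R/2 \<and> hull_nbhd \<Lambda> L R e \<subseteq> \<Union>K"
      by blast
  qed
qed

lemma openin_hull_topology: "openin (hull_topology \<Lambda>) U \<longleftrightarrow> hull_open \<Lambda> U"
  unfolding hull_topology_def by (simp add: istopology_hull_open topology_inverse')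

lemma mem_shift: "x \<in> shift t \<Lambda> \<longleftrightarrow> x + t \<in> \<Lambda>"
proof
  assume "x \<in> shift t \<Lambda>" then show "x + t \<in> \<Lambda>"
    unfolding shift_def by auto
next
  assume "x + t \<in> \<Lambda>"
  then have "x + t - t \<in> shift t \<Lambda>"
    unfolding shift_def by (rule imageI)
  then show "x \<in> shift t \<Lambda>" by simp
qed

lemma shift_shift: "shift u (shift t \<Lambda>) = shift (t + u) \<Lambda>"
  by (rule set_eqI) (simp add: mem_shift add.assoc add.commute[of u])

lemma cpatch_alt: "cpatch \<rho> \<Lambda> t = shift t \<Lambda> \<inter> cball 0 \<rho>"
proof (rule set_eqI)
  fix x
  have "dist t (x + t) = norm x" by (simp add: dist_norm)
  then show "x \<in> cpatch \<rho> \<Lambda> t \<longleftrightarrow> x \<in> shift t \<Lambda> \<inter> cball 0 \<rho>"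
    unfolding cpatch_def by (simp add: mem_shift)
qed

lemma delone_shift: assumes "delone \<Lambda>" shows "delone (shift t \<Lambda>)"
proof -
  have b: "x + t \<in> cball (y + t) r \<longleftrightarrow> x \<in> cball y r" for x y r
    by (simp add: dist_norm)
  obtain r where r: "r > 0" "\<forall>x. \<forall>p\<in>\<Lambda> \<inter> cball x r. \<forall>q\<in>\<Lambda> \<inter> cball x r. p = q"
    using assms unfolding delone_def uniformly_discrete_def by auto
  have "p = q" if p: "p \<in> shift t \<Lambda> \<inter> cball x r" and q: "q \<in> shift t \<Lambda> \<inter> cball x r" for p q x
  proof -
    have "p + t \<in> \<Lambda> \<inter> cball (x + t) r" "q + t \<in> \<Lambda> \<inter> cball (x + t) r"
      using p q b by (simp_all add: mem_shift)
    then have "p + t = q + t" using r(2) by blast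
    then show ?thesis by simp
  qed
  then have 1: "uniformly_discrete (shift t \<Lambda>)"
    unfolding uniformly_discrete_def using r(1) by blast
  obtain R where R: "R > 0" "\<forall>x. \<Lambda> \<inter> cball x R \<noteq> {}"
    using assms unfolding delone_def relatively_dense_def by auto
  have "shift t \<Lambda> \<inter> cball x R \<noteq> {}" for x
  proof -
    obtain y where y: "y \<in> \<Lambda>" "y \<in> cball (x + t) R" using R(2) by blast
    then have "y - t \<in> shift t \<Lambda>" "y - t \<in> cball x R"
      using b[of "y - t" x R] by (simp_all add: mem_shift)
    then show ?thesis by blast
  qed
  then have "relatively_dense (shift t \<Lambda>)"
    unfolding relatively_dense_def using R(1) by blast
  with 1 show ?thesis unfolding delone_def by simp
qed

lemma hull_setD:
  assumes "\<Lambda>' \<in> hull_set \<Lambda>"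
  shows "delone \<Lambda>'" and "\<rho> > 0 \<Longrightarrow> \<exists>t'. cpatch \<rho> \<Lambda>' t = cpatch \<rho> \<Lambda> t'"
  using assms unfolding hull_set_def mem_Collect_eq by (iprover+)

lemma shift_in_hull_set:
  assumes "\<Lambda>' \<in> hull_set \<Lambda>" shows "shift t \<Lambda>' \<in> hull_set \<Lambda>"
  unfolding hull_set_def mem_Collect_eq
proof (intro conjI allI impI)
  show "delone (shift t \<Lambda>')"
    by (rule delone_shift[OF hull_setD(1)[OF assms]])
next
  fix \<rho> :: real and u assume "\<rho> > 0"
  have "cpatch \<rho> (shift t \<Lambda>') u = cpatch \<rho> \<Lambda>' (t + u)"
    by (simp only: cpatch_alt shift_shift)
  then show "\<exists>u'. cpatch \<rho> (shift t \<Lambda>') u = cpatch \<rho> \<Lambda> u'"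
    using hull_setD(2)[OF assms \<open>\<rho> > 0\<close>, of "t + u"] by (simp only:)
qed

lemma hull_nbhd_subset: "hull_nbhd \<Lambda> \<Lambda>' R \<epsilon> \<subseteq> hull_set \<Lambda>"
proof
  fix X assume "X \<in> hull_nbhd \<Lambda> \<Lambda>' R \<epsilon>"
  then obtain L t where "X = shift t L" "L \<in> hull_set \<Lambda>"
    unfolding hull_nbhd_def mem_Collect_eq by (elim exE conjE)
  then show "X \<in> hull_set \<Lambda>"
    by (simp only: shift_in_hull_set)
qed

lemma topspace_hull_topology: "topspace (hull_topology \<Lambda>) = hull_set \<Lambda>"
proof -
  have "\<exists>R \<epsilon>. 0 < \<epsilon> \<and> \<epsilon> < R / 2 \<and> hull_nbhd \<Lambda> L R \<epsilon> \<subseteq> hull_set \<Lambda>" for L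
  proof -
    have "(0::real) < 1 \<and> (1::real) < 4 / 2 \<and> hull_nbhd \<Lambda> L 4 1 \<subseteq> hull_set \<Lambda>"
      using hull_nbhd_subset by simp
    then show ?thesis by (rule_tac exI, rule_tac exI)
  qed
  then have "hull_open \<Lambda> (hull_set \<Lambda>)"
    unfolding hull_open_def by simp
  then have o: "openin (hull_topology \<Lambda>) (hull_set \<Lambda>)"
    by (simp only: openin_hull_topology)
  have "hull_open \<Lambda> (topspace (hull_topology \<Lambda>))"
    using openin_topspace by (simp only: openin_hull_topology[symmetric])
  then have "topspace (hull_topology \<Lambda>) \<subseteq> hull_set \<Lambda>"
    unfolding hull_open_def by (rule conjunct1)
  then show ?thesis
    using openin_subset[OF o] by (rule subset_antisym)
qed

section \<open>Euclidean spaces of variable dimension and tori\<close>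

text \<open>\<open>\<real>\<^sup>n\<close> is the set of extensional functions on \<open>{..<n}\<close>, so that it is both the carrier of
  the library's product topology and the space of the library's product measure; Lebesgue measure
  is \<open>\<Pi>\<^sub>M i\<in>{..<n}. lborel\<close>.\<close>

definition rn :: "nat \<Rightarrow> (nat \<Rightarrow> real) set" where
  "rn n = ({..<n} \<rightarrow>\<^sub>E UNIV)"

definition rn_topology :: "nat \<Rightarrow> (nat \<Rightarrow> real) topology" where
  "rn_topology n = product_topology (\<lambda>_. euclideanreal) {..<n}"

definition rn_lebesgue :: "nat \<Rightarrow> (nat \<Rightarrow> real) measure" where
  "rn_lebesgue n = (\<Pi>\<^sub>M i\<in>{..<n}. lborel)"

definition rn_add :: "nat \<Rightarrow> (nat \<Rightarrow> real) \<Rightarrow> (nat \<Rightarrow> real) \<Rightarrow> (nat \<Rightarrow> real)" where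
  "rn_add n x y = (\<lambda>i\<in>{..<n}. x i + y i)"

definition rn_translate :: "nat \<Rightarrow> (nat \<Rightarrow> real) \<Rightarrow> (nat \<Rightarrow> real) set \<Rightarrow> (nat \<Rightarrow> real) set" where
  "rn_translate n w V = rn_add n w ` V"

lemma topspace_rn_topology: "topspace (rn_topology n) = rn n"
  unfolding rn_topology_def rn_def by simp

lemma space_rn_lebesgue: "space (rn_lebesgue n) = rn n"
  unfolding rn_lebesgue_def rn_def by (simp add: space_PiM)

definition quotient_topology :: "'a topology \<Rightarrow> ('a \<Rightarrow> 'b) \<Rightarrow> 'b topology" where
  "quotient_topology X f =
     topology (\<lambda>U. U \<subseteq> f ` topspace X \<and> openin X {x \<in> topspace X. f x \<in> U})"

lemma openin_quotient_topology:
  "openin (quotient_topology X f) U \<longleftrightarrow>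
     U \<subseteq> f ` topspace X \<and> openin X {x \<in> topspace X. f x \<in> U}"
proof -
  have "istopology (\<lambda>U. U \<subseteq> f ` topspace X \<and> openin X {x \<in> topspace X. f x \<in> U})"
    unfolding istopology_def
  proof (intro conjI allI impI)
    fix S T
    assume S: "S \<subseteq> f ` topspace X \<and> openin X {x \<in> topspace X. f x \<in> S}"
      and T: "T \<subseteq> f ` topspace X \<and> openin X {x \<in> topspace X. f x \<in> T}"
    show "S \<inter> T \<subseteq> f ` topspace X" using S by auto
    have "{x \<in> topspace X. f x \<in> S \<inter> T} =
        {x \<in> topspace X. f x \<in> S} \<inter> {x \<in> topspace X. f x \<in> T}" by auto
    then show "openin X {x \<in> topspace X. f x \<in> S \<inter> T}" using S T by auto
  next
    fix K assume K: "\<forall>S\<in>K. S \<subseteq> f ` topspace X \<and> openin X {x \<in> topspace X. f x \<in> S}"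
    show "\<Union>K \<subseteq> f ` topspace X" using K by auto
    have "{x \<in> topspace X. f x \<in> \<Union>K} = (\<Union>S\<in>K. {x \<in> topspace X. f x \<in> S})" by auto
    then show "openin X {x \<in> topspace X. f x \<in> \<Union>K}" using K by auto
  qed
  then show ?thesis
    unfolding quotient_topology_def by (simp add: topology_inverse')
qed

lemma topspace_quotient_topology: "topspace (quotient_topology X f) = f ` topspace X"
proof -
  have "{x \<in> topspace X. f x \<in> f ` topspace X} = topspace X" by auto
  then have "openin (quotient_topology X f) (f ` topspace X)"
    unfolding openin_quotient_topology by simp
  then show ?thesis
    unfolding topspace_def[of "quotient_topology X f"] by (auto simp: openin_quotient_topology)
qed

lemma quotient_map_quotient_topology: "quotient_map X (quotient_topology X f) f"
  unfolding quotient_map_def topspace_quotient_topology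
  by (simp add: openin_quotient_topology)

text \<open>Points of \<open>\<real>\<^sup>s / \<int>\<^sup>s\<close> are cosets.  The translation of a coset \<open>w\<close> by \<open>v\<close>, i.e. the sum of
  \<open>w\<close> and the class of \<open>v\<close>, is \<open>rn_translate s v w\<close>.\<close>

definition torus_class :: "nat \<Rightarrow> (nat \<Rightarrow> real) \<Rightarrow> (nat \<Rightarrow> real) set" where
  "torus_class s x = {y \<in> rn s. \<forall>i<s. y i - x i \<in> \<int>}"

definition torus_topology :: "nat \<Rightarrow> (nat \<Rightarrow> real) set topology" where
  "torus_topology s = quotient_topology (rn_topology s) (torus_class s)"

section \<open>Topological dynamics\<close>

definition equivariant_map ::
    "'x topology \<Rightarrow> ('g \<Rightarrow> 'x \<Rightarrow> 'x) \<Rightarrow> 'y topology \<Rightarrow> ('g \<Rightarrow> 'y \<Rightarrow> 'y) \<Rightarrow> ('x \<Rightarrow> 'y) \<Rightarrow> bool" where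
  "equivariant_map X a Y b f \<longleftrightarrow>
     continuous_map X Y f \<and> (\<forall>t. \<forall>x\<in>topspace X. f (a t x) = b t (f x))"

definition factor_map ::
    "'x topology \<Rightarrow> ('g \<Rightarrow> 'x \<Rightarrow> 'x) \<Rightarrow> 'y topology \<Rightarrow> ('g \<Rightarrow> 'y \<Rightarrow> 'y) \<Rightarrow> ('x \<Rightarrow> 'y) \<Rightarrow> bool" where
  "factor_map X a Y b f \<longleftrightarrow> equivariant_map X a Y b f \<and> f ` topspace X = topspace Y"

definition invariant_probability :: "'y topology \<Rightarrow> ('g \<Rightarrow> 'y \<Rightarrow> 'y) \<Rightarrow> 'y measure \<Rightarrow> bool" where
  "invariant_probability Y b \<mu> \<longleftrightarrow>
     prob_space \<mu> \<and> space \<mu> = topspace Y \<and> sets \<mu> = sigma_sets (topspace Y) {U. openin Y U} \<and>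
     (\<forall>t. b t \<in> \<mu> \<rightarrow>\<^sub>M \<mu> \<and> distr \<mu> \<mu> (b t) = \<mu>)"

definition unique_ergodic_measure :: "'y topology \<Rightarrow> ('g \<Rightarrow> 'y \<Rightarrow> 'y) \<Rightarrow> 'y measure \<Rightarrow> bool" where
  "unique_ergodic_measure Y b \<mu> \<longleftrightarrow>
     invariant_probability Y b \<mu> \<and> (\<forall>\<nu>. invariant_probability Y b \<nu> \<longrightarrow> \<nu> = \<mu>)"

section \<open>The address system\<close>

definition is_Z_basis :: "nat \<Rightarrow> (nat \<Rightarrow> 'a::euclidean_space) \<Rightarrow> 'a set \<Rightarrow> bool" where
  "is_Z_basis s b G \<longleftrightarrow> (\<forall>i<s. b i \<in> G) \<and>
     (\<forall>x\<in>G. \<exists>!c. c \<in> ({..<s} \<rightarrow>\<^sub>E (UNIV :: int set)) \<and> x = (\<Sum>i<s. of_int (c i) *\<^sub>R b i))"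

definition Z_coord :: "nat \<Rightarrow> (nat \<Rightarrow> 'a::euclidean_space) \<Rightarrow> 'a \<Rightarrow> (nat \<Rightarrow> int)" where
  "Z_coord s b x =
     (THE c. c \<in> ({..<s} \<rightarrow>\<^sub>E (UNIV :: int set)) \<and> x = (\<Sum>i<s. of_int (c i) *\<^sub>R b i))"

definition Z_rank :: "'a::euclidean_space set \<Rightarrow> nat" where
  "Z_rank G = (THE s. \<exists>b. is_Z_basis s b G)"

definition linear_to_rn :: "nat \<Rightarrow> ('a::euclidean_space \<Rightarrow> nat \<Rightarrow> real) \<Rightarrow> bool" where
  "linear_to_rn s \<l> \<longleftrightarrow> (\<forall>t. \<l> t \<in> rn s) \<and> (\<forall>i<s. linear (\<lambda>t. \<l> t i))"

definition address_linear_map ::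
    "'a::euclidean_space set \<Rightarrow> nat \<Rightarrow> (nat \<Rightarrow> 'a) \<Rightarrow> ('a \<Rightarrow> nat \<Rightarrow> real) \<Rightarrow> bool" where
  "address_linear_map \<Lambda> s b \<l> \<longleftrightarrow> linear_to_rn s \<l> \<and>
     (\<exists>C>0. \<forall>\<Lambda>\<^sub>0\<in>transversal \<Lambda>. \<forall>t\<in>\<Lambda>\<^sub>0.
        L2_set (\<lambda>i. real_of_int (Z_coord s b t i) - \<l> t i) {..<s} \<le> C)"

definition address_action ::
    "nat \<Rightarrow> ('a::euclidean_space \<Rightarrow> nat \<Rightarrow> real) \<Rightarrow> 'a \<Rightarrow> (nat \<Rightarrow> real) set \<Rightarrow> (nat \<Rightarrow> real) set" where
  "address_action s \<l> t w = rn_translate s (\<l> t) w"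

definition address_homomorphism ::
    "'a::euclidean_space set \<Rightarrow> nat \<Rightarrow> ('a \<Rightarrow> nat \<Rightarrow> real) \<Rightarrow> ('a set \<Rightarrow> (nat \<Rightarrow> real) set) \<Rightarrow> bool" where
  "address_homomorphism \<Lambda> s \<l> \<pi> \<longleftrightarrow>
     equivariant_map (hull_topology \<Lambda>) shift (torus_topology s) (address_action s \<l>) \<pi>"

section \<open>Inter-model sets with Euclidean internal space\<close>

definition graph_on :: "'a set \<Rightarrow> ('a \<Rightarrow> 'b) \<Rightarrow> ('a \<times> 'b) set" where
  "graph_on \<Gamma> \<sigma> = {(\<gamma>, \<sigma> \<gamma>) | \<gamma>. \<gamma> \<in> \<Gamma>}"

definition graph_coset ::
    "nat \<Rightarrow> 'a::euclidean_space set \<Rightarrow> ('a \<Rightarrow> nat \<Rightarrow> real) \<Rightarrow> 'a \<times> (nat \<Rightarrow> real)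
       \<Rightarrow> ('a \<times> (nat \<Rightarrow> real)) set" where
  "graph_coset n \<Gamma> \<sigma> p = (\<lambda>(\<gamma>, v). (fst p + \<gamma>, rn_add n (snd p) v)) ` graph_on \<Gamma> \<sigma>"

definition euclidean_cps ::
    "nat \<Rightarrow> 'a::euclidean_space set \<Rightarrow> ('a \<Rightarrow> nat \<Rightarrow> real) \<Rightarrow> bool" where
  "euclidean_cps n \<Gamma> \<sigma> \<longleftrightarrow>
     n > 0 \<and> countable \<Gamma> \<and>
     0 \<in> \<Gamma> \<and> (\<forall>x\<in>\<Gamma>. \<forall>y\<in>\<Gamma>. x - y \<in> \<Gamma>) \<and>
     \<sigma> ` \<Gamma> \<subseteq> rn n \<and> (\<forall>x\<in>\<Gamma>. \<forall>y\<in>\<Gamma>. \<sigma> (x + y) = rn_add n (\<sigma> x) (\<sigma> y)) \<and>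
     (rn_topology n) closure_of (\<sigma> ` \<Gamma>) = rn n \<and>
     subtopology (prod_topology euclidean (rn_topology n)) (graph_on \<Gamma> \<sigma>)
       = discrete_topology (graph_on \<Gamma> \<sigma>) \<and>
     compact_space
       (quotient_topology (prod_topology euclidean (rn_topology n)) (graph_coset n \<Gamma> \<sigma>))"

definition window :: "nat \<Rightarrow> (nat \<Rightarrow> real) set \<Rightarrow> bool" where
  "window n W \<longleftrightarrow> compactin (rn_topology n) W \<and>
     W = (rn_topology n) closure_of ((rn_topology n) interior_of W)"

definition proj_set :: "'a::euclidean_space set \<Rightarrow> ('a \<Rightarrow> nat \<Rightarrow> real) \<Rightarrow> (nat \<Rightarrow> real) set \<Rightarrow> 'a set" where
  "proj_set \<Gamma> \<sigma> V = {t \<in> \<Gamma>. \<sigma> t \<in> V}"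

text \<open>The boundary is required to lie in \<open>null_sets\<close>, since \<open>emeasure\<close> vanishes by convention on
  non-measurable sets.\<close>

definition regular_inter_model_set :: "'a::euclidean_space set \<Rightarrow> bool" where
  "regular_inter_model_set \<Lambda> \<longleftrightarrow> delone \<Lambda> \<and>
     (\<exists>n \<Gamma> \<sigma> W t w.
        euclidean_cps n \<Gamma> \<sigma> \<and> window n W \<and> w \<in> rn n \<and>
        shift t (proj_set \<Gamma> \<sigma> (rn_translate n w ((rn_topology n) interior_of W))) \<subseteq> \<Lambda> \<and>
        \<Lambda> \<subseteq> shift t (proj_set \<Gamma> \<sigma> (rn_translate n w W)) \<and>
        (rn_topology n) frontier_of (rn_translate n w W) \<in> null_sets (rn_lebesgue n))"

end

theory Submission
  imports Defs "HOL-Library.Diagonal_Subsequence"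
begin

text \<open>Let \<open>G = \<langle>\<Lambda> - \<Lambda>\<rangle>\<close> and let \<open>lin : \<real>\<^sup>s \<rightarrow> \<real>\<^sup>d\<close> send the unit vectors to the basis of \<open>G\<close>.  Since
  \<open>coord - \<l>\<close> is bounded on the relatively dense set \<open>\<Lambda> - \<Lambda>\<close>, \<open>lin \<circ> \<l> = id\<close>, so that
  \<open>\<real>\<^sup>s = \<l>(\<real>\<^sup>d) \<oplus> ker lin\<close> and the lattice \<open>\<int>\<^sup>s\<close> becomes the graph of a homomorphism
  \<open>\<sigma> : G \<rightarrow> \<real>\<^sup>n\<close>, \<open>n = s - d\<close>, where \<open>S : \<real>\<^sup>s \<rightarrow> \<real>\<^sup>n\<close> with kernel \<open>\<l>(\<real>\<^sup>d)\<close> extends \<open>\<sigma>\<close>.  Conversely every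
  Euclidean cut and project scheme producing \<open>\<Lambda>\<close> is of this form: its group is \<open>G\<close>, because a
  model set with open window generates it, and discreteness and cocompactness of the graph make
  \<open>(lin, S)\<close> an isomorphism; \<open>S \<circ> \<l>\<close> vanishes, being linear and bounded on \<open>\<Lambda> - \<Lambda>\<close>.

  In these coordinates the address of an element of the hull determines it up to lattice points
  over the boundary of the window.  So a null boundary gives almost everywhere unique preimages.
  In the other direction the closure \<open>W\<close> of \<open>\<sigma>(\<Lambda>)\<close> (for \<open>0 \<in> \<Lambda>\<close>) is the window: by compactness of the
  hull, a point of \<open>W\<close> whose address has a unique preimage is interior to \<open>W\<close>, hence the boundary
  consists of exceptional addresses.  Null sets are transferred between \<open>\<real>\<^sup>s\<close> and \<open>\<real>\<^sup>n\<close> by Fubini's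
  theorem, and unique ergodicity follows since an invariant measure is invariant under the
  closure of \<open>\<l>(\<real>\<^sup>d) + \<int>\<^sup>s\<close>.\<close>

section \<open>Topology and measure on \<open>\<real>\<^sup>n\<close>\<close>

text \<open>A continuous \<pi> says nothing direct about the points of an element of the hull.
  \<open>hull_approx\<close> is the bridge: repetitivity makes any two elements agree on a large
  ball after a translation u, continuity makes their phases agree up to \<delta>, and the remaining
  ambiguity of a phase is \<open>coord h\<close> for a lattice point h. Applying \<open>lin\<close>
  and \<open>S\<close> to this one relation carries inclusions between a model set and a single
  element (outer for compact windows, inner for open ones) to the whole hull. The error \<delta> can
  be sent to 0 because lattice points with bounded norm and bounded \<sigma> form a finite set: one
  that works for arbitrarily small errors works exactly. Both implications share the locale
  \<open>cut_project\<close>; a given scheme enters it through \<open>lattice_data\<close>, the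
  constructed one through \<open>ex_cut_project\<close>. The obstacle in the construction is that
  \<Lambda> itself may have an exceptional address. The inner inclusion is therefore first proved
  for an element whose address has a unique preimage, which exists because exceptional addresses are
  null, and is then carried over to \<Lambda>.\<close>

lemma rn_restrict [simp]: "(\<lambda>i\<in>{..<n}. f i) \<in> rn n"
  unfolding rn_def by auto

lemma rn_add_in_rn [simp]: "rn_add n x y \<in> rn n"
  unfolding rn_add_def by simp

lemma rn_eqI:
  assumes "x \<in> rn n" "y \<in> rn n" "\<And>i. i < n \<Longrightarrow> x i = y i"
  shows "x = y"
  using assms unfolding rn_def by (intro PiE_ext) auto

text \<open>With finitely many coordinates, every product neighborhood of a point contains a
  sup-norm box around it and conversely; all topology below is done with such boxes.\<close>

lemma openin_rn:
  "openin (rn_topology n) U \<longleftrightarrow>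
    U \<subseteq> rn n \<and> (\<forall>x\<in>U. \<exists>\<epsilon>>0. \<forall>y\<in>rn n. (\<forall>i<n. \<bar>y i - x i\<bar> < \<epsilon>) \<longrightarrow> y \<in> U)"
proof
  assume U: "openin (rn_topology n) U"
  have "\<exists>\<epsilon>>0. \<forall>y\<in>rn n. (\<forall>i<n. \<bar>y i - x i\<bar> < \<epsilon>) \<longrightarrow> y \<in> U" if "x \<in> U" for x
  proof -
    have "\<exists>V. finite {i \<in> {..<n}. V i \<noteq> topspace euclideanreal} \<and>
        (\<forall>i\<in>{..<n}. openin euclideanreal (V i)) \<and> x \<in> Pi\<^sub>E {..<n} V \<and> Pi\<^sub>E {..<n} V \<subseteq> U"
      using U that unfolding rn_topology_def openin_product_topology_alt by (rule bspec)
    then obtain V where V0: "finite {i \<in> {..<n}. V i \<noteq> topspace euclideanreal} \<and>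
        (\<forall>i\<in>{..<n}. openin euclideanreal (V i)) \<and> x \<in> Pi\<^sub>E {..<n} V \<and> Pi\<^sub>E {..<n} V \<subseteq> U"
      by (rule exE)
    have V: "x \<in> Pi\<^sub>E {..<n} V" "Pi\<^sub>E {..<n} V \<subseteq> U"
      using V0 by iprover+
    have V1: "open (V i)" if "i < n" for i
      using conjunct1[OF conjunct2[OF V0]] that by simp
    have "\<exists>e>0. \<forall>t. \<bar>t - x i\<bar> < e \<longrightarrow> t \<in> V i" if "i < n" for i
      using V1[OF that] PiE_mem[OF V(1), of i] that unfolding open_dist dist_real_def by simp
    then obtain e where e: "\<And>i. i < n \<Longrightarrow> e i > 0 \<and> (\<forall>t. \<bar>t - x i\<bar> < e i \<longrightarrow> t \<in> V i)"
      by metis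
    \<comment> \<open>Inserting 1 keeps the minimum defined for n = 0; the same device returns
      wherever a \<open>Min\<close> over coordinates is taken.\<close>
    define \<epsilon> where "\<epsilon> = Min (insert 1 (e ` {..<n}))"
    have "\<epsilon> > 0" "\<And>i. i < n \<Longrightarrow> \<epsilon> \<le> e i"
      unfolding \<epsilon>_def using e by auto
    moreover have "y \<in> U" if "y \<in> rn n" "\<forall>i<n. \<bar>y i - x i\<bar> < \<epsilon>" for y
    proof -
      have "y \<in> Pi\<^sub>E {..<n} V"
        using that calculation(2) e unfolding rn_def by (force simp: PiE_iff)
      then show ?thesis using V(2) by (rule rev_subsetD)
    qed
    ultimately show ?thesis by blast
  qed
  with openin_subset[OF U] show "U \<subseteq> rn n \<and> (\<forall>x\<in>U. \<exists>\<epsilon>>0. \<forall>y\<in>rn n. (\<forall>i<n. \<bar>y i - x i\<bar> < \<epsilon>) \<longrightarrow> y \<in> U)"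
    by (simp add: topspace_rn_topology)
next
  assume U: "U \<subseteq> rn n \<and> (\<forall>x\<in>U. \<exists>\<epsilon>>0. \<forall>y\<in>rn n. (\<forall>i<n. \<bar>y i - x i\<bar> < \<epsilon>) \<longrightarrow> y \<in> U)"
  show "openin (rn_topology n) U"
    unfolding rn_topology_def openin_product_topology_alt
  proof (intro ballI)
    fix x assume x: "x \<in> U"
    then obtain \<epsilon> where \<epsilon>: "\<epsilon> > 0" "\<And>y. y \<in> rn n \<Longrightarrow> (\<forall>i<n. \<bar>y i - x i\<bar> < \<epsilon>) \<Longrightarrow> y \<in> U"
      using U by blast
    have "Pi\<^sub>E {..<n} (\<lambda>i. if i < n then {x i - \<epsilon><..<x i + \<epsilon>} else UNIV) \<subseteq> U"
    proof
      fix y assume y: "y \<in> Pi\<^sub>E {..<n} (\<lambda>i. if i < n then {x i - \<epsilon><..<x i + \<epsilon>} else UNIV)"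
      then have "\<bar>y i - x i\<bar> < \<epsilon>" if "i < n" for i
        using that by (force simp: PiE_iff abs_less_iff)
      moreover have "y \<in> rn n" using y unfolding rn_def by (auto simp: PiE_iff)
      ultimately show "y \<in> U" using \<epsilon>(2) by blast
    qed
    moreover have "x \<in> Pi\<^sub>E {..<n} (\<lambda>i. if i < n then {x i - \<epsilon><..<x i + \<epsilon>} else UNIV)"
      using x U \<epsilon>(1) unfolding rn_def by (auto simp: PiE_iff)
    moreover have "finite {i. (if i < n then {x i - \<epsilon><..<x i + \<epsilon>} else UNIV) \<noteq> UNIV}"
      by (rule finite_subset[of _ "{..<n}"]) auto
    ultimately show "\<exists>Ua. finite {i \<in> {..<n}. Ua i \<noteq> topspace euclideanreal} \<and>
          (\<forall>i\<in>{..<n}. openin euclideanreal (Ua i)) \<and> x \<in> Pi\<^sub>E {..<n} Ua \<and> Pi\<^sub>E {..<n} Ua \<subseteq> U"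
      by (intro exI[of _ "\<lambda>i. if i < n then {x i - \<epsilon><..<x i + \<epsilon>} else UNIV"]) auto
  qed
qed

lemma openin_rn_box: "openin (rn_topology n) {y \<in> rn n. \<forall>i<n. \<bar>y i - x i\<bar> < \<epsilon>}"
  unfolding openin_rn
proof (intro conjI ballI)
  fix y assume y: "y \<in> {y \<in> rn n. \<forall>i<n. \<bar>y i - x i\<bar> < \<epsilon>}"
  define d where "d = Min (insert 1 ((\<lambda>i. \<epsilon> - \<bar>y i - x i\<bar>) ` {..<n}))"
  have d: "d > 0" "\<And>i. i < n \<Longrightarrow> d \<le> \<epsilon> - \<bar>y i - x i\<bar>"
    unfolding d_def using y by auto
  have "\<bar>z i - x i\<bar> < \<epsilon>" if "\<bar>z i - y i\<bar> < d" "i < n" for z i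
    using that d(2)[of i] by linarith
  then show "\<exists>\<epsilon>'>0. \<forall>z\<in>rn n. (\<forall>i<n. \<bar>z i - y i\<bar> < \<epsilon>') \<longrightarrow> z \<in> {y \<in> rn n. \<forall>i<n. \<bar>y i - x i\<bar> < \<epsilon>}"
    using d(1) by blast
qed auto

lemma in_closure_of_rn:
  assumes "A \<subseteq> rn n"
  shows "x \<in> rn_topology n closure_of A \<longleftrightarrow>
    x \<in> rn n \<and> (\<forall>\<epsilon>>0. \<exists>y\<in>A. \<forall>i<n. \<bar>y i - x i\<bar> < \<epsilon>)"
proof -
  have 1: "\<exists>y\<in>A. \<forall>i<n. \<bar>y i - x i\<bar> < \<epsilon>"
    if x: "x \<in> rn n" "\<forall>T. x \<in> T \<and> openin (rn_topology n) T \<longrightarrow> (\<exists>y. y \<in> A \<and> y \<in> T)" "\<epsilon> > 0" for \<epsilon> :: real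
  proof -
    have "openin (rn_topology n) {y \<in> rn n. \<forall>i<n. \<bar>y i - x i\<bar> < \<epsilon>}" by (rule openin_rn_box)
    moreover have "x \<in> {y \<in> rn n. \<forall>i<n. \<bar>y i - x i\<bar> < \<epsilon>}"
      using x(1,3) by simp
    ultimately show ?thesis
      using x(2)[rule_format, of "{y \<in> rn n. \<forall>i<n. \<bar>y i - x i\<bar> < \<epsilon>}"] by fast
  qed
  have 2: "\<exists>y. y \<in> A \<and> y \<in> T"
    if "\<forall>\<epsilon>>0. \<exists>y\<in>A. \<forall>i<n. \<bar>y i - x i\<bar> < \<epsilon>" "x \<in> T" "openin (rn_topology n) T" for T
    using that assms unfolding openin_rn by (meson subsetD)
  show ?thesis
    unfolding in_closure_of topspace_rn_topology
  proof (intro iffI conjI allI impI)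
    fix \<epsilon> :: real
    assume "x \<in> rn n \<and> (\<forall>T. x \<in> T \<and> openin (rn_topology n) T \<longrightarrow> (\<exists>y. y \<in> A \<and> y \<in> T))" "\<epsilon> > 0"
    then show "\<exists>y\<in>A. \<forall>i<n. \<bar>y i - x i\<bar> < \<epsilon>"
      by (elim conjE) (rule 1)
  next
    fix T
    assume "x \<in> rn n \<and> (\<forall>\<epsilon>>0. \<exists>y\<in>A. \<forall>i<n. \<bar>y i - x i\<bar> < \<epsilon>)" "x \<in> T \<and> openin (rn_topology n) T"
    then show "\<exists>y. y \<in> A \<and> y \<in> T"
      by (elim conjE) (rule 2)
  qed simp_all
qed

lemma closedin_rnD:
  assumes "closedin (rn_topology n) W" "x \<in> rn n" "\<And>\<epsilon>. \<epsilon> > 0 \<Longrightarrow> \<exists>y\<in>W. \<forall>i<n. \<bar>y i - x i\<bar> < \<epsilon>"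
  shows "x \<in> W"
proof -
  have "W \<subseteq> rn n" using closedin_subset[OF assms(1)] by (simp add: topspace_rn_topology)
  then have "x \<in> rn_topology n closure_of W"
    using assms by (simp add: in_closure_of_rn)
  then show ?thesis using closure_of_closedin[OF assms(1)] by simp
qed

text \<open>Heine-Borel: the coordinate projections of a compact set are bounded, and a bounded
  closed set is a closed subset of a compact product of intervals.\<close>

lemma compactin_rn_iff:
  "compactin (rn_topology n) W \<longleftrightarrow> closedin (rn_topology n) W \<and> (\<exists>B. \<forall>w\<in>W. \<forall>i<n. \<bar>w i\<bar> \<le> B)"
proof
  assume W: "compactin (rn_topology n) W"
  have "Hausdorff_space (rn_topology n)"
    unfolding rn_topology_def by (simp add: Hausdorff_space_product_topology)
  then have "closedin (rn_topology n) W" using W compactin_imp_closedin by blast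
  moreover have "\<exists>B. \<forall>w\<in>W. \<forall>i<n. \<bar>w i\<bar> \<le> B"
  proof -
    have "\<exists>B. \<forall>w\<in>W. \<bar>w i\<bar> \<le> B" if "i < n" for i
    proof -
      have "continuous_map (rn_topology n) euclideanreal (\<lambda>x. x i)"
        unfolding rn_topology_def using that by (intro continuous_map_product_projection) auto
      then have "compact ((\<lambda>x. x i) ` W)"
        using image_compactin[OF W] by fastforce
      then show ?thesis using compact_imp_bounded bounded_real by (metis imageI)
    qed
    then obtain B where B: "\<And>i w. i < n \<Longrightarrow> w \<in> W \<Longrightarrow> \<bar>w i\<bar> \<le> B i" by metis
    have "\<bar>w i\<bar> \<le> Max (insert 0 (B ` {..<n}))" if "w \<in> W" "i < n" for w i
      using B[OF that(2,1)] that(2) by (intro order_trans[OF _ Max_ge[of _ "B i"]]) auto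
    then show ?thesis by blast
  qed
  ultimately show "closedin (rn_topology n) W \<and> (\<exists>B. \<forall>w\<in>W. \<forall>i<n. \<bar>w i\<bar> \<le> B)" by simp
next
  assume "closedin (rn_topology n) W \<and> (\<exists>B. \<forall>w\<in>W. \<forall>i<n. \<bar>w i\<bar> \<le> B)"
  then obtain B where W: "closedin (rn_topology n) W" and B: "\<And>w i. w \<in> W \<Longrightarrow> i < n \<Longrightarrow> \<bar>w i\<bar> \<le> B"
    by blast
  have "compactin (rn_topology n) (Pi\<^sub>E {..<n} (\<lambda>_. {-B..B}))"
    unfolding rn_topology_def by (simp add: compactin_PiE)
  moreover have "W \<subseteq> Pi\<^sub>E {..<n} (\<lambda>_. {-B..B})"
  proof
    fix w assume w: "w \<in> W"
    then have "w \<in> rn n" using closedin_subset[OF W] by (auto simp: topspace_rn_topology)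
    then show "w \<in> Pi\<^sub>E {..<n} (\<lambda>_. {-B..B})"
      using B[OF w] unfolding rn_def by (force simp: PiE_iff abs_le_iff)
  qed
  ultimately show "compactin (rn_topology n) W" using W closed_compactin by blast
qed

text \<open>Topology and product measure are built independently, so their Borel sets have to be
  matched: an open set is the union of the countably many rational boxes inside it.\<close>

lemma openin_rn_sets:
  assumes "openin (rn_topology n) U"
  shows "U \<in> sets (rn_lebesgue n)"
proof -
  define box where "box p q = Pi\<^sub>E {..<n} (\<lambda>i. {p i<..<q i})" for p q :: "nat \<Rightarrow> real"
  define Q where "Q = Pi\<^sub>E {..<n} (\<lambda>_. \<rat> :: real set)"
  have "countable Q" unfolding Q_def by (intro countable_PiE) (auto simp: countable_rat)
  have "U = (\<Union>pq \<in> {pq \<in> Q \<times> Q. box (fst pq) (snd pq) \<subseteq> U}. box (fst pq) (snd pq))"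
  proof
    show "U \<subseteq> (\<Union>pq \<in> {pq \<in> Q \<times> Q. box (fst pq) (snd pq) \<subseteq> U}. box (fst pq) (snd pq))"
    proof
      fix x assume x: "x \<in> U"
      then obtain \<epsilon> where \<epsilon>: "\<epsilon> > 0" "\<And>y. y \<in> rn n \<Longrightarrow> (\<forall>i<n. \<bar>y i - x i\<bar> < \<epsilon>) \<Longrightarrow> y \<in> U"
        using assms unfolding openin_rn by blast
      have "\<exists>p\<in>\<rat>. x i - \<epsilon> < p \<and> p < x i" "\<exists>q\<in>\<rat>. x i < q \<and> q < x i + \<epsilon>" for i
        using Rats_dense_in_real[of "x i - \<epsilon>" "x i"] Rats_dense_in_real[of "x i" "x i + \<epsilon>"] \<epsilon>(1) by auto
      then obtain p q where p: "\<And>i. p i \<in> \<rat> \<and> x i - \<epsilon> < p i \<and> p i < x i"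
        and q: "\<And>i. q i \<in> \<rat> \<and> x i < q i \<and> q i < x i + \<epsilon>"
        by metis
      \<comment> \<open>The corners must be extensional to lie in the countable set Q.\<close>
      define p' q' where "p' = restrict p {..<n}" and "q' = restrict q {..<n}"
      have "box p' q' \<subseteq> U"
      proof
        fix y assume y: "y \<in> box p' q'"
        have "\<bar>y i - x i\<bar> < \<epsilon>" if "i < n" for i
        proof -
          have "p i < y i" "y i < q i"
            using y that unfolding box_def p'_def q'_def by (auto simp: PiE_iff)
          then show ?thesis using p[of i] q[of i] by linarith
        qed
        moreover have "y \<in> rn n" using y unfolding box_def rn_def by (auto simp: PiE_iff)
        ultimately show "y \<in> U" using \<epsilon>(2) by blast
      qed
      moreover have "x \<in> rn n" using x openin_subset[OF assms] by (auto simp: topspace_rn_topology)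
      then have "x \<in> box p' q'"
        using p q unfolding box_def p'_def q'_def rn_def by (auto simp: PiE_iff)
      moreover have "p' \<in> Q" "q' \<in> Q" using p q unfolding p'_def q'_def Q_def by auto
      ultimately show "x \<in> (\<Union>pq \<in> {pq \<in> Q \<times> Q. box (fst pq) (snd pq) \<subseteq> U}. box (fst pq) (snd pq))"
        by (intro UN_I[of "(p', q')"]) auto
    qed
  qed blast
  moreover have "(\<Union>pq \<in> {pq \<in> Q \<times> Q. box (fst pq) (snd pq) \<subseteq> U}. box (fst pq) (snd pq)) \<in> sets (rn_lebesgue n)"
  proof (intro sets.countable_UN'')
    have "countable (Q \<times> Q)" using \<open>countable Q\<close> by simp
    then show "countable {pq \<in> Q \<times> Q. box (fst pq) (snd pq) \<subseteq> U}"
      by (rule countable_subset[rotated]) blast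
    show "box (fst pq) (snd pq) \<in> sets (rn_lebesgue n)" for pq
      unfolding box_def rn_lebesgue_def by (intro sets_PiM_I_finite) simp_all
  qed
  ultimately show ?thesis by simp
qed

lemma closedin_rn_sets:
  assumes "closedin (rn_topology n) U"
  shows "U \<in> sets (rn_lebesgue n)"
proof -
  have "rn n - U \<in> sets (rn_lebesgue n)"
    using assms by (intro openin_rn_sets) (simp add: closedin_def topspace_rn_topology)
  then have "rn n - (rn n - U) \<in> sets (rn_lebesgue n)"
    by (metis sets.compl_sets space_rn_lebesgue)
  moreover have "rn n - (rn n - U) = U"
    using closedin_subset[OF assms] by (auto simp: topspace_rn_topology)
  ultimately show ?thesis by simp
qed

section \<open>Translation invariance and null sets of Lebesgue measure\<close>

interpretation lborel_product: product_sigma_finite "\<lambda>_. lborel :: real measure"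
  by standard

lemma sigma_finite_rn_lebesgue: "sigma_finite_measure (rn_lebesgue n)"
  unfolding rn_lebesgue_def
  using lborel_product.sigma_finite[of "{..<n}"] by simp

lemma measurable_rn_lebesgueI:
  assumes "\<And>i. i < n \<Longrightarrow> (\<lambda>x. f x i) \<in> borel_measurable M" "f \<in> space M \<rightarrow> rn n"
  shows "f \<in> M \<rightarrow>\<^sub>M rn_lebesgue n"
  unfolding rn_lebesgue_def
  using assms by (intro measurable_PiM_single') (auto simp: rn_def)

lemma measurable_rn_component:
  "i < n \<Longrightarrow> (\<lambda>x. x i) \<in> borel_measurable (rn_lebesgue n)"
  unfolding rn_lebesgue_def using measurable_component_singleton[of i "{..<n}" "\<lambda>_. lborel"] by simp

text \<open>Boxes determine the product measure, and the preimage of a box under a coordinatewise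
  map is again a box. Serves translations of Lebesgue measure and rotations of the unit cube
  alike.\<close>

lemma (in product_sigma_finite) distr_PiM_measure_preserving:
  assumes I: "finite I"
    and f: "\<And>i. i \<in> I \<Longrightarrow> f i \<in> M i \<rightarrow>\<^sub>M M i" "\<And>i. i \<in> I \<Longrightarrow> distr (M i) (M i) (f i) = M i"
  shows "distr (PiM I M) (PiM I M) (\<lambda>x. \<lambda>i\<in>I. f i (x i)) = PiM I M"
proof (rule PiM_eqI[OF I])
  have m: "(\<lambda>x. \<lambda>i\<in>I. f i (x i)) \<in> PiM I M \<rightarrow>\<^sub>M PiM I M"
    using f(1) by (intro measurable_restrict) (auto intro: measurable_compose[OF measurable_component_singleton])
  fix A assume A: "\<And>i. i \<in> I \<Longrightarrow> A i \<in> sets (M i)"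
  have "(\<lambda>x. \<lambda>i\<in>I. f i (x i)) -` Pi\<^sub>E I A \<inter> space (PiM I M) = Pi\<^sub>E I (\<lambda>i. f i -` A i \<inter> space (M i))"
    by (auto simp: space_PiM PiE_iff)
  then have "emeasure (distr (PiM I M) (PiM I M) (\<lambda>x. \<lambda>i\<in>I. f i (x i))) (Pi\<^sub>E I A) =
      emeasure (PiM I M) (Pi\<^sub>E I (\<lambda>i. f i -` A i \<inter> space (M i)))"
    using A I by (subst emeasure_distr[OF m]) (auto intro!: sets_PiM_I_finite)
  also have "\<dots> = (\<Prod>i\<in>I. emeasure (M i) (f i -` A i \<inter> space (M i)))"
    using A f(1) by (intro emeasure_PiM[OF I]) (auto intro: measurable_sets)
  also have "\<dots> = (\<Prod>i\<in>I. emeasure (distr (M i) (M i) (f i)) (A i))"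
    using A f(1) by (intro prod.cong) (auto simp: emeasure_distr)
  also have "\<dots> = (\<Prod>i\<in>I. emeasure (M i) (A i))"
    using f(2) by simp
  finally show "emeasure (distr (PiM I M) (PiM I M) (\<lambda>x. \<lambda>i\<in>I. f i (x i))) (Pi\<^sub>E I A) = (\<Prod>i\<in>I. emeasure (M i) (A i))" .
qed simp

lemma rn_add_measurable [measurable]: "rn_add n u \<in> rn_lebesgue n \<rightarrow>\<^sub>M rn_lebesgue n"
  by (intro measurable_rn_lebesgueI) (auto simp: rn_add_def intro!: borel_measurable_add measurable_rn_component)

lemma distr_rn_lebesgue_translate:
  "distr (rn_lebesgue n) (rn_lebesgue n) (rn_add n u) = rn_lebesgue n"
proof -
  have "distr lborel lborel (\<lambda>x. u i + x) = lborel" for i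
  proof -
    have "distr lborel lborel (\<lambda>x. u i + x) = distr lborel borel ((+) (u i))"
      by (intro distr_cong) auto
    then show ?thesis using lborel_distr_plus[of "u i"] by simp
  qed
  then have "distr (PiM {..<n} (\<lambda>_. lborel)) (PiM {..<n} (\<lambda>_. lborel)) (\<lambda>x. \<lambda>i\<in>{..<n}. u i + x i)
      = PiM {..<n} (\<lambda>_. lborel)"
    using lborel_product.distr_PiM_measure_preserving[of "{..<n}" "\<lambda>i x. u i + x"] by simp
  then show ?thesis unfolding rn_lebesgue_def rn_add_def by simp
qed

lemma emeasure_rn_translate:
  assumes "A \<in> sets (rn_lebesgue n)"
  shows "emeasure (rn_lebesgue n) {x \<in> rn n. rn_add n u x \<in> A} = emeasure (rn_lebesgue n) A"
proof -
  have "emeasure (distr (rn_lebesgue n) (rn_lebesgue n) (rn_add n u)) A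
      = emeasure (rn_lebesgue n) (rn_add n u -` A \<inter> space (rn_lebesgue n))"
    by (rule emeasure_distr[OF rn_add_measurable assms])
  moreover have "rn_add n u -` A \<inter> space (rn_lebesgue n) = {x \<in> rn n. rn_add n u x \<in> A}"
    by (auto simp: space_rn_lebesgue)
  ultimately show ?thesis by (simp add: distr_rn_lebesgue_translate)
qed

text \<open>The value is 1 for n = 0 and infinite otherwise; being nonzero is what cancels this
  factor in the comparison of null sets.\<close>

lemma emeasure_rn_lebesgue_rn: "emeasure (rn_lebesgue n) (rn n) \<noteq> 0"
proof -
  have "emeasure (rn_lebesgue n) (rn n) = (\<Prod>i\<in>{..<n}. emeasure lborel (UNIV :: real set))"
    unfolding rn_def rn_lebesgue_def by (subst lborel_product.emeasure_PiM) auto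
  then show ?thesis by (simp add: ennreal_prod_eq_top)
qed

text \<open>Integrating the indicator of \<open>{(v, y). rn_add n y (H v) \<in> F}\<close> in both orders gives
  \<open>\<infinity> \<cdot> |F| = \<infinity> \<cdot> |H\<^sup>-\<^sup>1 F|\<close>; this replaces a linear change of variables.\<close>

lemma null_rn_affine_vimage_iff:
  assumes H: "H \<in> rn_lebesgue m \<rightarrow>\<^sub>M rn_lebesgue n"
    and surj: "\<And>y. y \<in> rn n \<Longrightarrow> \<exists>u. \<forall>v\<in>rn m. H (rn_add m u v) = rn_add n y (H v)"
    and F: "F \<in> sets (rn_lebesgue n)"
  shows "emeasure (rn_lebesgue m) {v \<in> rn m. H v \<in> F} = 0 \<longleftrightarrow> emeasure (rn_lebesgue n) F = 0"
proof -
  let ?M = "rn_lebesgue m" and ?N = "rn_lebesgue n"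
  interpret M: sigma_finite_measure ?M by (rule sigma_finite_rn_lebesgue)
  interpret N: sigma_finite_measure ?N by (rule sigma_finite_rn_lebesgue)
  interpret P: pair_sigma_finite ?M ?N ..
  have H': "H v \<in> rn n" if "v \<in> rn m" for v
    using measurable_space[OF H, of v] that by (simp add: space_rn_lebesgue)
  have Hi: "(\<lambda>v. H v i) \<in> borel_measurable ?M" if "i < n" for i
    using measurable_compose[OF H measurable_rn_component[OF that]] .
  have f: "(\<lambda>(v, y). rn_add n y (H v)) \<in> ?M \<Otimes>\<^sub>M ?N \<rightarrow>\<^sub>M ?N"
    using Hi measurable_rn_component[of _ n]
    by (intro measurable_rn_lebesgueI) (auto simp: rn_add_def split_beta)
  define E where "E = (\<lambda>(v, y). rn_add n y (H v)) -` F \<inter> space (?M \<Otimes>\<^sub>M ?N)"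
  have E: "E \<in> sets (?M \<Otimes>\<^sub>M ?N)"
    unfolding E_def by (rule measurable_sets[OF f F])
  have s1: "Pair v -` E = {y \<in> rn n. rn_add n (H v) y \<in> F}" if "v \<in> rn m" for v
    using that unfolding E_def by (auto simp: space_pair_measure space_rn_lebesgue rn_add_def add.commute)
  have "emeasure (?M \<Otimes>\<^sub>M ?N) E = (\<integral>\<^sup>+v. emeasure ?N (Pair v -` E) \<partial>?M)"
    by (rule N.emeasure_pair_measure_alt[OF E])
  also have "\<dots> = (\<integral>\<^sup>+v. emeasure ?N F \<partial>?M)"
    by (intro nn_integral_cong) (simp add: s1 space_rn_lebesgue emeasure_rn_translate[OF F])
  finally have e1: "emeasure (?M \<Otimes>\<^sub>M ?N) E = emeasure ?N F * emeasure ?M (rn m)"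
    by (simp add: space_rn_lebesgue)
  let ?V = "{v \<in> rn m. H v \<in> F}"
  have V: "?V \<in> sets ?M"
    using measurable_sets[OF H F] by (simp add: vimage_def Int_def space_rn_lebesgue conj_commute)
  \<comment> \<open>Adding y after H amounts to translating the argument by u, so this fiber is a
    translate of \<open>?V\<close> and has the same measure.\<close>
  have s2: "emeasure ?M ((\<lambda>v. (v, y)) -` E) = emeasure ?M ?V" if "y \<in> rn n" for y
  proof -
    obtain u where u: "\<And>v. v \<in> rn m \<Longrightarrow> H (rn_add m u v) = rn_add n y (H v)"
      using surj[OF \<open>y \<in> rn n\<close>] by blast
    have "(\<lambda>v. (v, y)) -` E = {v \<in> rn m. rn_add m u v \<in> ?V}"
      unfolding E_def using that by (auto simp: space_pair_measure space_rn_lebesgue u)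
    then show ?thesis by (simp only: emeasure_rn_translate[OF V])
  qed
  have "emeasure (?M \<Otimes>\<^sub>M ?N) E = (\<integral>\<^sup>+y. emeasure ?M ((\<lambda>v. (v, y)) -` E) \<partial>?N)"
    by (rule P.emeasure_pair_measure_alt2[OF E])
  also have "\<dots> = (\<integral>\<^sup>+y. emeasure ?M ?V \<partial>?N)"
    by (intro nn_integral_cong) (simp add: s2 space_rn_lebesgue)
  finally have e2: "emeasure (?M \<Otimes>\<^sub>M ?N) E = emeasure ?M ?V * emeasure ?N (rn n)"
    by (simp add: space_rn_lebesgue)
  have "emeasure ?N F * emeasure ?M (rn m) = 0 \<longleftrightarrow> emeasure ?M ?V * emeasure ?N (rn n) = 0"
    unfolding e1[symmetric] e2[symmetric] ..
  then show ?thesis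
    by (simp add: emeasure_rn_lebesgue_rn)
qed

text \<open>Bolzano-Weierstrass: the induction passes to a further subsequence for each new
  coordinate.\<close>

lemma rn_bounded_convergent_subsequence:
  fixes f :: "nat \<Rightarrow> nat \<Rightarrow> real"
  assumes "\<And>k i. i < n \<Longrightarrow> \<bar>f k i\<bar> \<le> B"
  shows "\<exists>r l. strict_mono (r :: nat \<Rightarrow> nat) \<and> (\<forall>i<n. (\<lambda>k. f (r k) i) \<longlonglongrightarrow> l i)"
  using assms
proof (induction n)
  case 0
  then show ?case using strict_mono_id by auto
next
  case (Suc n)
  have "\<exists>r l. strict_mono (r :: nat \<Rightarrow> nat) \<and> (\<forall>i<n. (\<lambda>k. f (r k) i) \<longlonglongrightarrow> l i)"
    by (rule Suc.IH) (simp add: Suc.prems)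
  then obtain r l where r: "strict_mono (r :: nat \<Rightarrow> nat)" "\<And>i. i < n \<Longrightarrow> (\<lambda>k. f (r k) i) \<longlonglongrightarrow> l i"
    by auto
  have "\<forall>k. f (r k) n \<in> {-B..B}" using Suc.prems[of n] by (auto simp: abs_le_iff minus_le_iff)
  then obtain a r' where r': "strict_mono r'" "((\<lambda>k. f (r k) n) \<circ> r') \<longlonglongrightarrow> a"
    using compact_Icc[of "-B" B] unfolding compact_def by metis
  have "(\<lambda>k. f ((r \<circ> r') k) i) \<longlonglongrightarrow> (l(n := a)) i" if "i < Suc n" for i
  proof (cases "i = n")
    case True
    then show ?thesis using r'(2) by (simp add: o_def)
  next
    case False
    then show ?thesis
      using that LIMSEQ_subseq_LIMSEQ[OF r(2) r'(1), of i] by (simp add: o_def)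
  qed
  with strict_mono_o[OF r(1) r'(1)] show ?case by (intro exI[of _ "r \<circ> r'"] exI[of _ "l(n := a)"]) (simp add: o_def)
qed

section \<open>The torus and its Haar measure\<close>

text \<open>Cosets read only the coordinates below s, hence x and y may be arbitrary functions; this
  lets later lemmas write representatives as plain abstractions.\<close>

lemma torus_class_eq_iff: "torus_class s x = torus_class s y \<longleftrightarrow> (\<forall>i<s. x i - y i \<in> \<int>)"
proof
  assume *: "torus_class s x = torus_class s y"
  have "(\<lambda>i\<in>{..<s}. x i) \<in> torus_class s x" unfolding torus_class_def by simp
  with * have "(\<lambda>i\<in>{..<s}. x i) \<in> torus_class s y" by simp
  then show "\<forall>i<s. x i - y i \<in> \<int>" unfolding torus_class_def by simp
next
  assume *: "\<forall>i<s. x i - y i \<in> \<int>"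
  have "z i - x i \<in> \<int> \<longleftrightarrow> z i - y i \<in> \<int>" if "i < s" for z i
  proof -
    have "z i - y i = (z i - x i) + (x i - y i)" by simp
    then show ?thesis using * that by (metis Ints_add Ints_diff add_diff_cancel_right')
  qed
  then show "torus_class s x = torus_class s y" unfolding torus_class_def by blast
qed

lemma torus_class_cong: "(\<And>i. i < s \<Longrightarrow> x i = y i) \<Longrightarrow> torus_class s x = torus_class s y"
  by (simp add: torus_class_eq_iff)

lemma topspace_torus: "topspace (torus_topology s) = range (torus_class s)"
proof -
  have "torus_class s x \<in> torus_class s ` rn s" for x
    using torus_class_cong[of s x "\<lambda>i\<in>{..<s}. x i"] by (metis imageI lessThan_iff restrict_apply' rn_restrict)
  then show ?thesis
    unfolding torus_topology_def topspace_quotient_topology topspace_rn_topology by blast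
qed

lemma openin_torus:
  "openin (torus_topology s) U \<longleftrightarrow>
    U \<subseteq> topspace (torus_topology s) \<and> openin (rn_topology s) {x \<in> rn s. torus_class s x \<in> U}"
  unfolding torus_topology_def openin_quotient_topology topspace_quotient_topology
  by (simp add: topspace_rn_topology)

text \<open>With \<open>openin_torusI\<close> this hides the quotient: openness is tested on
  arbitrary representatives by sup-norm boxes.\<close>

lemma openin_torusD:
  assumes "openin (torus_topology s) U" "torus_class s z \<in> U"
  obtains \<epsilon> where "\<epsilon> > 0" "\<And>z'. (\<And>i. i < s \<Longrightarrow> \<bar>z' i - z i\<bar> < \<epsilon>) \<Longrightarrow> torus_class s z' \<in> U"
proof -
  define r where "r z = (\<lambda>i\<in>{..<s}. z i :: real)" for z :: "nat \<Rightarrow> real"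
  have r: "r z \<in> rn s" "torus_class s (r z) = torus_class s z" for z
    unfolding r_def by (simp_all add: torus_class_eq_iff)
  have "r z \<in> {x \<in> rn s. torus_class s x \<in> U}" using r assms(2) by simp
  then obtain \<epsilon> where \<epsilon>: "\<epsilon> > 0"
    "\<And>y. y \<in> rn s \<Longrightarrow> (\<forall>i<s. \<bar>y i - r z i\<bar> < \<epsilon>) \<Longrightarrow> y \<in> {x \<in> rn s. torus_class s x \<in> U}"
    using assms(1) unfolding openin_torus openin_rn by blast
  have "torus_class s z' \<in> U" if "\<And>i. i < s \<Longrightarrow> \<bar>z' i - z i\<bar> < \<epsilon>" for z'
    using \<epsilon>(2)[of "r z'"] r that by (simp add: r_def)
  with \<epsilon>(1) show ?thesis using that by blast
qed

lemma openin_torusI: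
  assumes "U \<subseteq> topspace (torus_topology s)"
    "\<And>z. torus_class s z \<in> U \<Longrightarrow> \<exists>\<epsilon>>0. \<forall>z'. (\<forall>i<s. \<bar>z' i - z i\<bar> < \<epsilon>) \<longrightarrow> torus_class s z' \<in> U"
  shows "openin (torus_topology s) U"
  unfolding openin_torus openin_rn using assms by fastforce

text \<open>The projection is an open map: a representative of a point of the image is an integer
  translate of some y in the box, and y has room d left in the box.\<close>

lemma openin_torus_ball:
  "openin (torus_topology s) {torus_class s y | y. \<forall>i<s. \<bar>y i - z i\<bar> < \<epsilon>}"
proof (rule openin_torusI)
  show "{torus_class s y | y. \<forall>i<s. \<bar>y i - z i\<bar> < \<epsilon>} \<subseteq> topspace (torus_topology s)"
    unfolding topspace_torus by blast
  fix x assume "torus_class s x \<in> {torus_class s y | y. \<forall>i<s. \<bar>y i - z i\<bar> < \<epsilon>}"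
  then obtain y where y: "\<And>i. i < s \<Longrightarrow> x i - y i \<in> \<int>" "\<And>i. i < s \<Longrightarrow> \<bar>y i - z i\<bar> < \<epsilon>"
    by (auto simp: torus_class_eq_iff)
  define d where "d = Min (insert 1 ((\<lambda>i. \<epsilon> - \<bar>y i - z i\<bar>) ` {..<s}))"
  have d: "d > 0" "\<And>i. i < s \<Longrightarrow> d \<le> \<epsilon> - \<bar>y i - z i\<bar>"
    unfolding d_def using y(2) by auto
  have "torus_class s x' \<in> {torus_class s y | y. \<forall>i<s. \<bar>y i - z i\<bar> < \<epsilon>}"
    if x': "\<forall>i<s. \<bar>x' i - x i\<bar> < d" for x'
  proof -
    have "torus_class s x' = torus_class s (\<lambda>i. y i + (x' i - x i))"
      using y(1) by (simp add: torus_class_eq_iff)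
    moreover have "\<bar>y i + (x' i - x i) - z i\<bar> < \<epsilon>" if "i < s" for i
      using x'[rule_format, OF that] d(2)[OF that] by linarith
    ultimately show ?thesis by blast
  qed
  then show "\<exists>\<epsilon>'>0. \<forall>x'. (\<forall>i<s. \<bar>x' i - x i\<bar> < \<epsilon>') \<longrightarrow>
      torus_class s x' \<in> {torus_class s y | y. \<forall>i<s. \<bar>y i - z i\<bar> < \<epsilon>}"
    using d(1) by blast
qed

lemma rn_translate_torus_class:
  "rn_translate s v (torus_class s x) = torus_class s (\<lambda>i. x i + v i)"
proof
  show "rn_translate s v (torus_class s x) \<subseteq> torus_class s (\<lambda>i. x i + v i)"
    unfolding rn_translate_def torus_class_def by (auto simp: rn_add_def)
  show "torus_class s (\<lambda>i. x i + v i) \<subseteq> rn_translate s v (torus_class s x)"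
  proof
    fix y assume y: "y \<in> torus_class s (\<lambda>i. x i + v i)"
    have "y = rn_add s v (\<lambda>i\<in>{..<s}. y i - v i)"
      using y by (intro rn_eqI[of _ s]) (auto simp: torus_class_def rn_add_def)
    moreover have "(\<lambda>i\<in>{..<s}. y i - v i) \<in> torus_class s x"
      using y by (auto simp: torus_class_def algebra_simps)
    ultimately show "y \<in> rn_translate s v (torus_class s x)"
      unfolding rn_translate_def by blast
  qed
qed

section \<open>Borel structure of the torus and representatives in the unit cube\<close>

definition torus_rep :: "nat \<Rightarrow> (nat \<Rightarrow> real) set \<Rightarrow> (nat \<Rightarrow> real)" where
  "torus_rep s w = (\<lambda>i\<in>{..<s}. frac ((SOME x. x \<in> w) i))"

lemma frac_eq_frac_iff: "frac x = frac y \<longleftrightarrow> x - y \<in> \<int>" for x y :: real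
proof -
  have "x - frac y = (x - y) + of_int \<lfloor>y\<rfloor>" by (simp add: frac_def)
  then have "x - frac y \<in> \<int> \<longleftrightarrow> x - y \<in> \<int>"
    by (metis Ints_add Ints_diff Ints_of_int add_diff_cancel_right')
  then show ?thesis by (simp add: frac_unique_iff frac_lt_1)
qed

text \<open>Fractional parts do not depend on the coset element picked by \<open>SOME\<close>, so
  \<open>torus_rep\<close> is the representative in the half-open unit cube.\<close>

lemma torus_rep_torus_class: "torus_rep s (torus_class s x) = (\<lambda>i\<in>{..<s}. frac (x i))"
proof -
  have "(\<lambda>i\<in>{..<s}. x i) \<in> torus_class s x" unfolding torus_class_def by simp
  then have "(SOME y. y \<in> torus_class s x) \<in> torus_class s x" by (auto simp: some_in_eq)
  then show ?thesis
    unfolding torus_rep_def torus_class_def by (intro restrict_ext) (auto simp: frac_eq_frac_iff)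
qed

lemma torus_class_torus_rep:
  assumes "w \<in> topspace (torus_topology s)"
  shows "torus_class s (torus_rep s w) = w"
proof -
  obtain x where x: "w = torus_class s x" using assms unfolding topspace_torus by blast
  have "frac (x i) - x i \<in> \<int>" for i by (simp add: frac_def)
  then show ?thesis unfolding x torus_rep_torus_class by (simp add: torus_class_eq_iff)
qed

definition torus_borel :: "nat \<Rightarrow> (nat \<Rightarrow> real) set measure" where
  "torus_borel s = sigma (topspace (torus_topology s)) {U. openin (torus_topology s) U}"

lemma open_torus_Pow: "{U. openin (torus_topology s) U} \<subseteq> Pow (topspace (torus_topology s))"
  using openin_subset by blast

lemma space_torus_borel [simp]: "space (torus_borel s) = topspace (torus_topology s)"
  unfolding torus_borel_def using open_torus_Pow by (rule space_measure_of)

lemma sets_torus_borel: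
  "sets (torus_borel s) = sigma_sets (topspace (torus_topology s)) {U. openin (torus_topology s) U}"
  unfolding torus_borel_def using open_torus_Pow by (rule sets_measure_of)

lemma measurable_torus_class [measurable]: "torus_class s \<in> rn_lebesgue s \<rightarrow>\<^sub>M torus_borel s"
  unfolding torus_borel_def
proof (rule measurable_measure_of)
  show "torus_class s \<in> space (rn_lebesgue s) \<rightarrow> topspace (torus_topology s)"
    by (auto simp: topspace_torus)
  fix U assume "U \<in> {U. openin (torus_topology s) U}"
  then have "{x \<in> rn s. torus_class s x \<in> U} \<in> sets (rn_lebesgue s)"
    by (auto simp: openin_torus intro: openin_rn_sets)
  moreover have "torus_class s -` U \<inter> space (rn_lebesgue s) = {x \<in> rn s. torus_class s x \<in> U}"
    by (auto simp: space_rn_lebesgue)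
  ultimately show "torus_class s -` U \<inter> space (rn_lebesgue s) \<in> sets (rn_lebesgue s)" by simp
qed (rule open_torus_Pow)

text \<open>Only superlevel sets of \<open>frac\<close> are open; this suffices for Borel measurability.\<close>

lemma measurable_torus_rep [measurable]: "torus_rep s \<in> torus_borel s \<rightarrow>\<^sub>M rn_lebesgue s"
proof (rule measurable_rn_lebesgueI)
  show "torus_rep s \<in> space (torus_borel s) \<rightarrow> rn s"
    by (simp add: torus_rep_def)
  fix i assume i: "i < s"
  show "(\<lambda>w. torus_rep s w i) \<in> borel_measurable (torus_borel s)"
  proof (rule borel_measurableI_greater)
    fix a :: real
    let ?U = "{w \<in> space (torus_borel s). a < torus_rep s w i}"
    have "openin (torus_topology s) ?U"
    proof (rule openin_torusI)
      fix z assume "torus_class s z \<in> ?U"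
      then have a: "a < frac (z i)" using i by (simp add: torus_rep_torus_class)
      have "\<exists>\<epsilon>>0. \<forall>t. \<bar>t - z i\<bar> < \<epsilon> \<longrightarrow> a < frac t"
      proof (cases "a < 0")
        case True
        then show ?thesis by (intro exI[of _ 1]) (auto intro: less_le_trans[OF _ frac_ge_0])
      next
        case False
        \<comment> \<open>Since a \<ge> 0, the first bound also keeps t above the floor of
          \<open>z i\<close>, and the second keeps it below the next integer; so the floor stays
          constant.\<close>
        define \<epsilon> where "\<epsilon> = min (frac (z i) - a) (1 - frac (z i))"
        have "\<epsilon> > 0" unfolding \<epsilon>_def using a by (simp add: frac_lt_1)
        moreover have "a < frac t" if "\<bar>t - z i\<bar> < \<epsilon>" for t
        proof -
          have "\<lfloor>t\<rfloor> = \<lfloor>z i\<rfloor>"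
            using that False unfolding \<epsilon>_def frac_def by (intro floor_unique) linarith+
          then show ?thesis using that unfolding \<epsilon>_def frac_def by linarith
        qed
        ultimately show ?thesis by blast
      qed
      then obtain \<epsilon> where \<epsilon>: "\<epsilon> > 0" "\<And>t. \<bar>t - z i\<bar> < \<epsilon> \<Longrightarrow> a < frac t" by blast
      then show "\<exists>\<epsilon>>0. \<forall>z'. (\<forall>i<s. \<bar>z' i - z i\<bar> < \<epsilon>) \<longrightarrow> torus_class s z' \<in> ?U"
        using i by (intro exI[of _ \<epsilon>]) (auto simp: torus_rep_torus_class topspace_torus)
    qed auto
    then show "?U \<in> sets (torus_borel s)"
      unfolding sets_torus_borel by (intro sigma_sets.Basic) simp
  qed
qed

section \<open>Rotations of the unit cube and Haar measure\<close>

definition unit_interval :: "real measure" where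
  "unit_interval = uniform_measure lborel {0..<1}"

lemma sets_unit_interval [simp, measurable_cong]: "sets unit_interval = sets borel"
  unfolding unit_interval_def by simp

lemma space_unit_interval [simp]: "space unit_interval = UNIV"
  unfolding unit_interval_def by simp

lemma prob_space_unit_interval: "prob_space unit_interval"
  unfolding unit_interval_def by (intro prob_space_uniform_measure) auto

lemma emeasure_unit_interval:
  "A \<in> sets borel \<Longrightarrow> emeasure unit_interval A = emeasure lborel ({0..<1} \<inter> A)"
  unfolding unit_interval_def by (simp add: emeasure_uniform_measure divide_ennreal_def)

text \<open>A rotation exchanges two intervals: with c' the fractional part of c, points below 1 -
  c' move by c' and the others by c' - 1, and both motions preserve Lebesgue measure.\<close>

lemma distr_unit_interval_rotate:
  "distr unit_interval unit_interval (\<lambda>x. frac (x + c)) = unit_interval"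
proof (rule measure_eqI)
  have m: "(\<lambda>x. frac (x + c)) \<in> unit_interval \<rightarrow>\<^sub>M unit_interval"
    unfolding frac_def by measurable
  fix A assume "A \<in> sets (distr unit_interval unit_interval (\<lambda>x. frac (x + c)))"
  then have A [measurable]: "A \<in> sets borel" by simp
  have tr: "emeasure lborel {x. x + d \<in> B} = emeasure lborel B" if "B \<in> sets borel" for d B
  proof -
    have "emeasure lborel B = emeasure (distr lborel borel ((+) d)) B"
      by (simp add: lborel_distr_plus)
    also have "\<dots> = emeasure lborel {x. x + d \<in> B}"
      using that by (subst emeasure_distr) (auto simp: vimage_def add.commute)
    finally show ?thesis by simp
  qed
  define c' where "c' = frac c"
  have c': "0 \<le> c'" "c' < 1" unfolding c'_def by (auto simp: frac_lt_1)
  have f: "frac (x + c) = (if x < 1 - c' then x + c' else x + (c' - 1))" if "0 \<le> x" "x < 1" for x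
  proof -
    have "frac x = x" using that by (simp add: frac_eq)
    then show ?thesis using frac_add[of x c] by (simp add: c'_def algebra_simps)
  qed
  \<comment> \<open>\<open>B1\<close> is reached by the points that move by c', \<open>B2\<close> by
    those that move by c' - 1; together they are the part of A in the unit interval.\<close>
  define B1 B2 where "B1 = A \<inter> {c'..<1}" and "B2 = A \<inter> {0..<c'}"
  have [measurable]: "B1 \<in> sets borel" "B2 \<in> sets borel" unfolding B1_def B2_def by auto
  have "{0..<1} \<inter> {x. frac (x + c) \<in> A} = {x. x + c' \<in> B1} \<union> {x. x + (c' - 1) \<in> B2}"
  proof (rule set_eqI)
    fix x
    show "x \<in> {0..<1} \<inter> {x. frac (x + c) \<in> A} \<longleftrightarrow> x \<in> {x. x + c' \<in> B1} \<union> {x. x + (c' - 1) \<in> B2}"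
    proof (cases "0 \<le> x \<and> x < 1")
      case True
      then show ?thesis using c' f[of x] unfolding B1_def B2_def by auto
    next
      case False
      then show ?thesis using c' unfolding B1_def B2_def by auto
    qed
  qed
  moreover have "{x. x + c' \<in> B1} \<inter> {x. x + (c' - 1) \<in> B2} = {}"
    unfolding B1_def B2_def by auto
  ultimately have "emeasure lborel ({0..<1} \<inter> {x. frac (x + c) \<in> A})
      = emeasure lborel {x. x + c' \<in> B1} + emeasure lborel {x. x + (c' - 1) \<in> B2}"
    by (simp add: plus_emeasure)
  also have "\<dots> = emeasure lborel (B1 \<union> B2)"
    by (subst (1 2) tr) (auto simp: B1_def B2_def intro!: plus_emeasure)
  also have "B1 \<union> B2 = {0..<1} \<inter> A"
    using c' unfolding B1_def B2_def by auto
  finally have e: "emeasure lborel ({0..<1} \<inter> {x. frac (x + c) \<in> A}) = emeasure lborel ({0..<1} \<inter> A)" .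
  have "emeasure (distr unit_interval unit_interval (\<lambda>x. frac (x + c))) A
      = emeasure unit_interval {x. frac (x + c) \<in> A}"
    using m by (subst emeasure_distr) (auto simp: vimage_def)
  also have "{x. frac (x + c) \<in> A} \<in> sets borel"
    using measurable_sets[OF m, of A] by (simp add: vimage_def)
  then have "emeasure unit_interval {x. frac (x + c) \<in> A} = emeasure lborel ({0..<1} \<inter> {x. frac (x + c) \<in> A})"
    by (rule emeasure_unit_interval)
  finally show "emeasure (distr unit_interval unit_interval (\<lambda>x. frac (x + c))) A = emeasure unit_interval A"
    using e emeasure_unit_interval[OF A] by simp
qed simp

interpretation unit_interval_product: product_prob_space "\<lambda>_. unit_interval"
  by (intro product_prob_spaceI prob_space_unit_interval)

text \<open>The factors are measures on all of \<open>real\<close>, so that the \<sigma>-algebra is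
  that of \<open>rn_lebesgue\<close> and no restricted spaces occur.\<close>

definition unit_cube :: "nat \<Rightarrow> (nat \<Rightarrow> real) measure" where
  "unit_cube s = (\<Pi>\<^sub>M i\<in>{..<s}. unit_interval)"

lemma sets_unit_cube [measurable_cong]: "sets (unit_cube s) = sets (rn_lebesgue s)"
  unfolding unit_cube_def rn_lebesgue_def by (intro sets_PiM_cong) auto

lemma space_unit_cube [simp]: "space (unit_cube s) = rn s"
  using sets_eq_imp_space_eq[OF sets_unit_cube] by (simp add: space_rn_lebesgue)

lemma prob_space_unit_cube: "prob_space (unit_cube s)"
proof -
  interpret F: finite_product_prob_space "\<lambda>_. unit_interval" "{..<s}"
    by standard simp
  show ?thesis unfolding unit_cube_def by (rule F.prob_space_axioms)
qed

text \<open>Both measures agree on boxes. The product form carries the rotations, the uniform form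
  compares null sets with Lebesgue measure.\<close>

lemma unit_cube_eq_uniform_measure:
  "unit_cube s = uniform_measure (rn_lebesgue s) (Pi\<^sub>E {..<s} (\<lambda>_. {0..<1}))"
  unfolding unit_cube_def
proof (rule unit_interval_product.PiM_eqI[symmetric])
  show "sets (uniform_measure (rn_lebesgue s) (Pi\<^sub>E {..<s} (\<lambda>_. {0..<1}))) = sets (Pi\<^sub>M {..<s} (\<lambda>_. unit_interval))"
    using sets_unit_cube[of s] unfolding unit_cube_def by simp
  fix A :: "nat \<Rightarrow> real set" assume A: "\<And>i. i \<in> {..<s} \<Longrightarrow> A i \<in> sets unit_interval"
  have "emeasure (rn_lebesgue s) (Pi\<^sub>E {..<s} (\<lambda>_. {0..<1})) = 1"
    unfolding rn_lebesgue_def by (subst lborel_product.emeasure_PiM) auto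
  moreover have "Pi\<^sub>E {..<s} A \<in> sets (rn_lebesgue s)" "Pi\<^sub>E {..<s} (\<lambda>_. {0..<1}) \<in> sets (rn_lebesgue s)"
    unfolding rn_lebesgue_def using A by (auto intro!: sets_PiM_I_finite)
  ultimately have "emeasure (uniform_measure (rn_lebesgue s) (Pi\<^sub>E {..<s} (\<lambda>_. {0..<1}))) (Pi\<^sub>E {..<s} A) =
      emeasure (rn_lebesgue s) (Pi\<^sub>E {..<s} (\<lambda>_. {0..<1}) \<inter> Pi\<^sub>E {..<s} A)"
    by (simp add: divide_ennreal_def)
  also have "\<dots> = emeasure (rn_lebesgue s) (Pi\<^sub>E {..<s} (\<lambda>i. {0..<1} \<inter> A i))"
    by (simp add: PiE_Int)
  also have "\<dots> = (\<Prod>i\<in>{..<s}. emeasure lborel ({0..<1} \<inter> A i))"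
    unfolding rn_lebesgue_def using A by (intro lborel_product.emeasure_PiM) auto
  also have "\<dots> = (\<Prod>i\<in>{..<s}. emeasure unit_interval (A i))"
    using A by (intro prod.cong) (auto simp: emeasure_unit_interval)
  finally show "emeasure (uniform_measure (rn_lebesgue s) (Pi\<^sub>E {..<s} (\<lambda>_. {0..<1}))) (Pi\<^sub>E {..<s} A)
      = (\<Prod>i\<in>{..<s}. emeasure unit_interval (A i))" .
qed simp

lemma borel_measurable_frac_real [measurable]: "(frac :: real \<Rightarrow> real) \<in> borel_measurable borel"
  unfolding frac_def[abs_def] by measurable

lemma measurable_cube_rotate [measurable]:
  "(\<lambda>x. \<lambda>i\<in>{..<s}. frac (x i + c i)) \<in> rn_lebesgue s \<rightarrow>\<^sub>M rn_lebesgue s"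
proof (rule measurable_rn_lebesgueI)
  fix i assume "i < s"
  then show "(\<lambda>x. (\<lambda>i\<in>{..<s}. frac (x i + c i)) i) \<in> borel_measurable (rn_lebesgue s)"
    using measurable_rn_component[of i s] by (simp add: measurable_compose[OF _ borel_measurable_frac_real])
qed simp

lemma distr_unit_cube_rotate:
  "distr (unit_cube s) (unit_cube s) (\<lambda>x. \<lambda>i\<in>{..<s}. frac (x i + c i)) = unit_cube s"
  unfolding unit_cube_def
  by (rule unit_interval_product.distr_PiM_measure_preserving[of "{..<s}" "\<lambda>i x. frac (x + c i)"])
    (simp_all add: distr_unit_interval_rotate measurable_cong_sets[OF sets_unit_interval sets_unit_interval]
      measurable_compose[OF _ borel_measurable_frac_real])

definition torus_haar :: "nat \<Rightarrow> (nat \<Rightarrow> real) set measure" where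
  "torus_haar s = distr (unit_cube s) (torus_borel s) (torus_class s)"

lemma measurable_unit_cube_torus_class: "torus_class s \<in> unit_cube s \<rightarrow>\<^sub>M torus_borel s"
  by (simp add: measurable_cong_sets[OF sets_unit_cube refl])

lemma sets_torus_haar [simp]: "sets (torus_haar s) = sets (torus_borel s)"
  unfolding torus_haar_def by simp

lemma space_torus_haar [simp]: "space (torus_haar s) = topspace (torus_topology s)"
  unfolding torus_haar_def by simp

text \<open>Translation of a coset is a set image; passing through \<open>torus_rep\<close> turns it
  into a composition of measurable maps.\<close>

lemma torus_translate_eq:
  assumes "w \<in> topspace (torus_topology s)"
  shows "rn_translate s v w = torus_class s (rn_add s v (torus_rep s w))"
proof -
  have "rn_translate s v w = torus_class s (\<lambda>i. torus_rep s w i + v i)"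
    using torus_class_torus_rep[OF assms] rn_translate_torus_class by metis
  also have "\<dots> = torus_class s (rn_add s v (torus_rep s w))"
    by (intro torus_class_cong) (simp add: rn_add_def)
  finally show ?thesis .
qed

lemma measurable_torus_translate: "rn_translate s v \<in> torus_borel s \<rightarrow>\<^sub>M torus_borel s"
proof -
  have "(\<lambda>w. torus_class s (rn_add s v (torus_rep s w))) \<in> torus_borel s \<rightarrow>\<^sub>M torus_borel s"
    by measurable
  then show ?thesis
    by (subst measurable_cong[where g="\<lambda>w. torus_class s (rn_add s v (torus_rep s w))"])
      (simp_all add: torus_translate_eq)
qed

text \<open>\<open>torus_class\<close> intertwines the rotation of the cube with the translation of
  cosets, so invariance descends to the torus.\<close>

lemma distr_torus_haar_translate:
  "distr (torus_haar s) (torus_haar s) (rn_translate s v) = torus_haar s"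
proof -
  have "distr (torus_haar s) (torus_haar s) (rn_translate s v)
      = distr (torus_haar s) (torus_borel s) (rn_translate s v)"
    by (intro distr_cong) auto
  also have "\<dots> = distr (unit_cube s) (torus_borel s) (rn_translate s v \<circ> torus_class s)"
    unfolding torus_haar_def
    by (rule distr_distr[OF measurable_torus_translate measurable_unit_cube_torus_class])
  also have "rn_translate s v \<circ> torus_class s = torus_class s \<circ> (\<lambda>x. \<lambda>i\<in>{..<s}. frac (x i + v i))"
    by (auto simp: fun_eq_iff rn_translate_torus_class torus_class_eq_iff frac_def)
  also have "distr (unit_cube s) (torus_borel s) (torus_class s \<circ> (\<lambda>x. \<lambda>i\<in>{..<s}. frac (x i + v i)))
     = distr (distr (unit_cube s) (unit_cube s) (\<lambda>x. \<lambda>i\<in>{..<s}. frac (x i + v i))) (torus_borel s) (torus_class s)"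
    using measurable_cube_rotate[where c=v and s=s]
    by (intro distr_distr[symmetric] measurable_unit_cube_torus_class)
       (simp add: measurable_cong_sets[OF sets_unit_cube sets_unit_cube])
  finally show ?thesis by (simp add: distr_unit_cube_rotate torus_haar_def)
qed

lemma invariant_probability_torus_haar:
  "invariant_probability (torus_topology s) (address_action s \<l>) (torus_haar s)"
proof -
  have "prob_space (torus_haar s)"
    unfolding torus_haar_def
    by (rule prob_space.prob_space_distr[OF prob_space_unit_cube measurable_unit_cube_torus_class])
  moreover have "address_action s \<l> t = rn_translate s (\<l> t)" for t
    by (simp add: fun_eq_iff address_action_def)
  ultimately show ?thesis
    unfolding invariant_probability_def
    using measurable_torus_translate[of s]
    by (simp add: distr_torus_haar_translate sets_torus_borel
        measurable_cong_sets[OF sets_torus_haar sets_torus_haar])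
qed

text \<open>The preimage in \<open>\<real>\<^sup>s\<close> is periodic, hence covered by countably
  many integer translates of its part in the unit cube.\<close>

lemma torus_haar_null_iff:
  assumes A: "A \<in> sets (torus_borel s)"
  shows "emeasure (torus_haar s) A = 0 \<longleftrightarrow> emeasure (rn_lebesgue s) {x \<in> rn s. torus_class s x \<in> A} = 0"
proof -
  let ?P = "{x \<in> rn s. torus_class s x \<in> A}" and ?C = "Pi\<^sub>E {..<s} (\<lambda>_. {0..<1}) :: (nat \<Rightarrow> real) set"
  have P: "?P \<in> sets (rn_lebesgue s)"
    using measurable_sets[OF measurable_torus_class A]
    by (simp add: vimage_def Int_def space_rn_lebesgue conj_commute)
  have C: "?C \<in> sets (rn_lebesgue s)"
    unfolding rn_lebesgue_def by (auto intro!: sets_PiM_I_finite)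
  have "emeasure (rn_lebesgue s) ?C = 1"
    unfolding rn_lebesgue_def by (subst lborel_product.emeasure_PiM) auto
  then have "emeasure (unit_cube s) ?P = emeasure (rn_lebesgue s) (?C \<inter> ?P)"
    unfolding unit_cube_eq_uniform_measure using P C by (simp add: divide_ennreal_def)
  moreover have "emeasure (torus_haar s) A = emeasure (unit_cube s) ?P"
    unfolding torus_haar_def
    by (subst emeasure_distr[OF measurable_unit_cube_torus_class A])
       (simp add: vimage_def Int_def conj_commute)
  ultimately have e: "emeasure (torus_haar s) A = emeasure (rn_lebesgue s) (?C \<inter> ?P)" by simp
  show ?thesis
  proof
    assume "emeasure (rn_lebesgue s) ?P = 0"
    then show "emeasure (torus_haar s) A = 0"
      unfolding e using P emeasure_mono[of "?C \<inter> ?P" ?P "rn_lebesgue s"] by simp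
  next
    assume "emeasure (torus_haar s) A = 0"
    then have 0: "emeasure (rn_lebesgue s) (?C \<inter> ?P) = 0" using e by simp
    define Z where "Z = Pi\<^sub>E {..<s} (\<lambda>_. \<int> :: real set)"
    have "countable Z" unfolding Z_def Ints_def by (intro countable_PiE) auto
    have null: "{x \<in> rn s. rn_add s m x \<in> ?C \<inter> ?P} \<in> null_sets (rn_lebesgue s)" for m
    proof
      have CP: "?C \<inter> ?P \<in> sets (rn_lebesgue s)" using C P by auto
      show "emeasure (rn_lebesgue s) {x \<in> rn s. rn_add s m x \<in> ?C \<inter> ?P} = 0"
        using emeasure_rn_translate[OF CP] 0 by simp
      show "{x \<in> rn s. rn_add s m x \<in> ?C \<inter> ?P} \<in> sets (rn_lebesgue s)"
        using measurable_sets[OF rn_add_measurable CP, of m]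
        by (simp add: vimage_def Int_def space_rn_lebesgue conj_ac)
    qed
    have "?P \<subseteq> (\<Union>m\<in>Z. {x \<in> rn s. rn_add s m x \<in> ?C \<inter> ?P})"
    proof
      fix x assume x: "x \<in> ?P"
      \<comment> \<open>Minus the integer parts: m moves x into the unit cube without changing its
        class.\<close>
      define m where "m = (\<lambda>i\<in>{..<s}. - real_of_int \<lfloor>x i\<rfloor>)"
      have "torus_class s (rn_add s m x) = torus_class s x"
        by (auto simp: torus_class_eq_iff rn_add_def m_def)
      moreover have "rn_add s m x \<in> ?C"
        unfolding rn_add_def m_def by (auto simp: frac_def[symmetric] frac_lt_1 less_eq_real_def)
      moreover have "m \<in> Z" unfolding m_def Z_def by auto
      ultimately show "x \<in> (\<Union>m\<in>Z. {x \<in> rn s. rn_add s m x \<in> ?C \<inter> ?P})"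
        using x by (intro UN_I[of m]) simp_all
    qed
    moreover have "(\<Union>m\<in>Z. {x \<in> rn s. rn_add s m x \<in> ?C \<inter> ?P}) \<in> null_sets (rn_lebesgue s)"
      using \<open>countable Z\<close> null by (intro null_sets_UN') auto
    ultimately show "emeasure (rn_lebesgue s) ?P = 0"
      using P null_sets_subset by blast
  qed
qed

text \<open>Fubini for the indicator of the pairs (w, y) with y + w in A. For fixed w, rotation
  invariance of the cube gives the Haar measure of A; for fixed y, invariance of \<nu> gives its
  \<nu>-measure. Both factors have mass 1, so the two values agree.\<close>

lemma torus_haar_uniqueI:
  assumes \<nu>: "prob_space \<nu>" "sets \<nu> = sets (torus_borel s)"
    and inv: "\<And>v. distr \<nu> \<nu> (rn_translate s v) = \<nu>"
  shows "\<nu> = torus_haar s"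
proof (rule measure_eqI)
  show "sets \<nu> = sets (torus_haar s)" using \<nu>(2) by simp
  fix A assume "A \<in> sets \<nu>"
  then have A: "A \<in> sets (torus_borel s)" using \<nu>(2) by simp
  interpret N: prob_space \<nu> by (rule \<nu>(1))
  interpret C: prob_space "unit_cube s" by (rule prob_space_unit_cube)
  interpret P: pair_sigma_finite \<nu> "unit_cube s" ..
  have sp: "space \<nu> = topspace (torus_topology s)"
    using sets_eq_imp_space_eq[OF \<nu>(2)] by simp
  have f: "(\<lambda>(w, y). rn_translate s y w) \<in> \<nu> \<Otimes>\<^sub>M unit_cube s \<rightarrow>\<^sub>M torus_borel s"
  proof -
    have [measurable]: "(\<lambda>(w, y). rn_add s y (torus_rep s w)) \<in> torus_borel s \<Otimes>\<^sub>M rn_lebesgue s \<rightarrow>\<^sub>M rn_lebesgue s"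
    proof (rule measurable_rn_lebesgueI)
      fix i assume i: "i < s"
      have "(\<lambda>w. torus_rep s w i) \<in> borel_measurable (torus_borel s)"
        using measurable_compose[OF measurable_torus_rep measurable_rn_component[OF i]] .
      then show "(\<lambda>x. (case x of (w, y) \<Rightarrow> rn_add s y (torus_rep s w)) i)
          \<in> borel_measurable (torus_borel s \<Otimes>\<^sub>M rn_lebesgue s)"
        using measurable_rn_component[OF i] i unfolding rn_add_def split_beta by simp
    qed auto
    have "(\<lambda>(w, y). torus_class s (rn_add s y (torus_rep s w))) \<in> torus_borel s \<Otimes>\<^sub>M rn_lebesgue s \<rightarrow>\<^sub>M torus_borel s"
      using measurable_compose[OF \<open>(\<lambda>(w, y). rn_add s y (torus_rep s w)) \<in> _\<close> measurable_torus_class]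
      by (simp add: split_beta)
    then have "(\<lambda>(w, y). torus_class s (rn_add s y (torus_rep s w))) \<in> \<nu> \<Otimes>\<^sub>M unit_cube s \<rightarrow>\<^sub>M torus_borel s"
      by (simp add: measurable_cong_sets[OF sets_pair_measure_cong[OF \<nu>(2) sets_unit_cube] refl])
    then show ?thesis
      by (subst measurable_cong[where g="\<lambda>(w, y). torus_class s (rn_add s y (torus_rep s w))"])
         (auto simp: space_pair_measure sp torus_translate_eq)
  qed
  define E where "E = (\<lambda>(w, y). rn_translate s y w) -` A \<inter> space (\<nu> \<Otimes>\<^sub>M unit_cube s)"
  have E: "E \<in> sets (\<nu> \<Otimes>\<^sub>M unit_cube s)" unfolding E_def by (rule measurable_sets[OF f A])
  have 1: "emeasure (unit_cube s) (Pair w -` E) = emeasure (torus_haar s) A" if w: "w \<in> space \<nu>" for w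
  proof -
    obtain x where x: "w = torus_class s x" using w unfolding sp topspace_torus by blast
    have "Pair w -` E = {y \<in> rn s. torus_class s (\<lambda>i\<in>{..<s}. frac (y i + x i)) \<in> A}"
    proof -
      have "rn_translate s y w = torus_class s (\<lambda>i\<in>{..<s}. frac (y i + x i))" for y
        unfolding x rn_translate_torus_class by (auto simp: torus_class_eq_iff frac_def)
      then show ?thesis using w unfolding E_def by (auto simp: space_pair_measure)
    qed
    also have "emeasure (unit_cube s) \<dots> = emeasure (distr (unit_cube s) (torus_borel s)
        (torus_class s \<circ> (\<lambda>y. \<lambda>i\<in>{..<s}. frac (y i + x i)))) A"
      using measurable_comp[OF measurable_cube_rotate measurable_torus_class]
      by (subst emeasure_distr[OF _ A])
         (auto simp: measurable_cong_sets[OF sets_unit_cube refl] vimage_def Int_def conj_commute)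
    also have "distr (unit_cube s) (torus_borel s) (torus_class s \<circ> (\<lambda>y. \<lambda>i\<in>{..<s}. frac (y i + x i)))
        = distr (distr (unit_cube s) (unit_cube s) (\<lambda>y. \<lambda>i\<in>{..<s}. frac (y i + x i))) (torus_borel s) (torus_class s)"
      using measurable_cube_rotate[where c=x and s=s]
      by (intro distr_distr[symmetric] measurable_unit_cube_torus_class)
         (simp add: measurable_cong_sets[OF sets_unit_cube sets_unit_cube])
    finally show ?thesis by (simp add: distr_unit_cube_rotate torus_haar_def)
  qed
  have 2: "emeasure \<nu> ((\<lambda>w. (w, y)) -` E) = emeasure \<nu> A" if "y \<in> space (unit_cube s)" for y
  proof -
    have "(\<lambda>w. (w, y)) -` E = rn_translate s y -` A \<inter> space \<nu>"
      using that unfolding E_def by (auto simp: space_pair_measure)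
    moreover have "emeasure (distr \<nu> \<nu> (rn_translate s y)) A = emeasure \<nu> (rn_translate s y -` A \<inter> space \<nu>)"
      using measurable_torus_translate A \<nu>(2)
      by (intro emeasure_distr) (simp_all add: measurable_cong_sets[OF \<nu>(2) \<nu>(2)])
    ultimately show ?thesis by (simp add: inv)
  qed
  have "emeasure (\<nu> \<Otimes>\<^sub>M unit_cube s) E = (\<integral>\<^sup>+w. emeasure (torus_haar s) A \<partial>\<nu>)"
    unfolding C.emeasure_pair_measure_alt[OF E] by (intro nn_integral_cong) (rule 1)
  moreover have "emeasure (\<nu> \<Otimes>\<^sub>M unit_cube s) E = (\<integral>\<^sup>+y. emeasure \<nu> A \<partial>unit_cube s)"
    unfolding P.emeasure_pair_measure_alt2[OF E] by (intro nn_integral_cong) (rule 2)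
  ultimately show "emeasure \<nu> A = emeasure (torus_haar s) A"
    using N.emeasure_space_1 C.emeasure_space_1 by simp
qed

text \<open>Density of the orbit extends the invariance of \<nu> to all translations. For open U,
  the preimage under v lies in the lower limit of the preimages under approximating group elements,
  which gives an inequality of measures; applied with -v to the translated open set it gives the
  converse. Open sets then determine the measure.\<close>

lemma unique_ergodic_torus_haar:
  assumes dense: "\<And>v \<epsilon>. \<epsilon> > 0 \<Longrightarrow> \<exists>t m. \<forall>i<s. m i \<in> \<int> \<and> \<bar>\<l> t i + m i - v i\<bar> < \<epsilon>"
  shows "unique_ergodic_measure (torus_topology s) (address_action s \<l>) (torus_haar s)"
  unfolding unique_ergodic_measure_def
proof (intro conjI allI impI invariant_probability_torus_haar)
  fix \<nu> assume "invariant_probability (torus_topology s) (address_action s \<l>) \<nu>"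
  then have \<nu>: "prob_space \<nu>" "space \<nu> = topspace (torus_topology s)" "sets \<nu> = sets (torus_borel s)"
    and inv: "\<And>t. distr \<nu> \<nu> (rn_translate s (\<l> t)) = \<nu>"
    unfolding invariant_probability_def sets_torus_borel by (simp_all add: address_action_def[abs_def])
  interpret prob_space \<nu> by (rule \<nu>(1))
  have tm: "rn_translate s v \<in> \<nu> \<rightarrow>\<^sub>M \<nu>" for v
    using measurable_torus_translate by (simp add: measurable_cong_sets[OF \<nu>(3) \<nu>(3)])
  define T where "T v U = rn_translate s v -` U \<inter> space \<nu>" for v U
  have open_sets: "U \<in> sets \<nu>" if "openin (torus_topology s) U" for U
    using that unfolding \<nu>(3) sets_torus_borel by (intro sigma_sets.Basic) simp
  have T_sets: "T v U \<in> sets \<nu>" if "U \<in> sets \<nu>" for v U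
    unfolding T_def by (rule measurable_sets[OF tm that])
  have T_inv: "emeasure \<nu> (T (\<l> t) U) = emeasure \<nu> U" if "U \<in> sets \<nu>" for t U
    using emeasure_distr[OF tm that, of "\<l> t"] unfolding T_def inv by simp
  have le: "emeasure \<nu> (T v U) \<le> emeasure \<nu> U" if U: "openin (torus_topology s) U" for v U
  proof -
    have "\<exists>t m. \<forall>i<s. m i \<in> \<int> \<and> \<bar>\<l> t i + m i - v i\<bar> < inverse (real (Suc k))" for k
      by (rule dense) simp
    then obtain t m where tk: "\<And>k i. i < s \<Longrightarrow> m k i \<in> \<int> \<and> \<bar>\<l> (t k) i + m k i - v i\<bar> < inverse (real (Suc k))"
      by metis
    \<comment> \<open>The \<open>B K\<close> increase to the lower limit of the preimages; a class
      moved into U by v is moved there by all late approximations.\<close>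
    define B where "B K = (\<Inter>k\<in>{K..}. T (\<l> (t k)) U)" for K :: nat
    have B: "range B \<subseteq> sets \<nu>"
      unfolding B_def using T_sets[OF open_sets[OF U]] by (auto intro!: sets.countable_INT')
    have "incseq B" unfolding B_def by (intro monoI INF_superset_mono) auto
    have "T v U \<subseteq> (\<Union>K. B K)"
    proof
      fix w assume w: "w \<in> T v U"
      then obtain x where x: "w = torus_class s x" unfolding T_def \<nu>(2) topspace_torus by blast
      have "torus_class s (\<lambda>i. x i + v i) \<in> U"
        using w unfolding T_def x by (simp add: rn_translate_torus_class)
      then obtain \<epsilon> where \<epsilon>: "\<epsilon> > 0" "\<And>z. (\<And>i. i < s \<Longrightarrow> \<bar>z i - (x i + v i)\<bar> < \<epsilon>) \<Longrightarrow> torus_class s z \<in> U"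
        using openin_torusD[OF U] by blast
      obtain K where K: "inverse (real (Suc K)) < \<epsilon>" using \<epsilon>(1) reals_Archimedean by blast
      have "w \<in> T (\<l> (t k)) U" if "K \<le> k" for k
      proof -
        have "inverse (real (Suc k)) \<le> inverse (real (Suc K))" using that by (intro le_imp_inverse_le) auto
        then have "torus_class s (\<lambda>i. x i + (\<l> (t k) i + m k i)) \<in> U"
          using tk[of _ k] K by (intro \<epsilon>(2)) (smt (verit))
        moreover have "torus_class s (\<lambda>i. x i + (\<l> (t k) i + m k i)) = torus_class s (\<lambda>i. x i + \<l> (t k) i)"
          using tk by (simp add: torus_class_eq_iff)
        ultimately show ?thesis using w unfolding T_def x by (simp add: rn_translate_torus_class)
      qed
      then show "w \<in> (\<Union>K. B K)" unfolding B_def by blast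
    qed
    then have "emeasure \<nu> (T v U) \<le> emeasure \<nu> (\<Union>K. B K)"
      using B by (intro emeasure_mono) auto
    also have "\<dots> = (SUP K. emeasure \<nu> (B K))"
      using SUP_emeasure_incseq[OF B \<open>incseq B\<close>] by simp
    also have "\<dots> \<le> emeasure \<nu> U"
    proof (rule SUP_least)
      fix K
      have "emeasure \<nu> (B K) \<le> emeasure \<nu> (T (\<l> (t K)) U)"
        using T_sets[OF open_sets[OF U]] unfolding B_def by (intro emeasure_mono) auto
      then show "emeasure \<nu> (B K) \<le> emeasure \<nu> U" by (simp add: T_inv[OF open_sets[OF U]])
    qed
    finally show ?thesis .
  qed
  have T_T: "T u (T v U) = T (\<lambda>i. u i + v i) U" for u v U
    unfolding T_def \<nu>(2) topspace_torus by (auto simp: rn_translate_torus_class add.assoc)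
  have T_0: "T (\<lambda>i. - v i + v i) U = U" if "U \<subseteq> space \<nu>" for v U
  proof -
    have "rn_translate s (\<lambda>i. - v i + v i) w = w" if "w \<in> space \<nu>" for w
      using that unfolding \<nu>(2) topspace_torus by (auto simp: rn_translate_torus_class)
    then show ?thesis using that unfolding T_def by auto
  qed
  have open_T: "openin (torus_topology s) (T v U)" if U: "openin (torus_topology s) U" for v U
  proof (rule openin_torusI)
    show "T v U \<subseteq> topspace (torus_topology s)" unfolding T_def \<nu>(2) by blast
    fix z assume "torus_class s z \<in> T v U"
    then have "torus_class s (\<lambda>i. z i + v i) \<in> U" unfolding T_def by (simp add: rn_translate_torus_class)
    then obtain \<epsilon> where \<epsilon>: "\<epsilon> > 0" "\<And>z'. (\<And>i. i < s \<Longrightarrow> \<bar>z' i - (z i + v i)\<bar> < \<epsilon>) \<Longrightarrow> torus_class s z' \<in> U"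
      using openin_torusD[OF U] by blast
    have "torus_class s z' \<in> T v U" if "\<forall>i<s. \<bar>z' i - z i\<bar> < \<epsilon>" for z'
      using \<epsilon>(2)[of "\<lambda>i. z' i + v i"] that unfolding T_def \<nu>(2) topspace_torus
      by (simp add: rn_translate_torus_class)
    then show "\<exists>\<epsilon>>0. \<forall>z'. (\<forall>i<s. \<bar>z' i - z i\<bar> < \<epsilon>) \<longrightarrow> torus_class s z' \<in> T v U"
      using \<epsilon>(1) by blast
  qed
  have eq: "emeasure \<nu> (T v U) = emeasure \<nu> U" if U: "openin (torus_topology s) U" for v U
  proof (rule antisym[OF le[OF U]])
    have "U \<subseteq> space \<nu>" using openin_subset[OF U] \<nu>(2) by simp
    then have "U = T (\<lambda>i. - v i) (T v U)" by (simp only: T_T T_0)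
    then show "emeasure \<nu> U \<le> emeasure \<nu> (T v U)" using le[OF open_T[OF U]] by metis
  qed
  have "distr \<nu> \<nu> (rn_translate s v) = \<nu>" for v
  proof (rule measure_eqI_generator_eq[where E="{U. openin (torus_topology s) U}"
        and \<Omega>="topspace (torus_topology s)" and A="\<lambda>_. topspace (torus_topology s)"])
    show "Int_stable {U. openin (torus_topology s) U}" by (auto simp: Int_stable_def)
    show "emeasure (distr \<nu> \<nu> (rn_translate s v)) U = emeasure \<nu> U" if "U \<in> {U. openin (torus_topology s) U}" for U
      using that by (subst emeasure_distr[OF tm open_sets]) (simp_all add: eq[unfolded T_def])
    show "emeasure (distr \<nu> \<nu> (rn_translate s v)) (topspace (torus_topology s)) \<noteq> \<infinity>"
      by (subst emeasure_distr[OF tm]) (auto simp: open_sets)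
  qed (use open_torus_Pow \<nu>(3) in \<open>auto simp: sets_torus_borel\<close>)
  then show "\<nu> = torus_haar s" by (rule torus_haar_uniqueI[OF \<nu>(1,3)])
qed

section \<open>The hull of a repetitive Meyer set\<close>

lemma uniformly_discreteE:
  assumes "uniformly_discrete X"
  obtains r where "r > 0" "\<And>p q. p \<in> X \<Longrightarrow> q \<in> X \<Longrightarrow> dist p q \<le> r \<Longrightarrow> p = q"
proof -
  obtain r where r: "r > 0" "\<And>x p q. p \<in> X \<inter> cball x r \<Longrightarrow> q \<in> X \<inter> cball x r \<Longrightarrow> p = q"
    using assms unfolding uniformly_discrete_def by blast
  have "p = q" if "p \<in> X" "q \<in> X" "dist p q \<le> r" for p q
    using r(2)[of p p q] that r(1) by simp
  with r(1) show ?thesis using that by blast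
qed

lemma finite_uniformly_discrete_cball:
  fixes D :: "'a::euclidean_space set"
  assumes "uniformly_discrete D"
  shows "finite (D \<inter> cball x R)"
proof (rule ccontr)
  assume "infinite (D \<inter> cball x R)"
  then obtain l where "l islimpt (D \<inter> cball x R)"
    using compact_cball[of x R] unfolding compact_eq_Bolzano_Weierstrass by (metis inf_le2)
  then have l: "infinite (D \<inter> cball x R \<inter> ball l e)" if "e > 0" for e
    using that by (simp add: islimpt_eq_infinite_ball)
  obtain r where r: "r > 0" "\<And>p q. p \<in> D \<Longrightarrow> q \<in> D \<Longrightarrow> dist p q \<le> r \<Longrightarrow> p = q"
    using uniformly_discreteE[OF assms] by blast
  have "p = q" if "p \<in> D \<inter> cball x R \<inter> ball l (r/2)" "q \<in> D \<inter> cball x R \<inter> ball l (r/2)" for p q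
  proof -
    have "dist p q \<le> dist l p + dist l q" by (metis dist_commute dist_triangle)
    then show ?thesis using r(2)[of p q] that by simp
  qed
  then have "finite (D \<inter> cball x R \<inter> ball l (r/2))"
    by (metis finite.emptyI finite.insertI finite_subset insertI1 subsetI)
  then show False using l[of "r/2"] r(1) by simp
qed

text \<open>Two points of X within r/2 of x coincide, so an approximation of x could not be improved
  if x were missing.\<close>

lemma uniformly_discrete_limit_mem:
  assumes "uniformly_discrete X" "\<And>\<epsilon>. \<epsilon> > 0 \<Longrightarrow> \<exists>y\<in>X. dist y x < \<epsilon>"
  shows "x \<in> X"
proof (rule ccontr)
  assume x: "x \<notin> X"
  obtain r where r: "r > 0" "\<And>p q. p \<in> X \<Longrightarrow> q \<in> X \<Longrightarrow> dist p q \<le> r \<Longrightarrow> p = q"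
    using uniformly_discreteE[OF assms(1)] by blast
  obtain y where y: "y \<in> X" "dist y x < r/2" using assms(2)[of "r/2"] r(1) by auto
  have "dist y x > 0" using x y by auto
  then obtain z where z: "z \<in> X" "dist z x < min (r/2) (dist y x)"
    using assms(2)[of "min (r/2) (dist y x)"] r(1) by auto
  have "dist y z \<le> dist y x + dist z x" by (rule dist_triangle2)
  then have "y = z" using r(2)[of y z] y z by simp
  then show False using z by simp
qed

lemma shift_0 [simp]: "shift 0 X = X"
  by (auto simp: mem_shift)

lemma shift_minus_shift [simp]: "shift (- t) (shift t X) = X" "shift t (shift (- t) X) = X"
  by (simp_all add: shift_shift)

text \<open>Moving by t costs \<open>norm t\<close> of the radius of agreement.\<close>

lemma agree_shift:
  assumes "X \<inter> cball 0 R = Y \<inter> cball 0 R" "norm t + \<rho> \<le> R"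
  shows "shift t X \<inter> cball 0 \<rho> = shift t Y \<inter> cball 0 \<rho>"
proof -
  have "x + t \<in> cball 0 R" if "norm x \<le> \<rho>" for x
    using norm_triangle_ineq[of x t] that assms(2) by simp
  then show ?thesis using assms(1) by (auto simp: mem_shift)
qed

lemma agree_mono:
  fixes X :: "'a::euclidean_space set"
  assumes "X \<inter> cball 0 R = Y \<inter> cball 0 R" "\<rho> \<le> R"
  shows "X \<inter> cball 0 \<rho> = Y \<inter> cball 0 \<rho>"
  using agree_shift[OF assms(1), of 0 \<rho>] assms(2) by simp

text \<open>Agreement on balls around the origin suffices: a ball around x lies in one around 0
  whose radius is larger by \<open>norm x\<close>, and the constants of uniform discreteness and
  relative density of \<Lambda> carry over unchanged.\<close>

lemma hull_setI:
  assumes L: "delone \<Lambda>" and agree: "\<And>R. R > 0 \<Longrightarrow> \<exists>t. X \<inter> cball 0 R = shift t \<Lambda> \<inter> cball 0 R"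
  shows "X \<in> hull_set \<Lambda>"
proof -
  have "uniformly_discrete X"
  proof -
    obtain r where r: "r > 0" "\<And>x p q. p \<in> \<Lambda> \<inter> cball x r \<Longrightarrow> q \<in> \<Lambda> \<inter> cball x r \<Longrightarrow> p = q"
      using L unfolding delone_def uniformly_discrete_def by blast
    have "p = q" if pq: "p \<in> X \<inter> cball x r" "q \<in> X \<inter> cball x r" for x p q
    proof -
      obtain t where t: "X \<inter> cball 0 (norm x + r) = shift t \<Lambda> \<inter> cball 0 (norm x + r)"
        using agree[of "norm x + r"] r(1) norm_ge_zero[of x] by force
      have "y \<in> cball 0 (norm x + r)" if "y \<in> cball x r" for y
        using that norm_triangle_ineq2[of y x] by (simp add: dist_norm norm_minus_commute)
      then have "p \<in> shift t \<Lambda>" "q \<in> shift t \<Lambda>" using pq t by blast+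
      then have "p + t \<in> \<Lambda> \<inter> cball (x + t) r" "q + t \<in> \<Lambda> \<inter> cball (x + t) r"
        using pq by (auto simp: mem_shift dist_norm)
      then show ?thesis using r(2) by (metis add_right_imp_eq)
    qed
    then show ?thesis using r(1) unfolding uniformly_discrete_def by blast
  qed
  moreover have "relatively_dense X"
  proof -
    obtain R where R: "R > 0" "\<And>x. \<Lambda> \<inter> cball x R \<noteq> {}"
      using L unfolding delone_def relatively_dense_def by blast
    have "X \<inter> cball x R \<noteq> {}" for x
    proof -
      obtain t where t: "X \<inter> cball 0 (norm x + R) = shift t \<Lambda> \<inter> cball 0 (norm x + R)"
        using agree[of "norm x + R"] R(1) norm_ge_zero[of x] by force
      obtain y where y: "y \<in> \<Lambda>" "y \<in> cball (x + t) R" using R(2) by blast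
      have "y - t \<in> cball x R" using y(2) by (simp add: dist_norm algebra_simps)
      moreover have "y - t \<in> cball 0 (norm x + R)"
        using calculation norm_triangle_ineq2[of "y - t" x] by (simp add: dist_norm norm_minus_commute)
      moreover have "y - t \<in> shift t \<Lambda>" using y(1) by (simp add: mem_shift)
      ultimately show ?thesis using t by blast
    qed
    then show ?thesis using R(1) unfolding relatively_dense_def by blast
  qed
  moreover have "\<exists>t'. cpatch \<rho> X t = cpatch \<rho> \<Lambda> t'" if \<rho>: "\<rho> > 0" for \<rho> t
  proof -
    obtain u where "X \<inter> cball 0 (norm t + \<rho>) = shift u \<Lambda> \<inter> cball 0 (norm t + \<rho>)"
      using agree[of "norm t + \<rho>"] \<rho> norm_ge_zero[of t] by force
    from agree_shift[OF this, of t \<rho>] show ?thesis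
      by (auto simp: cpatch_alt shift_shift)
  qed
  ultimately show ?thesis unfolding hull_set_def delone_def by blast
qed

lemma hull_set_agree:
  assumes "X \<in> hull_set \<Lambda>"
  obtains t where "X \<inter> cball 0 R = shift t \<Lambda> \<inter> cball 0 R"
proof -
  \<comment> \<open>The hull condition covers positive radii, while R is arbitrary here.\<close>
  have "max R 1 > 0" by simp
  from hull_setD(2)[OF assms this, of 0]
  obtain t where "cpatch (max R 1) X 0 = cpatch (max R 1) \<Lambda> t" by blast
  then have "X \<inter> cball 0 (max R 1) = shift t \<Lambda> \<inter> cball 0 (max R 1)" by (simp add: cpatch_alt)
  then show ?thesis using that agree_mono by (metis max.cobounded1)
qed

lemma hull_set_self: "delone \<Lambda> \<Longrightarrow> \<Lambda> \<in> hull_set \<Lambda>"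
  by (intro hull_setI) (auto intro: exI[of _ 0])

text \<open>The patch of Y at 0 occurs in \<Lambda>, by repetitivity within M of any given place v;
  X copies \<Lambda> around v on a ball of radius M + \<rho>, so the patch also occurs in X. This is
  minimality of the hull in the form used below.\<close>

lemma repetitive_hull_agree:
  assumes "repetitive \<Lambda>" "X \<in> hull_set \<Lambda>" "Y \<in> hull_set \<Lambda>"
  obtains t where "Y \<inter> cball 0 R = shift t X \<inter> cball 0 R"
proof -
  define \<rho> where "\<rho> = max R 1"
  obtain u where u: "Y \<inter> cball 0 \<rho> = shift u \<Lambda> \<inter> cball 0 \<rho>" using hull_set_agree[OF assms(3)] .
  obtain M where M: "M > 0" "\<And>y t. \<exists>t'\<in>cball y M. cpatch \<rho> \<Lambda> t' = cpatch \<rho> \<Lambda> t"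
  proof -
    have "\<rho> > 0" unfolding \<rho>_def by simp
    then have "\<exists>M>0. \<forall>y t. \<exists>t'\<in>cball y M. cpatch \<rho> \<Lambda> t' = cpatch \<rho> \<Lambda> t"
      using assms(1) unfolding repetitive_def by simp
    then show ?thesis using that by (elim exE conjE) simp
  qed
  obtain v where v: "X \<inter> cball 0 (M + \<rho>) = shift v \<Lambda> \<inter> cball 0 (M + \<rho>)"
    using hull_set_agree[OF assms(2)] .
  obtain t where t: "t \<in> cball v M" "cpatch \<rho> \<Lambda> t = cpatch \<rho> \<Lambda> u" using M(2) by blast
  have "norm (t - v) + \<rho> \<le> M + \<rho>" using t(1) by (simp add: dist_norm norm_minus_commute)
  then have "shift (t - v) X \<inter> cball 0 \<rho> = shift (t - v) (shift v \<Lambda>) \<inter> cball 0 \<rho>"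
    by (rule agree_shift[OF v])
  also have "\<dots> = shift t \<Lambda> \<inter> cball 0 \<rho>" by (simp add: shift_shift)
  also have "\<dots> = shift u \<Lambda> \<inter> cball 0 \<rho>" using t(2) by (simp only: cpatch_alt)
  also have "\<dots> = Y \<inter> cball 0 \<rho>" by (rule u[symmetric])
  finally have "Y \<inter> cball 0 \<rho> = shift (t - v) X \<inter> cball 0 \<rho>" by (rule sym)
  then have "Y \<inter> cball 0 R = shift (t - v) X \<inter> cball 0 R"
    by (rule agree_mono) (simp add: \<rho>_def)
  then show ?thesis by (rule that)
qed

lemma hull_set_uniformly_relatively_dense:
  assumes "delone \<Lambda>"
  obtains R where "R > 0" "\<And>X x. X \<in> hull_set \<Lambda> \<Longrightarrow> X \<inter> cball x R \<noteq> {}"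
proof -
  obtain R where R: "R > 0" "\<And>x. \<Lambda> \<inter> cball x R \<noteq> {}"
    using assms unfolding delone_def relatively_dense_def by blast
  have "X \<inter> cball x R \<noteq> {}" if X: "X \<in> hull_set \<Lambda>" for X x
  proof -
    obtain t where t: "shift x X \<inter> cball 0 R = shift t \<Lambda> \<inter> cball 0 R"
      using hull_set_agree[OF shift_in_hull_set[OF X]] .
    obtain y where y: "y \<in> \<Lambda>" "y \<in> cball t R" using R(2) by blast
    then have "y - t \<in> shift t \<Lambda> \<inter> cball 0 R" by (simp add: mem_shift dist_norm norm_minus_commute)
    then have "y - t + x \<in> X \<inter> cball x R" using t by (force simp: mem_shift dist_norm norm_minus_commute)
    then show ?thesis by blast
  qed
  with R(1) show ?thesis using that by blast
qed

lemma hull_set_differences: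
  assumes "X \<in> hull_set \<Lambda>" "x \<in> X" "y \<in> X"
  shows "x - y \<in> differences \<Lambda>"
proof -
  obtain t where t: "X \<inter> cball 0 (max (norm x) (norm y)) = shift t \<Lambda> \<inter> cball 0 (max (norm x) (norm y))"
    using hull_set_agree[OF assms(1)] .
  have "x \<in> shift t \<Lambda>" "y \<in> shift t \<Lambda>"
    using t assms(2,3) by (metis IntD1 IntI max.cobounded1 max.cobounded2 mem_cball_0)+
  then have "x + t \<in> \<Lambda>" "y + t \<in> \<Lambda>" by (simp_all add: mem_shift)
  then have "(x + t) - (y + t) \<in> differences \<Lambda>" unfolding differences_def by blast
  then show ?thesis by simp
qed

text \<open>All \<open>X k\<close> contain 0, so they are subsets of the uniformly discrete set
  \<Lambda> - \<Lambda> and show only finitely many patterns in each ball. A diagonal subsequence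
  freezes the pattern in every ball. This is where the Meyer property enters compactness.\<close>

lemma hull_set_sequentially_compact:
  fixes X :: "nat \<Rightarrow> 'a::euclidean_space set"
  assumes "meyer \<Lambda>" and X: "\<And>k. X k \<in> hull_set \<Lambda>" "\<And>k. 0 \<in> X k"
  obtains r Y where "strict_mono (r :: nat \<Rightarrow> nat)" "Y \<in> hull_set \<Lambda>" "0 \<in> Y"
    "\<And>R. \<exists>K. \<forall>k\<ge>K. X (r k) \<inter> cball 0 R = Y \<inter> cball 0 R"
proof -
  have D: "delone \<Lambda>" "uniformly_discrete (differences \<Lambda>)"
    using assms(1) unfolding meyer_def delone_def by blast+
  have sub: "X k \<subseteq> differences \<Lambda>" for k
    using hull_set_differences[OF X(1) _ X(2)] by fastforce
  \<comment> \<open>Along r the pattern in the ball of radius m is constant; the diagonal sequence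
    has this property for every m from index \<open>Suc m\<close> on.\<close>
  define P where "P m r \<longleftrightarrow> (\<exists>A. \<forall>k. X (r k) \<inter> cball 0 (real m) = A)" for m :: nat and r :: "nat \<Rightarrow> nat"
  interpret subseqs P
  proof
    fix m and q :: "nat \<Rightarrow> nat" assume "strict_mono q"
    let ?f = "\<lambda>k. X (q k) \<inter> cball 0 (real m)"
    have "range ?f \<subseteq> Pow (differences \<Lambda> \<inter> cball 0 (real m))" using sub by blast
    then have "finite (range ?f)"
      using finite_uniformly_discrete_cball[OF D(2)] finite_subset by (metis finite_Pow_iff)
    then obtain k0 where k0: "infinite {k. ?f k = ?f k0}"
      using pigeonhole_infinite[of UNIV ?f] by auto
    then have "strict_mono (enumerate {k. ?f k = ?f k0})" "\<And>k. enumerate {k. ?f k = ?f k0} k \<in> {k. ?f k = ?f k0}"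
      by (rule strict_mono_enumerate, rule enumerate_in_set)
    then show "\<exists>r'. strict_mono r' \<and> P m (q \<circ> r')"
      unfolding P_def by (intro exI[of _ "enumerate {k. ?f k = ?f k0}"]) auto
  qed
  have "P m (diagseq \<circ> (+) (Suc m))" for m
    by (rule diagseq_holds) (auto simp: P_def)
  then have "\<exists>A. \<forall>k. X (diagseq (Suc m + k)) \<inter> cball 0 (real m) = A" for m
    unfolding P_def by simp
  then obtain A where "\<And>m k. X (diagseq (Suc m + k)) \<inter> cball 0 (real m) = A m" by metis
  then have A: "X (diagseq k) \<inter> cball 0 (real m) = A m" if "k \<ge> Suc m" for m k
    using that by (metis le_Suc_ex)
  define Y where "Y = (\<Union>m. A m)"
  have YA: "Y \<inter> cball 0 (real m) = A m" for m
  proof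
    have "A m = X (diagseq (Suc m)) \<inter> cball 0 (real m)" using A[of m "Suc m"] by simp
    then show "A m \<subseteq> Y \<inter> cball 0 (real m)" unfolding Y_def by blast
    show "Y \<inter> cball 0 (real m) \<subseteq> A m"
    proof
      fix x assume "x \<in> Y \<inter> cball 0 (real m)"
      then obtain m' where m': "x \<in> A m'" "x \<in> cball 0 (real m)" unfolding Y_def by blast
      let ?k = "Suc (max m m')"
      have "X (diagseq ?k) \<inter> cball 0 (real m') = A m'" "X (diagseq ?k) \<inter> cball 0 (real m) = A m"
        by (rule A, simp)+
      then show "x \<in> A m" using m' by blast
    qed
  qed
  have agree: "X (diagseq k) \<inter> cball 0 R = Y \<inter> cball 0 R" if "k \<ge> Suc (nat \<lceil>R\<rceil>)" for k R
  proof (rule agree_mono)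
    show "X (diagseq k) \<inter> cball 0 (real (nat \<lceil>R\<rceil>)) = Y \<inter> cball 0 (real (nat \<lceil>R\<rceil>))"
      unfolding A[OF that] YA ..
    show "R \<le> real (nat \<lceil>R\<rceil>)" by (rule of_nat_ceiling)
  qed
  have "Y \<in> hull_set \<Lambda>"
  proof (rule hull_setI[OF D(1)])
    fix R :: real
    obtain t where "X (diagseq (Suc (nat \<lceil>R\<rceil>))) \<inter> cball 0 R = shift t \<Lambda> \<inter> cball 0 R"
      by (rule hull_set_agree[OF X(1)])
    then show "\<exists>t. Y \<inter> cball 0 R = shift t \<Lambda> \<inter> cball 0 R"
      unfolding agree[OF order_refl] by (rule exI)
  qed
  moreover have "0 \<in> Y"
  proof -
    have "0 \<in> X (diagseq (Suc (nat \<lceil>0::real\<rceil>))) \<inter> cball 0 0" using X(2) by simp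
    then show ?thesis unfolding agree[OF order_refl] by (rule IntD1)
  qed
  moreover have "\<exists>K. \<forall>k\<ge>K. X (diagseq k) \<inter> cball 0 R = Y \<inter> cball 0 R" for R
    using agree by blast
  ultimately show ?thesis using that[of diagseq Y] subseq_diagseq by simp
qed

text \<open>Only the untranslated members (t = 0) of a basic neighborhood are used.\<close>

lemma hull_continuous_map_agree:
  assumes "continuous_map (hull_topology \<Lambda>) T f" "X \<in> hull_set \<Lambda>" "openin T V" "f X \<in> V"
  obtains R where "\<And>Y. Y \<in> hull_set \<Lambda> \<Longrightarrow> Y \<inter> cball 0 R = X \<inter> cball 0 R \<Longrightarrow> f Y \<in> V"
proof -
  have "hull_open \<Lambda> {Y \<in> hull_set \<Lambda>. f Y \<in> V}"
    using assms(1,3) unfolding continuous_map_def topspace_hull_topology openin_hull_topology by blast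
  then obtain R \<epsilon> where R: "0 < \<epsilon>" "hull_nbhd \<Lambda> X R \<epsilon> \<subseteq> {Y \<in> hull_set \<Lambda>. f Y \<in> V}"
    using assms(2,4) unfolding hull_open_def by blast
  have "f Y \<in> V" if "Y \<in> hull_set \<Lambda>" "Y \<inter> cball 0 R = X \<inter> cball 0 R" for Y
  proof -
    have "shift 0 Y \<in> hull_nbhd \<Lambda> X R \<epsilon>"
      unfolding hull_nbhd_def using that R(1) by (force simp del: shift_0)
    then show ?thesis using R(2) by auto
  qed
  then show ?thesis by (rule that)
qed

section \<open>Phases of elements of the hull\<close>

lemma Ints_if_approx:
  fixes x :: real
  assumes "\<And>\<epsilon>. \<epsilon> > 0 \<Longrightarrow> \<exists>m\<in>\<int>. \<bar>x - m\<bar> < \<epsilon>"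
  shows "x \<in> \<int>"
proof -
  have "\<exists>m\<in>\<int>. dist m x < \<epsilon>" if "\<epsilon> > 0" for \<epsilon>
    using assms[OF that] by (simp add: dist_real_def abs_minus_commute)
  then show ?thesis
    using closed_approachable[OF closed_Ints, of x] by blast
qed

lemma LIMSEQ_if_close:
  fixes f :: "nat \<Rightarrow> real"
  assumes "\<And>k. \<bar>f k - l\<bar> < inverse (real (Suc k))"
  shows "f \<longlonglongrightarrow> l"
proof -
  have "(\<lambda>k. f k - l) \<longlonglongrightarrow> 0"
    by (rule Lim_null_comparison[OF _ LIMSEQ_inverse_real_of_nat])
      (use assms in \<open>auto simp: less_eq_real_def simp del: of_nat_Suc\<close>)
  then show ?thesis by (simp add: LIM_zero_iff)
qed

text \<open>Boundedness on D spreads to the whole space, since f is Lipschitz and D meets every ball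
  of radius R; a bounded linear map vanishes by scaling. Yields both \<open>lin_ell\<close> and
  \<open>internal_ell_0\<close>.\<close>

lemma linear_eq_0_if_bounded_on_relatively_dense:
  fixes f :: "'a::euclidean_space \<Rightarrow> 'b::real_normed_vector"
  assumes "linear f" "relatively_dense D" "\<And>p. p \<in> D \<Longrightarrow> norm (f p) \<le> B"
  shows "f x = 0"
proof (rule ccontr)
  assume "f x \<noteq> 0"
  obtain R where R: "R > 0" "\<And>x. D \<inter> cball x R \<noteq> {}"
    using assms(2) unfolding relatively_dense_def by blast
  obtain K where K: "\<And>x. norm (f x) \<le> K * norm x" "K > 0"
    using linear_bounded_pos[OF assms(1)] by blast
  have bound: "norm (f y) \<le> B + K * R" for y
  proof -
    obtain p where p: "p \<in> D" "norm (y - p) \<le> R" using R(2)[of y] by (auto simp: dist_norm)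
    have "f y = f p + f (y - p)" using linear_diff[OF assms(1), of y p] by simp
    then have "norm (f y) \<le> norm (f p) + norm (f (y - p))" by (metis norm_triangle_ineq)
    also have "\<dots> \<le> B + K * R"
      using assms(3)[OF p(1)] K(1)[of "y - p"] mult_left_mono[OF p(2), of K] K(2) by linarith
    finally show ?thesis .
  qed
  obtain k :: nat where "B + K * R < real k * norm (f x)"
    using reals_Archimedean3[of "norm (f x)"] \<open>f x \<noteq> 0\<close> by auto
  moreover have "norm (f (real k *\<^sub>R x)) = real k * norm (f x)"
    by (simp add: linear_scale[OF assms(1)])
  ultimately show False using bound[of "real k *\<^sub>R x"] by simp
qed

definition comb :: "nat \<Rightarrow> (nat \<Rightarrow> 'a::real_vector) \<Rightarrow> (nat \<Rightarrow> real) \<Rightarrow> 'a" where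
  "comb s b z = (\<Sum>i<s. z i *\<^sub>R b i)"

lemma comb_add: "comb s b (\<lambda>i. x i + y i) = comb s b x + comb s b y"
  by (simp add: comb_def scaleR_add_left sum.distrib)

lemma comb_diff: "comb s b (\<lambda>i. x i - y i) = comb s b x - comb s b y"
  by (simp add: comb_def scaleR_diff_left sum_subtractf)

lemma comb_scale: "comb s b (\<lambda>i. k * x i) = k *\<^sub>R comb s b x"
  by (simp add: comb_def scaleR_sum_right)

lemma comb_cong: "(\<And>i. i < s \<Longrightarrow> x i = y i) \<Longrightarrow> comb s b x = comb s b y"
  by (simp add: comb_def)

lemma comb_bounded:
  fixes b :: "nat \<Rightarrow> 'a::real_normed_vector"
  obtains K where "K > 0" "\<And>z \<epsilon>. (\<And>i. i < s \<Longrightarrow> \<bar>z i\<bar> \<le> \<epsilon>) \<Longrightarrow> 0 \<le> \<epsilon> \<Longrightarrow> norm (comb s b z) \<le> K * \<epsilon>"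
proof -
  \<comment> \<open>The summand 1 keeps K positive for s = 0.\<close>
  define K where "K = 1 + (\<Sum>i<s. norm (b i))"
  have "norm (comb s b z) \<le> K * \<epsilon>" if z: "\<And>i. i < s \<Longrightarrow> \<bar>z i\<bar> \<le> \<epsilon>" and \<epsilon>: "0 \<le> \<epsilon>" for z \<epsilon>
  proof -
    have "norm (comb s b z) \<le> (\<Sum>i<s. norm (z i *\<^sub>R b i))" unfolding comb_def by (rule norm_sum)
    also have "\<dots> \<le> (\<Sum>i<s. \<epsilon> * norm (b i))" using z by (intro sum_mono) (auto intro: mult_right_mono)
    also have "\<dots> = \<epsilon> * (\<Sum>i<s. norm (b i))" by (simp add: sum_distrib_left)
    also have "\<dots> \<le> K * \<epsilon>" using \<epsilon> unfolding K_def by (simp add: algebra_simps)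
    finally show ?thesis .
  qed
  moreover have "K > 0" unfolding K_def by (simp add: add_pos_nonneg sum_nonneg)
  ultimately show ?thesis using that by blast
qed

text \<open>The free parameter \<open>z0\<close> lets each implication choose its own origin of the
  torus: the address of the translate described by the scheme in one, of a translate containing 0 in
  the other.\<close>

locale address_system =
  fixes \<Lambda> :: "'a::euclidean_space set" and s :: nat and b :: "nat \<Rightarrow> 'a"
    and \<l> :: "'a \<Rightarrow> nat \<Rightarrow> real" and \<pi> :: "'a set \<Rightarrow> (nat \<Rightarrow> real) set"
    and z0 :: "nat \<Rightarrow> real"
  assumes meyer: "meyer \<Lambda>" and repetitive: "repetitive \<Lambda>"
    and Z_basis: "is_Z_basis s b (group_closure (differences \<Lambda>))"
    and address_map: "address_linear_map \<Lambda> s b \<l>"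
    and homomorphism: "address_homomorphism \<Lambda> s \<l> \<pi>"
begin

definition G :: "'a set" where "G = group_closure (differences \<Lambda>)"

definition coord :: "'a \<Rightarrow> nat \<Rightarrow> real" where
  "coord g i = real_of_int (Z_coord s b g i)"

abbreviation lin :: "(nat \<Rightarrow> real) \<Rightarrow> 'a" where "lin \<equiv> comb s b"

lemma delone: "delone \<Lambda>" and delone_differences: "delone (differences \<Lambda>)"
  using meyer unfolding meyer_def by blast+

lemma G_0 [simp]: "0 \<in> G" and G_diff: "x \<in> G \<Longrightarrow> y \<in> G \<Longrightarrow> x - y \<in> G"
  and G_add: "x \<in> G \<Longrightarrow> y \<in> G \<Longrightarrow> x + y \<in> G" and G_minus: "x \<in> G \<Longrightarrow> - x \<in> G"
  unfolding G_def by (auto intro: group_closure.diff group_closure_add)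

lemma differences_subset_G: "differences \<Lambda> \<subseteq> G"
  unfolding G_def by (auto intro: group_closure.base)

lemma basis_in_G: "i < s \<Longrightarrow> b i \<in> G"
  using Z_basis unfolding is_Z_basis_def G_def by blast

lemma G_scale_nat: "x \<in> G \<Longrightarrow> real k *\<^sub>R x \<in> G"
  by (induction k) (auto simp: scaleR_add_left intro: G_add)

lemma G_scale_int:
  assumes "x \<in> G" shows "real_of_int k *\<^sub>R x \<in> G"
proof (cases "k \<ge> 0")
  case True
  then show ?thesis using G_scale_nat[OF assms, of "nat k"] by simp
next
  case False
  then show ?thesis using G_minus[OF G_scale_nat[OF assms, of "nat (- k)"]] by simp
qed

lemma G_sum: "finite I \<Longrightarrow> (\<And>i. i \<in> I \<Longrightarrow> f i \<in> G) \<Longrightarrow> sum f I \<in> G"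
  by (induction I rule: finite_induct) (auto intro: G_add)

lemma lin_int_in_G: "lin (\<lambda>i. real_of_int (c i)) \<in> G"
  unfolding comb_def by (intro G_sum) (auto intro: G_scale_int basis_in_G)

lemma lin_coord [simp]: assumes "g \<in> G" shows "lin (coord g) = g"
proof -
  have "\<exists>!c. c \<in> ({..<s} \<rightarrow>\<^sub>E (UNIV :: int set)) \<and> g = (\<Sum>i<s. of_int (c i) *\<^sub>R b i)"
    using Z_basis assms unfolding is_Z_basis_def G_def by blast
  from theI'[OF this] show ?thesis unfolding comb_def coord_def Z_coord_def by simp
qed

lemma coord_lin_int: assumes "i < s" shows "coord (lin (\<lambda>i. real_of_int (c i))) i = real_of_int (c i)"
proof -
  let ?g = "lin (\<lambda>i. real_of_int (c i))" and ?c = "restrict c {..<s}"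
  have ex: "\<exists>!c. c \<in> ({..<s} \<rightarrow>\<^sub>E (UNIV :: int set)) \<and> ?g = (\<Sum>i<s. of_int (c i) *\<^sub>R b i)"
    using Z_basis lin_int_in_G[of c] unfolding is_Z_basis_def G_def by blast
  have "?c \<in> ({..<s} \<rightarrow>\<^sub>E UNIV) \<and> ?g = (\<Sum>i<s. of_int (?c i) *\<^sub>R b i)"
    unfolding comb_def by auto
  then have "Z_coord s b ?g = ?c" unfolding Z_coord_def by (rule the1_equality[OF ex])
  then show ?thesis using assms unfolding coord_def by simp
qed

lemma coord_Ints [simp]: "coord g i \<in> \<int>"
  unfolding coord_def by simp

lemma Ints_coord:
  assumes "\<And>i. i < s \<Longrightarrow> m i \<in> \<int>"
  obtains h where "h \<in> G" "\<And>i. i < s \<Longrightarrow> coord h i = m i"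
proof -
  have m: "real_of_int \<lfloor>m i\<rfloor> = m i" if "i < s" for i using assms[OF that] by simp
  have "coord (lin (\<lambda>i. real_of_int \<lfloor>m i\<rfloor>)) i = m i" if "i < s" for i
    by (rule trans[OF coord_lin_int[OF that, of "\<lambda>i. \<lfloor>m i\<rfloor>"] m[OF that]])
  then show ?thesis by (rule that[OF lin_int_in_G])
qed

lemma coord_add:
  assumes "g \<in> G" "h \<in> G" "i < s" shows "coord (g + h) i = coord g i + coord h i"
proof -
  have "g + h = lin (\<lambda>i. real_of_int (Z_coord s b g i + Z_coord s b h i))"
    using comb_add[of s b "coord g" "coord h"] assms(1,2) by (simp add: coord_def)
  then show ?thesis
    using coord_lin_int[OF assms(3), of "\<lambda>i. Z_coord s b g i + Z_coord s b h i"] by (simp add: coord_def)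
qed

lemma coord_basis:
  assumes "j < s" "i < s" shows "coord (b j) i = (if i = j then 1 else 0)"
proof -
  have "b j = lin (\<lambda>i. real_of_int (if i = j then 1 else 0))"
    using assms(1) unfolding comb_def by (simp add: if_distrib if_distribR sum.delta cong: if_cong)
  then show ?thesis using coord_lin_int[OF assms(2), of "\<lambda>i. if i = j then 1 else 0"] by simp
qed

lemma linear_address: "i < s \<Longrightarrow> linear (\<lambda>t. \<l> t i)"
  using address_map unfolding address_linear_map_def linear_to_rn_def by blast

lemma ell_add: "i < s \<Longrightarrow> \<l> (x + y) i = \<l> x i + \<l> y i"
  and ell_diff: "i < s \<Longrightarrow> \<l> (x - y) i = \<l> x i - \<l> y i"
  and ell_minus: "i < s \<Longrightarrow> \<l> (- x) i = - \<l> x i"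
  and ell_0: "i < s \<Longrightarrow> \<l> 0 i = 0"
  by (simp_all add: linear_add[OF linear_address] linear_diff[OF linear_address]
      linear_neg[OF linear_address] linear_0[OF linear_address])

lemma ell_bounded:
  obtains K where "K > 0" "\<And>x i. i < s \<Longrightarrow> \<bar>\<l> x i\<bar> \<le> K * norm x"
proof -
  have "\<exists>K. \<forall>x. \<bar>\<l> x i\<bar> \<le> K * norm x" if "i < s" for i
    using linear_bounded[OF linear_address[OF that]] by auto
  then obtain k where k: "\<And>i x. i < s \<Longrightarrow> \<bar>\<l> x i\<bar> \<le> k i * norm x" by metis
  define K where "K = Max (insert 1 (k ` {..<s}))"
  have "K > 0" unfolding K_def by (intro less_le_trans[OF zero_less_one Max_ge]) auto
  moreover have "\<bar>\<l> x i\<bar> \<le> K * norm x" if "i < s" for i x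
  proof -
    have "k i \<le> K" unfolding K_def using that by (intro Max_ge) auto
    then show ?thesis using k[OF that, of x] mult_right_mono[of "k i" K "norm x"] by simp
  qed
  ultimately show ?thesis using that by blast
qed

text \<open>A difference x - y is a point of \<open>shift y \<Lambda>\<close>, which contains 0 and
  so lies in the transversal; a coordinate is at most the Euclidean norm.\<close>

lemma coord_ell_bounded:
  obtains C where "\<And>p i. p \<in> differences \<Lambda> \<Longrightarrow> i < s \<Longrightarrow> \<bar>coord p i - \<l> p i\<bar> \<le> C"
proof -
  obtain C where C: "\<And>X t. X \<in> transversal \<Lambda> \<Longrightarrow> t \<in> X \<Longrightarrow>
      L2_set (\<lambda>i. real_of_int (Z_coord s b t i) - \<l> t i) {..<s} \<le> C"
    using address_map unfolding address_linear_map_def by blast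
  have "\<bar>coord p i - \<l> p i\<bar> \<le> C" if "p \<in> differences \<Lambda>" "i < s" for p i
  proof -
    obtain x y where xy: "p = x - y" "x \<in> \<Lambda>" "y \<in> \<Lambda>" using \<open>p \<in> differences \<Lambda>\<close> unfolding differences_def by blast
    have "shift y \<Lambda> \<in> transversal \<Lambda>"
      unfolding transversal_def using xy(3) shift_in_hull_set[OF hull_set_self[OF delone]]
      by (simp add: mem_shift)
    moreover have "p \<in> shift y \<Lambda>" using xy by (simp add: mem_shift)
    ultimately have "L2_set (\<lambda>i. real_of_int (Z_coord s b p i) - \<l> p i) {..<s} \<le> C" by (rule C)
    moreover have "\<bar>real_of_int (Z_coord s b p i) - \<l> p i\<bar> \<le> L2_set (\<lambda>i. \<bar>real_of_int (Z_coord s b p i) - \<l> p i\<bar>) {..<s}"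
      using \<open>i < s\<close> by (intro member_le_L2_set) auto
    ultimately show ?thesis by (simp add: coord_def L2_set_def)
  qed
  then show ?thesis by (rule that)
qed

lemma lin_ell [simp]: "lin (\<l> x) = x"
proof -
  have "linear (\<lambda>x. lin (\<l> x) - x)"
  proof (rule linearI)
    fix x y and r :: real
    have "lin (\<l> (x + y)) = lin (\<lambda>i. \<l> x i + \<l> y i)" by (intro comb_cong) (simp add: ell_add)
    then show "lin (\<l> (x + y)) - (x + y) = (lin (\<l> x) - x) + (lin (\<l> y) - y)"
      by (simp add: comb_add)
    have "lin (\<l> (r *\<^sub>R x)) = lin (\<lambda>i. r * \<l> x i)"
      by (intro comb_cong) (simp add: linear_scale[OF linear_address])
    then show "lin (\<l> (r *\<^sub>R x)) - r *\<^sub>R x = r *\<^sub>R (lin (\<l> x) - x)"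
      by (simp add: comb_scale scaleR_diff_right)
  qed
  moreover have "relatively_dense (differences \<Lambda>)"
    using delone_differences unfolding delone_def by blast
  moreover obtain C where C: "\<And>p i. p \<in> differences \<Lambda> \<Longrightarrow> i < s \<Longrightarrow> \<bar>coord p i - \<l> p i\<bar> \<le> C"
    by (rule coord_ell_bounded) blast
  obtain K where K: "K > 0" "\<And>z \<epsilon>. (\<And>i. i < s \<Longrightarrow> \<bar>z i\<bar> \<le> \<epsilon>) \<Longrightarrow> 0 \<le> \<epsilon> \<Longrightarrow> norm (lin z) \<le> K * \<epsilon>"
    using comb_bounded by blast
  have "norm (lin (\<l> p) - p) \<le> K * \<bar>C\<bar>" if p: "p \<in> differences \<Lambda>" for p
  proof -
    have "p = lin (coord p)" using p differences_subset_G by auto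
    then have "lin (\<l> p) - p = lin (\<lambda>i. \<l> p i - coord p i)" unfolding comb_diff by simp
    moreover have "\<bar>\<l> p i - coord p i\<bar> \<le> \<bar>C\<bar>" if "i < s" for i using C[OF p that] by linarith
    ultimately show ?thesis using K(2) by simp
  qed
  ultimately have "lin (\<l> x) - x = 0"
    by (rule linear_eq_0_if_bounded_on_relatively_dense)
  then show ?thesis by simp
qed

lemma span_Z_basis: "span (b ` {..<s}) = UNIV"
proof -
  have "lin z \<in> span (b ` {..<s})" for z
    unfolding comb_def by (intro span_sum span_scale span_base) auto
  then show ?thesis by (metis UNIV_eq_I lin_ell)
qed

text \<open>With this sign, an element of the hull with phase \<open>c\<close> is, up to points over the boundary of the
  window, the set of all \<open>lin c + g\<close> with \<open>S c + \<sigma> g\<close> in the window, as soon as this holds for one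
  element.  A suitable choice of \<open>z0\<close> gives a translate of \<open>\<Lambda>\<close> the phase \<open>0\<close>.\<close>

definition phase :: "'a set \<Rightarrow> (nat \<Rightarrow> real) \<Rightarrow> bool" where
  "phase X c \<longleftrightarrow> X \<in> hull_set \<Lambda> \<and> \<pi> X = torus_class s (\<lambda>i. z0 i - c i)"

lemma continuous_pi: "continuous_map (hull_topology \<Lambda>) (torus_topology s) \<pi>"
  using homomorphism unfolding address_homomorphism_def equivariant_map_def by blast

lemma pi_shift: "X \<in> hull_set \<Lambda> \<Longrightarrow> \<pi> (shift t X) = rn_translate s (\<l> t) (\<pi> X)"
  using homomorphism unfolding address_homomorphism_def equivariant_map_def address_action_def
  by (simp add: topspace_hull_topology)

lemma phase_ex:
  assumes "X \<in> hull_set \<Lambda>" obtains c where "phase X c"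
proof -
  have "\<pi> X \<in> topspace (torus_topology s)"
    using continuous_pi assms unfolding continuous_map_def by (auto simp: topspace_hull_topology)
  then obtain z where "\<pi> X = torus_class s z" unfolding topspace_torus by blast
  then have "phase X (\<lambda>i. z0 i - z i)" unfolding phase_def using assms by simp
  then show ?thesis by (rule that)
qed

lemma phase_iff: "phase X c \<Longrightarrow> phase X c' \<longleftrightarrow> (\<forall>i<s. c i - c' i \<in> \<int>)"
  unfolding phase_def by (auto simp: torus_class_eq_iff)
    (metis Ints_minus minus_diff_eq)+

lemma phase_add_coord: "phase X c \<Longrightarrow> phase X (\<lambda>i. c i + coord g i)"
  by (simp add: phase_iff[of X c "\<lambda>i. c i + coord g i"])

lemma phase_cong: "phase X c \<Longrightarrow> (\<And>i. i < s \<Longrightarrow> c i = c' i) \<Longrightarrow> phase X c'"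
  by (simp add: phase_iff[of X c c'])

lemma phase_shift: "phase X c \<Longrightarrow> phase (shift x X) (\<lambda>i. c i - \<l> x i)"
  unfolding phase_def
  by (auto simp: pi_shift rn_translate_torus_class algebra_simps intro: shift_in_hull_set torus_class_cong)

lemma phase_in_hull: "phase X c \<Longrightarrow> X \<in> hull_set \<Lambda>"
  unfolding phase_def by blast

lemma phases_differ_by_coord:
  assumes "phase X c" "phase X c'"
  obtains h where "h \<in> G" "\<And>i. i < s \<Longrightarrow> c' i = c i + coord h i"
proof -
  have "\<forall>i<s. c' i - c i \<in> \<int>" by (rule phase_iff[OF assms(2), THEN iffD1, OF assms(1)])
  then obtain h where h: "h \<in> G" "\<And>i. i < s \<Longrightarrow> coord h i = c' i - c i"
    using Ints_coord[of "\<lambda>i. c' i - c i"] by blast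
  have "c' i = c i + coord h i" if "i < s" for i using h(2)[OF that] by simp
  with h(1) show ?thesis by (rule that)
qed

lemma phase_continuous:
  assumes "phase X c" "\<epsilon> > 0"
  obtains R where "\<forall>Y\<in>hull_set \<Lambda>. Y \<inter> cball 0 R = X \<inter> cball 0 R \<longrightarrow>
    (\<exists>c'. phase Y c' \<and> (\<forall>i<s. \<bar>c' i - c i\<bar> < \<epsilon>))"
proof -
  let ?V = "{torus_class s y | y. \<forall>i<s. \<bar>y i - (z0 i - c i)\<bar> < \<epsilon>}"
  have "\<pi> X \<in> ?V"
    using assms unfolding phase_def by (intro CollectI exI[of _ "\<lambda>i. z0 i - c i"]) simp
  then obtain R where R: "\<And>Y. Y \<in> hull_set \<Lambda> \<Longrightarrow> Y \<inter> cball 0 R = X \<inter> cball 0 R \<Longrightarrow> \<pi> Y \<in> ?V"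
    by (rule hull_continuous_map_agree[OF continuous_pi phase_in_hull[OF assms(1)] openin_torus_ball]) blast
  have "\<exists>c'. phase Y c' \<and> (\<forall>i<s. \<bar>c' i - c i\<bar> < \<epsilon>)"
    if Y: "Y \<in> hull_set \<Lambda>" "Y \<inter> cball 0 R = X \<inter> cball 0 R" for Y
  proof -
    obtain y where y: "\<pi> Y = torus_class s y" "\<And>i. i < s \<Longrightarrow> \<bar>y i - (z0 i - c i)\<bar> < \<epsilon>"
      using R[OF Y] by blast
    have "phase Y (\<lambda>i. z0 i - y i)" unfolding phase_def using Y(1) y(1) by simp
    moreover have "\<bar>z0 i - y i - c i\<bar> < \<epsilon>" if "i < s" for i using y(2)[OF that] by linarith
    ultimately show ?thesis by blast
  qed
  then have "\<forall>Y\<in>hull_set \<Lambda>. Y \<inter> cball 0 R = X \<inter> cball 0 R \<longrightarrow>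
    (\<exists>c'. phase Y c' \<and> (\<forall>i<s. \<bar>c' i - c i\<bar> < \<epsilon>))" by blast
  then show ?thesis by (rule that)
qed

text \<open>The larger of two radii is used: R for the agreement asked for, R' for continuity of the
  phase at Y. The vector \<delta> is the distance from a phase of \<open>shift u X\<close> to c',
  and h accounts for phases being determined only modulo integers.\<close>

lemma hull_approx:
  assumes "phase X c" "phase Y c'" "\<epsilon> > 0"
  obtains u h \<delta> where "h \<in> G" "\<forall>i<s. \<bar>\<delta> i\<bar> < \<epsilon>" "Y \<inter> cball 0 R = shift u X \<inter> cball 0 R"
    "\<forall>i<s. c' i = c i - \<l> u i + coord h i + \<delta> i"
proof -
  obtain R' where R': "\<forall>Z\<in>hull_set \<Lambda>. Z \<inter> cball 0 R' = Y \<inter> cball 0 R' \<longrightarrow>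
    (\<exists>c. phase Z c \<and> (\<forall>i<s. \<bar>c i - c' i\<bar> < \<epsilon>))"
    using phase_continuous[OF assms(2,3)] .
  obtain u where u: "Y \<inter> cball 0 (max R R') = shift u X \<inter> cball 0 (max R R')"
    using repetitive_hull_agree[OF repetitive phase_in_hull[OF assms(1)] phase_in_hull[OF assms(2)]] .
  have "shift u X \<inter> cball 0 R' = Y \<inter> cball 0 R'"
    by (rule agree_mono[OF u[symmetric]]) simp
  then obtain d where d: "phase (shift u X) d" "\<And>i. i < s \<Longrightarrow> \<bar>d i - c' i\<bar> < \<epsilon>"
    using R'[rule_format, OF shift_in_hull_set[OF phase_in_hull[OF assms(1)]]] by blast
  obtain h where h: "h \<in> G" "\<And>i. i < s \<Longrightarrow> d i = c i - \<l> u i + coord h i"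
    using phases_differ_by_coord[OF phase_shift[OF assms(1)] d(1)] by blast
  show ?thesis
  proof (rule that[of h "\<lambda>i. c' i - d i" u])
    show "Y \<inter> cball 0 R = shift u X \<inter> cball 0 R" by (rule agree_mono[OF u]) simp
    show "\<forall>i<s. \<bar>c' i - d i\<bar> < \<epsilon>" using d(2) by (simp add: abs_minus_commute)
    show "\<forall>i<s. c' i = c i - \<l> u i + coord h i + (c' i - d i)" using h(2) by simp
  qed (rule h(1))
qed

text \<open>Sequential compactness for elements that need not contain 0. Each is recentered at a
  point \<open>y k\<close> in a fixed ball, the recentered sets converge because patterns freeze,
  and the limit is moved back by the limit y' of the centers. Since the centers move, points of Y
  are approximated rather than hit.\<close>

lemma hull_limit:
  assumes X: "\<And>k. phase (X k) (c k)" and c: "\<And>i. i < s \<Longrightarrow> (\<lambda>k. c k i) \<longlonglongrightarrow> c' i"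
  obtains r Y where "strict_mono (r :: nat \<Rightarrow> nat)" "phase Y c'"
    "\<forall>x\<in>Y. \<forall>\<epsilon>>0. \<exists>K. \<forall>k\<ge>K. \<exists>x'\<in>X (r k). dist x' x < \<epsilon>"
    "(\<forall>k. 0 \<in> X k) \<longrightarrow> 0 \<in> Y"
proof -
  obtain R where R: "R > 0" "\<And>X x. X \<in> hull_set \<Lambda> \<Longrightarrow> X \<inter> cball x R \<noteq> {}"
    by (rule hull_set_uniformly_relatively_dense[OF delone]) blast
  \<comment> \<open>Taking 0 as center whenever possible is what makes the last conclusion
    hold.\<close>
  have "\<exists>y. y \<in> X k \<and> y \<in> cball 0 R \<and> (0 \<in> X k \<longrightarrow> y = 0)" for k
    using R(1) R(2)[OF phase_in_hull[OF X[of k]], of 0] by (cases "0 \<in> X k") auto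
  then obtain y where y: "\<And>k. y k \<in> X k" "\<And>k. y k \<in> cball 0 R" "\<And>k. 0 \<in> X k \<Longrightarrow> y k = 0"
    by metis
  obtain y' r1 where r1: "strict_mono (r1 :: nat \<Rightarrow> nat)" "(y \<circ> r1) \<longlonglongrightarrow> y'"
    using compact_cball[of "0::'a" R] y(2) unfolding compact_def by meson
  define Z where "Z k = shift (y (r1 k)) (X (r1 k))" for k
  have "Z k \<in> hull_set \<Lambda>" "0 \<in> Z k" for k
    unfolding Z_def using y(1) phase_in_hull[OF X] by (auto simp: mem_shift intro: shift_in_hull_set)
  then obtain r2 Y where r2: "strict_mono (r2 :: nat \<Rightarrow> nat)" and Y: "Y \<in> hull_set \<Lambda>" "0 \<in> Y"
    and agree: "\<And>R. \<exists>K. \<forall>k\<ge>K. Z (r2 k) \<inter> cball 0 R = Y \<inter> cball 0 R"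
    by (rule hull_set_sequentially_compact[OF meyer, of Z]) blast
  define r where "r = r1 \<circ> r2"
  have r: "strict_mono r" unfolding r_def by (rule strict_mono_o[OF r1(1) r2])
  have yr: "(\<lambda>k. y (r k)) \<longlonglongrightarrow> y'"
    using LIMSEQ_subseq_LIMSEQ[OF r1(2) r2] by (simp add: r_def o_def)
  have Zr: "Z (r2 k) = shift (y (r k)) (X (r k))" for k by (simp add: Z_def r_def)
  obtain c0 where c0: "phase Y c0" using phase_ex[OF Y(1)] .
  \<comment> \<open>\<open>c0\<close> is an arbitrary phase of Y. Phases of \<open>Z (r2 k)\<close>
    come close to it by continuity, and modulo integers they tend to c' - \<l> y'; so the difference
    is approximated by integers.\<close>
  have int: "c0 i - (c' i - \<l> y' i) \<in> \<int>" if i: "i < s" for i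
  proof (rule Ints_if_approx)
    fix \<epsilon> :: real assume \<epsilon>: "\<epsilon> > 0"
    have "\<epsilon> / 2 > 0" using \<epsilon> by simp
    from phase_continuous[OF c0 this]
    obtain R' where R': "\<forall>Z\<in>hull_set \<Lambda>. Z \<inter> cball 0 R' = Y \<inter> cball 0 R' \<longrightarrow>
      (\<exists>c. phase Z c \<and> (\<forall>i<s. \<bar>c i - c0 i\<bar> < \<epsilon> / 2))"
      .
    have "(\<lambda>k. c (r k) i - \<l> (y (r k)) i) \<longlonglongrightarrow> c' i - \<l> y' i"
    proof (intro tendsto_diff)
      show "(\<lambda>k. c (r k) i) \<longlonglongrightarrow> c' i"
        using LIMSEQ_subseq_LIMSEQ[OF c[OF i] r] by (simp add: o_def)
      show "(\<lambda>k. \<l> (y (r k)) i) \<longlonglongrightarrow> \<l> y' i"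
        using linear_continuous_on[OF linear_conv_bounded_linear[THEN iffD1, OF linear_address[OF i]], of UNIV] yr
        by (auto simp: continuous_on_def intro: tendsto_compose[of "\<lambda>t. \<l> t i"])
    qed
    then obtain K1 where K1: "\<And>k. k \<ge> K1 \<Longrightarrow> \<bar>(c (r k) i - \<l> (y (r k)) i) - (c' i - \<l> y' i)\<bar> < \<epsilon> / 2"
      using \<epsilon> unfolding LIMSEQ_def dist_real_def by (meson half_gt_zero)
    obtain K2 where K2: "\<And>k. k \<ge> K2 \<Longrightarrow> Z (r2 k) \<inter> cball 0 R' = Y \<inter> cball 0 R'" using agree by blast
    define k where "k = max K1 K2"
    have ph: "phase (Z (r2 k)) (\<lambda>i. c (r k) i - \<l> (y (r k)) i)"
      unfolding Zr by (rule phase_shift[OF X])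
    have "Z (r2 k) \<inter> cball 0 R' = Y \<inter> cball 0 R'" by (rule K2) (simp add: k_def)
    then have "\<exists>d. phase (Z (r2 k)) d \<and> (\<forall>i<s. \<bar>d i - c0 i\<bar> < \<epsilon> / 2)"
      by (rule R'[THEN bspec, THEN mp, OF phase_in_hull[OF ph]])
    then obtain d where d: "phase (Z (r2 k)) d" "\<forall>i<s. \<bar>d i - c0 i\<bar> < \<epsilon> / 2"
      by blast
    have "d i - (c (r k) i - \<l> (y (r k)) i) \<in> \<int>"
      using phase_iff[OF d(1), THEN iffD1, OF ph] i by blast
    moreover have "\<bar>(c0 i - (c' i - \<l> y' i)) - (d i - (c (r k) i - \<l> (y (r k)) i))\<bar> < \<epsilon>"
      using d(2)[rule_format, OF i] K1[of k] unfolding k_def by linarith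
    ultimately show "\<exists>m\<in>\<int>. \<bar>c0 i - (c' i - \<l> y' i) - m\<bar> < \<epsilon>" by blast
  qed
  then have "phase Y (\<lambda>i. c' i - \<l> y' i)" by (intro phase_iff[OF c0, THEN iffD2]) blast
  then have ph: "phase (shift (- y') Y) c'"
    by (rule phase_cong[OF phase_shift]) (simp add: ell_minus)
  show ?thesis
  proof (rule that[OF r ph]; intro ballI allI impI)
    fix x and \<epsilon> :: real assume x: "x \<in> shift (- y') Y" and \<epsilon>: "\<epsilon> > 0"
    have x': "x - y' \<in> Y" using x by (simp add: mem_shift)
    obtain K1 where K1: "\<And>k. k \<ge> K1 \<Longrightarrow> Z (r2 k) \<inter> cball 0 (norm (x - y')) = Y \<inter> cball 0 (norm (x - y'))"
      using agree by blast
    obtain K2 where K2: "\<And>k. k \<ge> K2 \<Longrightarrow> dist (y (r k)) y' < \<epsilon>"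
      using yr \<epsilon> unfolding LIMSEQ_def by blast
    have "\<exists>x'\<in>X (r k). dist x' x < \<epsilon>" if k: "k \<ge> max K1 K2" for k
    proof -
      have "x - y' \<in> Y \<inter> cball 0 (norm (x - y'))" using x' by simp
      then have "x - y' \<in> Z (r2 k)" using K1[of k] k by (metis IntD1 max.bounded_iff)
      then have "x - y' + y (r k) \<in> X (r k)" by (simp add: Zr mem_shift)
      moreover have "dist (x - y' + y (r k)) x < \<epsilon>" using K2[of k] k by (simp add: dist_norm)
      ultimately show ?thesis by blast
    qed
    then show "\<exists>K. \<forall>k\<ge>K. \<exists>x'\<in>X (r k). dist x' x < \<epsilon>" by blast
  next
    assume 0: "\<forall>k. 0 \<in> X k"
    then have "y k = 0" for k using y(3) by blast
    then have "y' = 0" using yr by (simp add: LIMSEQ_const_iff)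
    then show "0 \<in> shift (- y') Y" using Y(2) by simp
  qed
qed

end

section \<open>Cut and project data for the address system\<close>

definition internal :: "nat \<Rightarrow> nat \<Rightarrow> (nat \<Rightarrow> 'a) \<Rightarrow> ('a \<Rightarrow> nat \<Rightarrow> real) \<Rightarrow> (nat \<Rightarrow> real) \<Rightarrow> (nat \<Rightarrow> real)" where
  "internal s n b \<sigma> z = (\<lambda>j\<in>{..<n}. \<Sum>i<s. z i * \<sigma> (b i) j)"

lemma internal_in_rn [simp]: "internal s n b \<sigma> z \<in> rn n"
  unfolding internal_def by simp

lemma internal_add: "j < n \<Longrightarrow> internal s n b \<sigma> (\<lambda>i. x i + y i) j = internal s n b \<sigma> x j + internal s n b \<sigma> y j"
  and internal_diff: "j < n \<Longrightarrow> internal s n b \<sigma> (\<lambda>i. x i - y i) j = internal s n b \<sigma> x j - internal s n b \<sigma> y j"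
  and internal_scale: "j < n \<Longrightarrow> internal s n b \<sigma> (\<lambda>i. k * x i) j = k * internal s n b \<sigma> x j"
  by (simp_all add: internal_def algebra_simps sum.distrib sum_subtractf sum_distrib_left)

lemma internal_cong: "(\<And>i. i < s \<Longrightarrow> x i = y i) \<Longrightarrow> internal s n b \<sigma> x = internal s n b \<sigma> y"
  by (simp add: internal_def)

lemma matrix_bounded:
  fixes A :: "nat \<Rightarrow> nat \<Rightarrow> real"
  obtains K where "K > 0" "\<forall>z \<epsilon>. (\<forall>i<s. \<bar>z i\<bar> \<le> \<epsilon>) \<longrightarrow> 0 \<le> \<epsilon> \<longrightarrow> (\<forall>j<n. \<bar>\<Sum>i<s. z i * A i j\<bar> \<le> K * \<epsilon>)"
proof -
  define K where "K = 1 + (\<Sum>j<n. \<Sum>i<s. \<bar>A i j\<bar>)"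
  have "\<bar>\<Sum>i<s. z i * A i j\<bar> \<le> K * \<epsilon>"
    if z: "\<forall>i<s. \<bar>z i\<bar> \<le> \<epsilon>" and \<epsilon>: "0 \<le> \<epsilon>" and j: "j < n" for z \<epsilon> j
  proof -
    have "\<bar>\<Sum>i<s. z i * A i j\<bar> \<le> (\<Sum>i<s. \<bar>z i * A i j\<bar>)" by (rule sum_abs)
    also have "\<dots> \<le> (\<Sum>i<s. \<epsilon> * \<bar>A i j\<bar>)"
      using z by (intro sum_mono) (auto simp: abs_mult intro: mult_right_mono)
    also have "\<dots> = \<epsilon> * (\<Sum>i<s. \<bar>A i j\<bar>)" by (simp add: sum_distrib_left)
    also have "\<dots> \<le> \<epsilon> * K"
    proof (rule mult_left_mono[OF _ \<epsilon>])
      have "(\<Sum>i<s. \<bar>A i j\<bar>) \<le> (\<Sum>j<n. \<Sum>i<s. \<bar>A i j\<bar>)"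
        using j by (intro member_le_sum) (auto intro: sum_nonneg)
      then show "(\<Sum>i<s. \<bar>A i j\<bar>) \<le> K" unfolding K_def by simp
    qed
    finally show ?thesis by (simp add: mult.commute)
  qed
  moreover have "K > 0" unfolding K_def by (simp add: add_pos_nonneg sum_nonneg)
  ultimately show ?thesis using that by blast
qed

text \<open>Additivity on G forces linearity over the integers, first for natural and then for
  negative multiples, so the values on the basis determine \<sigma>.\<close>

lemma (in address_system) internal_coord:
  assumes \<sigma>: "\<And>g. g \<in> G \<Longrightarrow> \<sigma> g \<in> rn n" "\<And>g h. g \<in> G \<Longrightarrow> h \<in> G \<Longrightarrow> \<sigma> (g + h) = rn_add n (\<sigma> g) (\<sigma> h)"
    and g: "g \<in> G"
  shows "internal s n b \<sigma> (coord g) = \<sigma> g"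
proof (rule rn_eqI)
  show "\<sigma> g \<in> rn n" using \<sigma>(1) g .
  fix j assume j: "j < n"
  have add: "\<sigma> (x + y) j = \<sigma> x j + \<sigma> y j" if "x \<in> G" "y \<in> G" for x y
    using \<sigma>(2)[OF that] j by (simp add: rn_add_def)
  have zero: "\<sigma> 0 j = 0" using add[of 0 0] by simp
  have minus: "\<sigma> (- x) j = - \<sigma> x j" if "x \<in> G" for x
    using add[OF that G_minus[OF that]] zero by simp
  have nat: "\<sigma> (real k *\<^sub>R x) j = real k * \<sigma> x j" if "x \<in> G" for k x
    using that by (induction k) (simp_all add: zero scaleR_add_left add G_scale_nat algebra_simps)
  have int: "\<sigma> (real_of_int k *\<^sub>R x) j = real_of_int k * \<sigma> x j" if "x \<in> G" for k x
  proof (cases "k \<ge> 0")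
    case True
    then show ?thesis using nat[OF that, of "nat k"] by simp
  next
    case False
    then show ?thesis
      using minus[OF G_scale_nat[OF that, of "nat (- k)"]] nat[OF that, of "nat (- k)"] by simp
  qed
  have sum: "\<sigma> (sum f I) j = (\<Sum>i\<in>I. \<sigma> (f i) j)" if "finite I" "\<And>i. i \<in> I \<Longrightarrow> f i \<in> G" for f :: "nat \<Rightarrow> 'a" and I
    using that by (induction I rule: finite_induct) (simp_all add: zero add G_sum)
  have "\<sigma> (lin (coord g)) j = (\<Sum>i<s. \<sigma> (coord g i *\<^sub>R b i) j)"
    unfolding comb_def by (rule sum) (auto simp: coord_def intro: G_scale_int basis_in_G)
  also have "\<dots> = (\<Sum>i<s. coord g i * \<sigma> (b i) j)"
    unfolding coord_def by (intro sum.cong) (auto simp: int basis_in_G)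
  finally show "internal s n b \<sigma> (coord g) j = \<sigma> g j"
    using j g by (simp add: internal_def)
qed simp

text \<open>Both implications meet here. The matrix \<tau> describes a section T of \<open>S\<close>
  into the kernel of \<open>lin\<close>; together with \<open>internal_ell\<close> the last three
  assumptions split \<open>\<real>\<^sup>s\<close> into the images of \<l> and T.\<close>

locale cut_project = address_system +
  fixes n :: nat and \<sigma> :: "'a \<Rightarrow> nat \<Rightarrow> real" and \<tau> :: "nat \<Rightarrow> nat \<Rightarrow> real"
  assumes sigma_in_rn: "g \<in> G \<Longrightarrow> \<sigma> g \<in> rn n"
    and sigma_add: "g \<in> G \<Longrightarrow> h \<in> G \<Longrightarrow> \<sigma> (g + h) = rn_add n (\<sigma> g) (\<sigma> h)"
    and internal_ell: "j < n \<Longrightarrow> internal s n b \<sigma> (\<l> x) j = 0"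
    and decomposition: "i < s \<Longrightarrow> z i = \<l> (comb s b z) i + (\<Sum>j<n. internal s n b \<sigma> z j * \<tau> j i)"
    and internal_section: "j < n \<Longrightarrow> internal s n b \<sigma> (\<lambda>i. \<Sum>j<n. y j * \<tau> j i) j = y j"
    and comb_section: "comb s b (\<lambda>i. \<Sum>j<n. y j * \<tau> j i) = 0"
begin

abbreviation S :: "(nat \<Rightarrow> real) \<Rightarrow> (nat \<Rightarrow> real)" where "S \<equiv> internal s n b \<sigma>"

definition T :: "(nat \<Rightarrow> real) \<Rightarrow> (nat \<Rightarrow> real)" where "T y i = (\<Sum>j<n. y j * \<tau> j i)"

lemma decomp: "i < s \<Longrightarrow> z i = \<l> (lin z) i + T (S z) i"
  unfolding T_def by (rule decomposition)

lemma S_T: "j < n \<Longrightarrow> S (T y) j = y j"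
  using internal_section unfolding T_def[abs_def] .

lemma lin_T [simp]: "lin (T y) = 0"
  using comb_section unfolding T_def[abs_def] .

lemma S_coord: "g \<in> G \<Longrightarrow> S (coord g) = \<sigma> g"
  by (rule internal_coord) (auto intro: sigma_in_rn sigma_add)

lemma sigma_diff: "g \<in> G \<Longrightarrow> h \<in> G \<Longrightarrow> j < n \<Longrightarrow> \<sigma> (g - h) j = \<sigma> g j - \<sigma> h j"
  using sigma_add[of "g - h" h] by (simp add: G_diff rn_add_def)

lemma sigma_add': "g \<in> G \<Longrightarrow> h \<in> G \<Longrightarrow> j < n \<Longrightarrow> \<sigma> (g + h) j = \<sigma> g j + \<sigma> h j"
  by (simp add: sigma_add rn_add_def)

lemma sigma_0: "j < n \<Longrightarrow> \<sigma> 0 j = 0"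
  using sigma_diff[of 0 0 j] by simp

lemma coord_decomp: "g \<in> G \<Longrightarrow> i < s \<Longrightarrow> coord g i = \<l> g i + T (\<sigma> g) i"
  using decomp[of i "coord g"] by (simp add: S_coord)

lemma S_bounded:
  obtains K where "K > 0" "\<forall>z \<epsilon>. (\<forall>i<s. \<bar>z i\<bar> \<le> \<epsilon>) \<longrightarrow> 0 \<le> \<epsilon> \<longrightarrow> (\<forall>j<n. \<bar>S z j\<bar> \<le> K * \<epsilon>)"
  by (rule matrix_bounded[where s=s and n=n and A="\<lambda>i j. \<sigma> (b i) j"]) (simp add: internal_def)

lemma T_bounded:
  obtains K where "K > 0" "\<forall>y \<epsilon>. (\<forall>j<n. \<bar>y j\<bar> \<le> \<epsilon>) \<longrightarrow> 0 \<le> \<epsilon> \<longrightarrow> (\<forall>i<s. \<bar>T y i\<bar> \<le> K * \<epsilon>)"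
  by (rule matrix_bounded[where s=n and n=s and A=\<tau>]) (simp add: T_def)

lemma T_diff: "T (\<lambda>j. x j - y j) i = T x i - T y i"
  by (simp add: T_def algebra_simps sum_subtractf)

text \<open>By \<open>coord_decomp\<close>, bounds on g and on \<sigma> g bound all s integer
  coordinates of g.\<close>

lemma finite_lattice_bounded: "finite {g \<in> G. norm g \<le> B \<and> (\<forall>j<n. \<bar>\<sigma> g j\<bar> \<le> B)}"
proof -
  obtain K1 where K1: "K1 > 0" "\<And>x i. i < s \<Longrightarrow> \<bar>\<l> x i\<bar> \<le> K1 * norm x"
    by (rule ell_bounded) blast
  obtain K2 where K2: "K2 > 0" "\<forall>y \<epsilon>. (\<forall>j<n. \<bar>y j\<bar> \<le> \<epsilon>) \<longrightarrow> 0 \<le> \<epsilon> \<longrightarrow> (\<forall>i<s. \<bar>T y i\<bar> \<le> K2 * \<epsilon>)"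
    by (rule T_bounded)
  define N where "N = \<lceil>K1 * B + K2 * B\<rceil>"
  have "{g \<in> G. norm g \<le> B \<and> (\<forall>j<n. \<bar>\<sigma> g j\<bar> \<le> B)} \<subseteq>
      (\<lambda>c. lin (\<lambda>i. real_of_int (c i))) ` Pi\<^sub>E {..<s} (\<lambda>_. {-N..N})"
  proof
    fix g assume "g \<in> {g \<in> G. norm g \<le> B \<and> (\<forall>j<n. \<bar>\<sigma> g j\<bar> \<le> B)}"
    then have g: "g \<in> G" "norm g \<le> B" "\<forall>j<n. \<bar>\<sigma> g j\<bar> \<le> B" by auto
    have "B \<ge> 0" using g(2) norm_ge_zero order_trans by blast
    have "\<bar>Z_coord s b g i\<bar> \<le> N" if "i < s" for i
    proof -
      have "\<bar>\<l> g i\<bar> \<le> K1 * B" using K1(2)[OF that, of g] mult_left_mono[OF g(2), of K1] K1(1) by linarith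
      moreover have "\<bar>T (\<sigma> g) i\<bar> \<le> K2 * B" using K2(2) g(3) \<open>B \<ge> 0\<close> that by blast
      ultimately have "\<bar>coord g i\<bar> \<le> K1 * B + K2 * B" using coord_decomp[OF g(1) that] by linarith
      then show ?thesis unfolding N_def coord_def by linarith
    qed
    then have "restrict (Z_coord s b g) {..<s} \<in> Pi\<^sub>E {..<s} (\<lambda>_. {-N..N})"
      by (auto simp: abs_le_iff minus_le_iff)
    moreover have "g = lin (\<lambda>i. real_of_int (restrict (Z_coord s b g) {..<s} i))"
      using lin_coord[OF g(1)] comb_cong[of s "coord g" "\<lambda>i. real_of_int (restrict (Z_coord s b g) {..<s} i)" b]
      by (simp add: coord_def)
    ultimately show "g \<in> (\<lambda>c. lin (\<lambda>i. real_of_int (c i))) ` Pi\<^sub>E {..<s} (\<lambda>_. {-N..N})" by blast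
  qed
  then show ?thesis by (rule finite_subset) (simp add: finite_PiE)
qed

text \<open>The nonzero points of a finite set keep a positive distance from 0. Used to show that
  the lattice point behind a point near the origin is 0.\<close>

lemma lattice_discrete:
  obtains \<delta> where "\<delta> > 0" "\<forall>g\<in>G. norm g < \<delta> \<longrightarrow> (\<forall>j<n. \<bar>\<sigma> g j\<bar> \<le> B) \<longrightarrow> g = 0"
proof -
  define F where "F = {g \<in> G. norm g \<le> max B 1 \<and> (\<forall>j<n. \<bar>\<sigma> g j\<bar> \<le> max B 1)}"
  have "finite F" unfolding F_def by (rule finite_lattice_bounded)
  \<comment> \<open>The inserted 1 bounds \<delta>, so that \<open>norm g < \<delta>\<close> already
    places g in F.\<close>
  define \<delta> where "\<delta> = Min (insert 1 (norm ` (F - {0})))"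
  have \<delta>: "\<delta> > 0" "\<delta> \<le> 1" "\<And>g. g \<in> F \<Longrightarrow> g \<noteq> 0 \<Longrightarrow> \<delta> \<le> norm g"
    unfolding \<delta>_def using \<open>finite F\<close> by auto
  have "g = 0" if "g \<in> G" "norm g < \<delta>" "\<forall>j<n. \<bar>\<sigma> g j\<bar> \<le> B" for g
  proof -
    have "g \<in> F" unfolding F_def using that \<delta>(2) by auto
    then show ?thesis using \<delta>(3)[of g] that(2) by fastforce
  qed
  with \<delta>(1) show ?thesis using that by blast
qed

text \<open>The model set with parameter c. Adding \<open>coord h\<close> to c only reindexes g by
  h, so the set depends on the torus class of c alone.\<close>

definition model :: "(nat \<Rightarrow> real) \<Rightarrow> (nat \<Rightarrow> real) set \<Rightarrow> 'a set" where
  "model c V = {lin c + g | g. g \<in> G \<and> rn_add n (S c) (\<sigma> g) \<in> V}"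

lemma approx_parts:
  assumes "h \<in> G" "\<forall>i<s. c' i = c i - \<l> u i + coord h i + \<delta> i"
  shows "lin c' = lin c - u + h + lin \<delta>" "j < n \<Longrightarrow> S c' j = S c j + \<sigma> h j + S \<delta> j"
proof -
  have "lin c' = lin (\<lambda>i. c i - \<l> u i + coord h i + \<delta> i)" by (rule comb_cong) (simp add: assms(2))
  then show "lin c' = lin c - u + h + lin \<delta>" using assms(1) by (simp add: comb_add comb_diff)
  have "S c' = S (\<lambda>i. c i - \<l> u i + coord h i + \<delta> i)" by (rule internal_cong) (simp add: assms(2))
  then show "S c' j = S c j + \<sigma> h j + S \<delta> j" if "j < n"
    using assms(1) that by (simp add: internal_add internal_diff internal_ell S_coord)
qed

text \<open>Two elements of the hull agree on large balls up to translation, and then their phases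
  agree up to the lattice and a small error \<open>\<delta>\<close>.  In the limit \<open>\<delta> \<rightarrow> 0\<close> only the closure of the
  window is controlled from above, and only its interior from below.\<close>

lemma phase_subset_model:
  assumes W: "compactin (rn_topology n) W"
    and X: "phase X c0" "X \<subseteq> model c0 W" and Y: "phase Y c"
  shows "Y \<subseteq> model c W"
proof
  fix x assume x: "x \<in> Y"
  have closed: "closedin (rn_topology n) W" using W[unfolded compactin_rn_iff] by blast
  obtain B where "\<forall>w\<in>W. \<forall>j<n. \<bar>w j\<bar> \<le> B" using W[unfolded compactin_rn_iff] by blast
  note B = this[rule_format]
  obtain K1 where K1: "K1 > 0" "\<And>z \<epsilon>. (\<And>i. i < s \<Longrightarrow> \<bar>z i\<bar> \<le> \<epsilon>) \<Longrightarrow> 0 \<le> \<epsilon> \<Longrightarrow> norm (lin z) \<le> K1 * \<epsilon>"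
    by (rule comb_bounded) blast
  obtain K2 where K2: "K2 > 0" "\<forall>z \<epsilon>. (\<forall>i<s. \<bar>z i\<bar> \<le> \<epsilon>) \<longrightarrow> 0 \<le> \<epsilon> \<longrightarrow> (\<forall>j<n. \<bar>S z j\<bar> \<le> K2 * \<epsilon>)"
    by (rule S_bounded)
  have ex: "\<exists>g w. g \<in> G \<and> w \<in> W \<and> norm (x - (lin c + g)) \<le> K1 * \<epsilon> \<and> (\<forall>j<n. \<bar>w j - (S c j + \<sigma> g j)\<bar> \<le> K2 * \<epsilon>)"
    if \<epsilon>: "\<epsilon> > 0" for \<epsilon>
  proof -
    obtain u h and \<delta> :: "nat \<Rightarrow> real" where h: "h \<in> G" and \<delta>: "\<forall>i<s. \<bar>\<delta> i\<bar> < \<epsilon>"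
      and agree: "Y \<inter> cball 0 (norm x) = shift u X \<inter> cball 0 (norm x)"
      and c: "\<forall>i<s. c i = c0 i - \<l> u i + coord h i + \<delta> i"
      by (rule hull_approx[OF X(1) Y \<epsilon>])
    have "x \<in> Y \<inter> cball 0 (norm x)" using x by simp
    then have "x + u \<in> X" unfolding agree by (simp add: mem_shift)
    then obtain g' where g': "x + u = lin c0 + g'" "g' \<in> G" "rn_add n (S c0) (\<sigma> g') \<in> W"
      using X(2) unfolding model_def by blast
    note p = approx_parts[OF h c]
    have "x = lin c0 + g' - u" using g'(1) by (simp add: algebra_simps)
    then have "x - (lin c + (g' - h)) = - lin \<delta>" unfolding p(1) by (simp add: algebra_simps)
    moreover have "norm (lin \<delta>) \<le> K1 * \<epsilon>" using \<delta> \<epsilon> by (intro K1(2)) (auto intro: less_imp_le)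
    moreover have "\<bar>rn_add n (S c0) (\<sigma> g') j - (S c j + \<sigma> (g' - h) j)\<bar> \<le> K2 * \<epsilon>" if "j < n" for j
    proof -
      have "\<bar>S \<delta> j\<bar> \<le> K2 * \<epsilon>" using K2(2) \<delta> \<epsilon> that by (meson less_imp_le)
      moreover have "rn_add n (S c0) (\<sigma> g') j - (S c j + \<sigma> (g' - h) j) = - S \<delta> j"
        using that p(2)[OF that] sigma_diff[OF g'(2) h that] by (simp add: rn_add_def)
      ultimately show ?thesis by simp
    qed
    ultimately show ?thesis
      using g'(3) G_diff[OF g'(2) h]
      by (intro exI[of _ "g' - h"] exI[of _ "rn_add n (S c0) (\<sigma> g')"]) simp
  qed
  have "\<forall>k. \<exists>g w. g \<in> G \<and> w \<in> W \<and> norm (x - (lin c + g)) \<le> K1 * inverse (real (Suc k)) \<and>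
      (\<forall>j<n. \<bar>w j - (S c j + \<sigma> g j)\<bar> \<le> K2 * inverse (real (Suc k)))"
    by (intro allI ex) simp
  then obtain g w where g: "\<And>k. g k \<in> G" and w: "\<And>k. w k \<in> W"
    and gx: "\<And>k. norm (x - (lin c + g k)) \<le> K1 * inverse (real (Suc k))"
    and wg: "\<And>k j. j < n \<Longrightarrow> \<bar>w k j - (S c j + \<sigma> (g k) j)\<bar> \<le> K2 * inverse (real (Suc k))"
    by metis
  \<comment> \<open>C bounds the norm and the \<sigma>-coordinates of every \<open>g k\<close>, all
    errors being at most K1 and K2; so the \<open>g k\<close> range over a finite set.\<close>
  define C where "C = norm x + norm (lin c) + K1 + \<bar>B\<bar> + (\<Sum>j<n. \<bar>S c j\<bar>) + K2"
  have "g k \<in> {g \<in> G. norm g \<le> C \<and> (\<forall>j<n. \<bar>\<sigma> g j\<bar> \<le> C)}" for k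
  proof -
    have i1: "inverse (real (Suc k)) \<le> 1" by (simp add: inverse_le_1_iff)
    have a: "K1 * inverse (real (Suc k)) \<le> K1" "K2 * inverse (real (Suc k)) \<le> K2"
      using mult_left_mono[OF i1, of K1] mult_left_mono[OF i1, of K2] K1(1) K2(1) by simp_all
    have s0: "0 \<le> (\<Sum>j<n. \<bar>S c j\<bar>)" by (intro sum_nonneg) simp
    have "g k = x - lin c - (x - (lin c + g k))" by simp
    then have "norm (g k) \<le> norm (x - lin c) + norm (x - (lin c + g k))" by (metis norm_triangle_ineq4)
    then have "norm (g k) \<le> C"
      using norm_triangle_ineq4[of x "lin c"] gx[of k] a(1) s0 K2(1) unfolding C_def by linarith
    moreover have "\<bar>\<sigma> (g k) j\<bar> \<le> C" if "j < n" for j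
    proof -
      have "\<bar>S c j\<bar> \<le> (\<Sum>j<n. \<bar>S c j\<bar>)" using that by (intro member_le_sum) auto
      then have "\<bar>\<sigma> (g k) j\<bar> \<le> \<bar>B\<bar> + (\<Sum>j<n. \<bar>S c j\<bar>) + K2"
        using B[OF w that, of k] wg[OF that, of k] a(2) by linarith
      then show ?thesis unfolding C_def using K1(1) norm_ge_zero[of x] norm_ge_zero[of "lin c"] by linarith
    qed
    ultimately show ?thesis using g[of k] by simp
  qed
  then have "finite (range g)" using finite_lattice_bounded[of C] by (meson finite_subset image_subsetI)
  \<comment> \<open>One lattice point occurs infinitely often, hence with arbitrarily small errors.
    It then represents x exactly, and its internal part lies in W because W is closed.\<close>
  then obtain k0 where "infinite {k. g k = g k0}" using pigeonhole_infinite[of UNIV g] by auto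
  then have large: "\<exists>k\<ge>N. g k = g k0" for N :: nat
    by (metis (mono_tags) infinite_nat_iff_unbounded_le mem_Collect_eq)
  have small: "\<exists>k. g k = g k0 \<and> K * inverse (real (Suc k)) < \<epsilon>" if "\<epsilon> > 0" "K > 0" for \<epsilon> K
  proof -
    have "\<epsilon> / K > 0" using that by simp
    then obtain N where N: "inverse (real (Suc N)) < \<epsilon> / K" using reals_Archimedean by blast
    obtain k where k: "k \<ge> N" "g k = g k0" using large by blast
    have "inverse (real (Suc k)) \<le> inverse (real (Suc N))" using k(1) by (intro le_imp_inverse_le) auto
    then have "inverse (real (Suc k)) < \<epsilon> / K" using N by linarith
    from mult_strict_left_mono[OF this that(2)]
    have "K * inverse (real (Suc k)) < \<epsilon>" using that(2) by simp
    with k(2) show ?thesis by blast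
  qed
  have "norm (x - (lin c + g k0)) \<le> 0"
  proof (rule field_le_epsilon)
    fix e :: real assume "e > 0"
    then obtain k where "g k = g k0" "K1 * inverse (real (Suc k)) < e" using small K1(1) by blast
    then show "norm (x - (lin c + g k0)) \<le> 0 + e" using gx[of k] by simp
  qed
  then have "x = lin c + g k0" by simp
  moreover have "rn_add n (S c) (\<sigma> (g k0)) \<in> W"
  proof (rule closedin_rnD[OF closed])
    fix e :: real assume "e > 0"
    then obtain k where k: "g k = g k0" "K2 * inverse (real (Suc k)) < e" using small K2(1) by blast
    have "\<forall>j<n. \<bar>w k j - rn_add n (S c) (\<sigma> (g k0)) j\<bar> < e"
      using wg[of _ k] k by (auto simp: rn_add_def intro: le_less_trans)
    then show "\<exists>y\<in>W. \<forall>j<n. \<bar>y j - rn_add n (S c) (\<sigma> (g k0)) j\<bar> < e" using w by blast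
  qed simp
  ultimately show "x \<in> model c W" unfolding model_def using g by blast
qed

text \<open>Openness of U absorbs the error \<open>S \<delta>\<close>, which places x in Y only up
  to \<open>lin \<delta>\<close>; uniform discreteness of Y removes the rest.\<close>

lemma model_subset_phase:
  assumes U: "openin (rn_topology n) U"
    and X: "phase X c0" "model c0 U \<subseteq> X" and Y: "phase Y c"
  shows "model c U \<subseteq> Y"
proof
  fix x assume "x \<in> model c U"
  then obtain g where g: "x = lin c + g" "g \<in> G" "rn_add n (S c) (\<sigma> g) \<in> U"
    unfolding model_def by blast
  obtain \<epsilon>U where \<epsilon>U: "\<epsilon>U > 0" "\<And>y. y \<in> rn n \<Longrightarrow> (\<forall>j<n. \<bar>y j - rn_add n (S c) (\<sigma> g) j\<bar> < \<epsilon>U) \<Longrightarrow> y \<in> U"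
    using U g(3) unfolding openin_rn by blast
  obtain K1 where K1: "K1 > 0" "\<And>z \<epsilon>. (\<And>i. i < s \<Longrightarrow> \<bar>z i\<bar> \<le> \<epsilon>) \<Longrightarrow> 0 \<le> \<epsilon> \<Longrightarrow> norm (lin z) \<le> K1 * \<epsilon>"
    by (rule comb_bounded) blast
  obtain K2 where K2: "K2 > 0" "\<forall>z \<epsilon>. (\<forall>i<s. \<bar>z i\<bar> \<le> \<epsilon>) \<longrightarrow> 0 \<le> \<epsilon> \<longrightarrow> (\<forall>j<n. \<bar>S z j\<bar> \<le> K2 * \<epsilon>)"
    by (rule S_bounded)
  have "uniformly_discrete Y"
    using hull_setD(1)[OF phase_in_hull[OF Y]] unfolding delone_def by blast
  then show "x \<in> Y"
  proof (rule uniformly_discrete_limit_mem)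
    fix \<epsilon> :: real assume \<epsilon>: "\<epsilon> > 0"
    \<comment> \<open>Half of each tolerance, to keep \<open>lin \<delta>\<close> and
      \<open>S \<delta>\<close> strictly below \<epsilon> and \<epsilon>U.\<close>
    define e where "e = min (\<epsilon> / (2 * K1)) (\<epsilon>U / (2 * K2))"
    have e: "e > 0" unfolding e_def using \<epsilon> \<epsilon>U(1) K1(1) K2(1) by simp
    have "K1 * e \<le> K1 * (\<epsilon> / (2 * K1))"
      unfolding e_def by (rule mult_left_mono[OF min.cobounded1]) (use K1(1) in simp)
    moreover have "K2 * e \<le> K2 * (\<epsilon>U / (2 * K2))"
      unfolding e_def by (rule mult_left_mono[OF min.cobounded2]) (use K2(1) in simp)
    ultimately have Ke: "K1 * e < \<epsilon>" "K2 * e < \<epsilon>U"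
      using K1(1) K2(1) \<epsilon> \<epsilon>U(1) by simp_all
    obtain u h \<delta> where h: "h \<in> G" and \<delta>: "\<forall>i<s. \<bar>\<delta> i\<bar> < e"
      and agree: "Y \<inter> cball 0 (norm x + \<epsilon>) = shift u X \<inter> cball 0 (norm x + \<epsilon>)"
      and c: "\<forall>i<s. c i = c0 i - \<l> u i + coord h i + \<delta> i"
      by (rule hull_approx[OF X(1) Y e])
    note p = approx_parts[OF h c]
    have "rn_add n (S c0) (\<sigma> (g + h)) \<in> U"
    proof (rule \<epsilon>U(2))
      show "\<forall>j<n. \<bar>rn_add n (S c0) (\<sigma> (g + h)) j - rn_add n (S c) (\<sigma> g) j\<bar> < \<epsilon>U"
      proof (intro allI impI)
        fix j assume j: "j < n"
        have "\<bar>S \<delta> j\<bar> \<le> K2 * e" using K2(2) \<delta> e j by (meson less_imp_le)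
        moreover have "rn_add n (S c0) (\<sigma> (g + h)) j - rn_add n (S c) (\<sigma> g) j = - S \<delta> j"
          using j p(2)[OF j] sigma_add'[OF g(2) h j] by (simp add: rn_add_def)
        ultimately show "\<bar>rn_add n (S c0) (\<sigma> (g + h)) j - rn_add n (S c) (\<sigma> g) j\<bar> < \<epsilon>U"
          using Ke(2) by simp
      qed
    qed simp
    then have "lin c0 + (g + h) \<in> X"
      using X(2) G_add[OF g(2) h] unfolding model_def by blast
    moreover have "lin c0 + (g + h) = (x - lin \<delta>) + u"
      unfolding g(1) p(1) by (simp add: algebra_simps)
    ultimately have "x - lin \<delta> \<in> shift u X" by (simp add: mem_shift)
    moreover have d: "norm (lin \<delta>) < \<epsilon>"
      using K1(2)[of \<delta> e] \<delta> e Ke(1) by (auto intro: less_imp_le le_less_trans)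
    then have "x - lin \<delta> \<in> cball 0 (norm x + \<epsilon>)"
      using norm_triangle_ineq4[of x "lin \<delta>"] by simp
    ultimately have "x - lin \<delta> \<in> Y" using agree by blast
    then show "\<exists>y\<in>Y. dist y x < \<epsilon>" using d by (intro bexI[of _ "x - lin \<delta>"]) (simp_all add: dist_norm)
  qed
qed

text \<open>Choose h with \<sigma> h near \<open>S v\<close>. After the translation
  \<open>lin v - h\<close> has matched the part along \<l>, only T of the small vector \<sigma> h -
  S v remains.\<close>

lemma dense_orbit:
  assumes dense: "\<And>y \<epsilon>. \<epsilon> > 0 \<Longrightarrow> \<exists>h\<in>G. \<forall>j<n. \<bar>\<sigma> h j - y j\<bar> < \<epsilon>" and \<epsilon>: "\<epsilon> > 0"
  shows "\<exists>t. \<exists>h\<in>G. \<forall>i<s. \<bar>\<l> t i + coord h i - v i\<bar> < \<epsilon>"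
proof -
  obtain K where K: "K > 0" "\<forall>y \<epsilon>. (\<forall>j<n. \<bar>y j\<bar> \<le> \<epsilon>) \<longrightarrow> 0 \<le> \<epsilon> \<longrightarrow> (\<forall>i<s. \<bar>T y i\<bar> \<le> K * \<epsilon>)"
    by (rule T_bounded)
  have "\<epsilon> / (2 * K) > 0" using \<epsilon> K(1) by simp
  from dense[OF this, of "S v"]
  obtain h where h: "h \<in> G" "\<forall>j<n. \<bar>\<sigma> h j - S v j\<bar> < \<epsilon> / (2 * K)" by blast
  have "\<bar>\<l> (lin v - h) i + coord h i - v i\<bar> < \<epsilon>" if "i < s" for i
  proof -
    have "\<l> (lin v - h) i + coord h i - v i = T (\<lambda>j. \<sigma> h j - S v j) i"
      using coord_decomp[OF h(1) that] decomp[OF that, of v] by (simp add: ell_diff[OF that] T_diff)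
    moreover have "\<bar>T (\<lambda>j. \<sigma> h j - S v j) i\<bar> \<le> K * (\<epsilon> / (2 * K))"
      using K(2) h(2) \<open>\<epsilon> / (2 * K) > 0\<close> that by (meson less_imp_le)
    ultimately show ?thesis using K(1) \<epsilon> by simp
  qed
  then show ?thesis using h(1) by blast
qed

text \<open>Phases of translates of \<Lambda> are dense modulo integers by
  \<open>dense_orbit\<close>; compactness turns a limit of phases into a phase.\<close>

lemma phase_surj:
  assumes dense: "\<And>y \<epsilon>. \<epsilon> > 0 \<Longrightarrow> \<exists>h\<in>G. \<forall>j<n. \<bar>\<sigma> h j - y j\<bar> < \<epsilon>"
  shows "\<exists>X. phase X c"
proof -
  obtain c0 where c0: "phase \<Lambda> c0" by (rule phase_ex[OF hull_set_self[OF delone]])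
  have "\<forall>k. \<exists>t h. h \<in> G \<and> (\<forall>i<s. \<bar>\<l> t i + coord h i - (c i - c0 i)\<bar> < inverse (real (Suc k)))"
  proof
    fix k
    show "\<exists>t h. h \<in> G \<and> (\<forall>i<s. \<bar>\<l> t i + coord h i - (c i - c0 i)\<bar> < inverse (real (Suc k)))"
      using dense_orbit[OF dense, of "inverse (real (Suc k))" "\<lambda>i. c i - c0 i"] by auto
  qed
  then obtain t h where h: "\<And>k. h k \<in> G"
    and th: "\<And>k i. i < s \<Longrightarrow> \<bar>\<l> (t k) i + coord (h k) i - (c i - c0 i)\<bar> < inverse (real (Suc k))"
    by metis
  define ck where "ck k i = c0 i - \<l> (- t k) i + coord (h k) i" for k i
  have "phase (shift (- t k) \<Lambda>) (ck k)" for k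
    unfolding ck_def[abs_def] by (rule phase_add_coord[OF phase_shift[OF c0]])
  moreover have "(\<lambda>k. ck k i) \<longlonglongrightarrow> c i" if "i < s" for i
  proof (rule LIMSEQ_if_close)
    show "\<bar>ck k i - c i\<bar> < inverse (real (Suc k))" for k
      using th[OF that, of k] unfolding ck_def ell_minus[OF that] by (simp add: algebra_simps)
  qed
  ultimately show ?thesis by (rule hull_limit) (assumption, rule exI)
qed

end

section \<open>The window of a hull with almost everywhere injective address map\<close>

lemma rn_interior_iff:
  assumes "x \<in> rn n"
  shows "x \<in> rn_topology n interior_of W \<longleftrightarrow>
    \<not> (\<forall>\<epsilon>>0. \<exists>y\<in>rn n - W. \<forall>i<n. \<bar>y i - x i\<bar> < \<epsilon>)"
  unfolding interior_of_closure_of topspace_rn_topology using assms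
  by (simp add: in_closure_of_rn)

context cut_project
begin

definition regular :: "(nat \<Rightarrow> real) \<Rightarrow> bool" where
  "regular c \<longleftrightarrow> (\<forall>X Y. phase X c \<longrightarrow> phase Y c \<longrightarrow> X = Y)"

lemma phase_eq_if_Ints:
  assumes "\<forall>i<s. c i - c' i \<in> \<int>" shows "phase X c \<longleftrightarrow> phase X c'"
proof -
  have "\<forall>i<s. c' i - c i \<in> \<int>" using assms Ints_minus by fastforce
  then show ?thesis using assms phase_iff[of X c c'] phase_iff[of X c' c] by blast
qed

lemma regular_if_Ints: "\<forall>i<s. c i - c' i \<in> \<int> \<Longrightarrow> regular c \<Longrightarrow> regular c'"
  unfolding regular_def by (simp add: phase_eq_if_Ints)

lemma regular_shift:
  assumes "regular c" shows "regular (\<lambda>i. c i - \<l> x i)"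
  unfolding regular_def
proof (intro allI impI)
  have *: "phase (shift (- x) X) c" if "phase X (\<lambda>i. c i - \<l> x i)" for X
    by (rule phase_cong[OF phase_shift[OF that]]) (simp add: ell_minus)
  fix X Y assume "phase X (\<lambda>i. c i - \<l> x i)" "phase Y (\<lambda>i. c i - \<l> x i)"
  then have "shift (- x) X = shift (- x) Y" using assms * unfolding regular_def by blast
  then show "X = Y" by (metis shift_minus_shift(2))
qed

text \<open>The translation by \<open>lin c\<close> takes phase c to \<open>T (S c)\<close>. Hence
  regularity can be studied in internal space.\<close>

lemma regular_T_S:
  assumes "regular c" shows "regular (T (S c))"
proof (rule regular_if_Ints[OF _ regular_shift[OF assms]])
  show "\<forall>i<s. c i - \<l> (lin c) i - T (S c) i \<in> \<int>" using decomp[of _ c] by simp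
qed

text \<open>\<sigma> p is the image under \<open>S\<close> of \<open>coord p - \<l> p\<close>,
  because \<open>S\<close> kills \<l>, and that vector is bounded on differences.\<close>

lemma sigma_differences_bounded:
  obtains B where "\<forall>p\<in>differences \<Lambda>. \<forall>j<n. \<bar>\<sigma> p j\<bar> \<le> B"
proof -
  obtain C where C: "\<And>p i. p \<in> differences \<Lambda> \<Longrightarrow> i < s \<Longrightarrow> \<bar>coord p i - \<l> p i\<bar> \<le> C"
    by (rule coord_ell_bounded) blast
  obtain K where K: "K > 0" "\<forall>z \<epsilon>. (\<forall>i<s. \<bar>z i\<bar> \<le> \<epsilon>) \<longrightarrow> 0 \<le> \<epsilon> \<longrightarrow> (\<forall>j<n. \<bar>S z j\<bar> \<le> K * \<epsilon>)"
    by (rule S_bounded)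
  have "\<bar>\<sigma> p j\<bar> \<le> K * \<bar>C\<bar>" if p: "p \<in> differences \<Lambda>" and j: "j < n" for p j
  proof -
    have "\<forall>i<s. \<bar>coord p i - \<l> p i\<bar> \<le> \<bar>C\<bar>" using C[OF p] by fastforce
    then have "\<bar>S (\<lambda>i. coord p i - \<l> p i) j\<bar> \<le> K * \<bar>C\<bar>" using K(2) j by simp
    moreover have "p \<in> G" using p differences_subset_G by blast
    ultimately show ?thesis using j by (simp add: internal_diff internal_ell S_coord)
  qed
  then have "\<forall>p\<in>differences \<Lambda>. \<forall>j<n. \<bar>\<sigma> p j\<bar> \<le> K * \<bar>C\<bar>" by blast
  then show ?thesis by (rule that)
qed

lemma internal_0: "j < n \<Longrightarrow> S (\<lambda>_. 0) j = 0"
  by (simp add: internal_def)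

lemma model_0: "model (\<lambda>_. 0) V = {g \<in> G. \<sigma> g \<in> V}"
proof -
  have "comb s b (\<lambda>_. 0) = 0" by (simp add: comb_def)
  moreover have "rn_add n (S (\<lambda>_. 0)) (\<sigma> g) = \<sigma> g" if "g \<in> G" for g
    using sigma_in_rn[OF that] by (intro rn_eqI[of _ n]) (auto simp: rn_add_def internal_0)
  ultimately show ?thesis unfolding model_def by auto
qed

section \<open>The graph of \<sigma> as a discrete cocompact subgroup\<close>

lemma countable_G: "countable G"
proof -
  have "G \<subseteq> (\<lambda>c. lin (\<lambda>i. real_of_int (c i))) ` Pi\<^sub>E {..<s} (\<lambda>_. UNIV)"
  proof
    fix g assume g: "g \<in> G"
    have "g = lin (\<lambda>i. real_of_int (restrict (Z_coord s b g) {..<s} i))"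
      using lin_coord[OF g] comb_cong[of s "coord g" "\<lambda>i. real_of_int (restrict (Z_coord s b g) {..<s} i)" b]
      by (simp add: coord_def)
    then show "g \<in> (\<lambda>c. lin (\<lambda>i. real_of_int (c i))) ` Pi\<^sub>E {..<s} (\<lambda>_. UNIV)"
      by (intro image_eqI[of _ _ "restrict (Z_coord s b g) {..<s}"]) auto
  qed
  moreover have "countable (Pi\<^sub>E {..<s} (\<lambda>_. UNIV :: int set))" by (intro countable_PiE) auto
  ultimately show ?thesis using countable_subset countable_image by meson
qed

text \<open>For a subgroup it suffices to isolate 0: a graph point near that of g differs from it by
  a lattice point that \<open>lattice_discrete\<close> forces to be 0.\<close>

lemma graph_discrete:
  "subtopology (prod_topology euclidean (rn_topology n)) (graph_on G \<sigma>) = discrete_topology (graph_on G \<sigma>)"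
  unfolding subtopology_eq_discrete_topology_eq
proof
  show "graph_on G \<sigma> \<subseteq> topspace (prod_topology euclidean (rn_topology n))"
    unfolding graph_on_def by (auto simp: topspace_rn_topology sigma_in_rn)
  show "graph_on G \<sigma> \<inter> prod_topology euclidean (rn_topology n) derived_set_of graph_on G \<sigma> = {}"
  proof (rule ccontr)
    assume "graph_on G \<sigma> \<inter> prod_topology euclidean (rn_topology n) derived_set_of graph_on G \<sigma> \<noteq> {}"
    then obtain g where g: "g \<in> G"
      and der: "(g, \<sigma> g) \<in> prod_topology euclidean (rn_topology n) derived_set_of graph_on G \<sigma>"
      unfolding graph_on_def by blast
    obtain \<delta> where \<delta>: "\<delta> > 0" "\<forall>g\<in>G. norm g < \<delta> \<longrightarrow> (\<forall>j<n. \<bar>\<sigma> g j\<bar> \<le> 1) \<longrightarrow> g = 0"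
      by (rule lattice_discrete)
    define V where "V = {y \<in> rn n. \<forall>j<n. \<bar>y j - \<sigma> g j\<bar> < 1}"
    have "openin (rn_topology n) V" unfolding V_def by (rule openin_rn_box)
    then have "openin (prod_topology euclidean (rn_topology n)) (ball g \<delta> \<times> V)"
      by (simp add: openin_prod_Times_iff)
    moreover have "(g, \<sigma> g) \<in> ball g \<delta> \<times> V" using \<delta>(1) sigma_in_rn[OF g] by (simp add: V_def)
    ultimately have "\<exists>p\<noteq>(g, \<sigma> g). p \<in> graph_on G \<sigma> \<and> p \<in> ball g \<delta> \<times> V"
      using conjunct2[OF der[unfolded in_derived_set_of], THEN spec, of "ball g \<delta> \<times> V"] by simp
    then obtain p where p: "p \<noteq> (g, \<sigma> g)" "p \<in> graph_on G \<sigma>" "p \<in> ball g \<delta> \<times> V"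
      by blast
    obtain h where h: "h \<in> G" "p = (h, \<sigma> h)" using p(2) unfolding graph_on_def by blast
    have "norm (h - g) < \<delta>" using p(3) h(2) by (simp add: dist_norm norm_minus_commute)
    moreover have "\<forall>j<n. \<bar>\<sigma> (h - g) j\<bar> \<le> 1"
      using p(3) h(2) sigma_diff[OF h(1) g] by (simp add: V_def less_eq_real_def)
    ultimately have "h - g = 0" using \<delta>(2) G_diff[OF h(1) g] by blast
    then show False using p(1) h(2) by simp
  qed
qed

lemma graph_coset_translate:
  assumes "h \<in> G"
  shows "graph_coset n G \<sigma> (x + h, rn_add n y (\<sigma> h)) = graph_coset n G \<sigma> (x, y)"
proof -
  have eq: "graph_coset n G \<sigma> (x, y) = (\<lambda>g. (x + g, rn_add n y (\<sigma> g))) ` G" for x y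
    unfolding graph_coset_def graph_on_def by force
  have 1: "(x + h + g, rn_add n (rn_add n y (\<sigma> h)) (\<sigma> g)) = (x + (h + g), rn_add n y (\<sigma> (h + g)))"
    if "g \<in> G" for g
    using sigma_add'[OF assms that] by (auto simp: rn_add_def add.assoc)
  show ?thesis
  proof
    show "graph_coset n G \<sigma> (x + h, rn_add n y (\<sigma> h)) \<subseteq> graph_coset n G \<sigma> (x, y)"
      unfolding eq using 1 G_add[OF assms] by force
    show "graph_coset n G \<sigma> (x, y) \<subseteq> graph_coset n G \<sigma> (x + h, rn_add n y (\<sigma> h))"
    proof
      fix p assume "p \<in> graph_coset n G \<sigma> (x, y)"
      then obtain g where g: "g \<in> G" "p = (x + g, rn_add n y (\<sigma> g))" unfolding eq by blast
      have "p = (x + h + (g - h), rn_add n (rn_add n y (\<sigma> h)) (\<sigma> (g - h)))"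
        using 1[OF G_diff[OF g(1) assms]] g(2) by simp
      then show "p \<in> graph_coset n G \<sigma> (x + h, rn_add n y (\<sigma> h))"
        unfolding eq using G_diff[OF g(1) assms] by blast
    qed
  qed
qed

text \<open>Rounding lattice coordinates down moves every point, modulo the graph, into the image of
  the unit cube under \<open>lin\<close> and \<open>S\<close>, which lies in the compact set
  \<open>?C\<close>.\<close>

lemma graph_cocompact:
  "compact_space (quotient_topology (prod_topology euclidean (rn_topology n)) (graph_coset n G \<sigma>))"
proof -
  let ?X = "prod_topology euclidean (rn_topology n) :: ('a \<times> (nat \<Rightarrow> real)) topology"
  obtain K1 where K1: "K1 > 0" "\<And>z \<epsilon>. (\<And>i. i < s \<Longrightarrow> \<bar>z i\<bar> \<le> \<epsilon>) \<Longrightarrow> 0 \<le> \<epsilon> \<Longrightarrow> norm (lin z) \<le> K1 * \<epsilon>"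
    by (rule comb_bounded) blast
  obtain K2 where K2: "K2 > 0" "\<forall>z \<epsilon>. (\<forall>i<s. \<bar>z i\<bar> \<le> \<epsilon>) \<longrightarrow> 0 \<le> \<epsilon> \<longrightarrow> (\<forall>j<n. \<bar>S z j\<bar> \<le> K2 * \<epsilon>)"
    by (rule S_bounded)
  let ?C = "cball (0::'a) K1 \<times> Pi\<^sub>E {..<n} (\<lambda>_. {-K2..K2})"
  have "compactin (rn_topology n) (Pi\<^sub>E {..<n} (\<lambda>_. {-K2..K2}))"
    unfolding rn_topology_def by (simp add: compactin_PiE)
  then have C: "compactin ?X ?C" by (simp add: compactin_Times)
  have "compactin (quotient_topology ?X (graph_coset n G \<sigma>)) (graph_coset n G \<sigma> ` ?C)"
    by (rule image_compactin[OF C quotient_imp_continuous_map[OF quotient_map_quotient_topology]])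
  moreover have "graph_coset n G \<sigma> ` ?C = topspace (quotient_topology ?X (graph_coset n G \<sigma>))"
    unfolding topspace_quotient_topology
  proof
    have "?C \<subseteq> topspace ?X" by (rule compactin_subset_topspace[OF C])
    then show "graph_coset n G \<sigma> ` ?C \<subseteq> graph_coset n G \<sigma> ` topspace ?X" by (rule image_mono)
    show "graph_coset n G \<sigma> ` topspace ?X \<subseteq> graph_coset n G \<sigma> ` ?C"
    proof
      fix q assume "q \<in> graph_coset n G \<sigma> ` topspace ?X"
      then obtain x y where xy: "q = graph_coset n G \<sigma> (x, y)" "y \<in> rn n"
        by (auto simp: topspace_rn_topology)
      \<comment> \<open>The point of \<open>\<real>\<^sup>s\<close> that \<open>lin\<close> and
        \<open>S\<close> send to (x, y).\<close>
      define z where "z i = \<l> x i + T y i" for i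
      have z: "lin z = x" "\<And>j. j < n \<Longrightarrow> S z j = y j"
        unfolding z_def[abs_def] by (simp_all add: comb_add internal_add internal_ell S_T)
      obtain h where h: "h \<in> G" "\<And>i. i < s \<Longrightarrow> coord h i = real_of_int \<lfloor>z i\<rfloor>"
        using Ints_coord[of "\<lambda>i. real_of_int \<lfloor>z i\<rfloor>"] by auto
      define z' where "z' i = z i - coord h i" for i
      have z': "\<bar>z' i\<bar> \<le> 1" if "i < s" for i
        unfolding z'_def h(2)[OF that] by linarith
      have "lin z' = x - h" unfolding z'_def[abs_def] comb_diff using z(1) h(1) by simp
      then have "x - h \<in> cball 0 K1" using K1(2)[of z' 1] z' by simp
      moreover have S': "S z' j = y j - \<sigma> h j" if "j < n" for j
        unfolding z'_def[abs_def] internal_diff[OF that] using z(2)[OF that] h(1) by (simp add: S_coord)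
      moreover have "\<bar>S z' j\<bar> \<le> K2" if "j < n" for j
        using K2(2)[rule_format, of z' 1 j] z' that by simp
      then have "S z' \<in> Pi\<^sub>E {..<n} (\<lambda>_. {-K2..K2})"
        by (auto simp: internal_def abs_le_iff minus_le_iff)
      moreover have "graph_coset n G \<sigma> (x - h, S z') = graph_coset n G \<sigma> (x, y)"
      proof -
        have "rn_add n (S z') (\<sigma> h) = y"
          using S' xy(2) by (intro rn_eqI[of _ n]) (auto simp: rn_add_def)
        then show ?thesis using graph_coset_translate[OF h(1), of "x - h" "S z'"] by simp
      qed
      ultimately show "q \<in> graph_coset n G \<sigma> ` ?C" unfolding xy(1) by (metis SigmaI image_eqI)
    qed
  qed
  ultimately show ?thesis by (simp add: compact_space_def)
qed

lemma euclidean_cps_if_dense: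
  assumes "n > 0" and dense: "\<And>y \<epsilon>. \<epsilon> > 0 \<Longrightarrow> \<exists>h\<in>G. \<forall>j<n. \<bar>\<sigma> h j - y j\<bar> < \<epsilon>"
  shows "euclidean_cps n G \<sigma>"
proof -
  have sub: "\<sigma> ` G \<subseteq> rn n" using sigma_in_rn by blast
  have "rn_topology n closure_of (\<sigma> ` G) = rn n"
    using dense by (auto simp: in_closure_of_rn[OF sub])
  then show ?thesis
    unfolding euclidean_cps_def
    using assms(1) countable_G G_diff sub sigma_add graph_discrete graph_cocompact by simp
qed

text \<open>Compare X with an element of phase \<open>T y\<close>: applying \<open>S\<close> to the
  relation of phases gives y = \<sigma> h + S \<delta>.\<close>

lemma dense_if_phase_surj:
  assumes X: "phase X (\<lambda>_. 0)" and surj: "\<And>c. \<exists>Y. phase Y c" and \<epsilon>: "\<epsilon> > 0"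
  shows "\<exists>h\<in>G. \<forall>j<n. \<bar>\<sigma> h j - y j\<bar> < \<epsilon>"
proof -
  obtain K where K: "K > 0" "\<forall>z \<epsilon>. (\<forall>i<s. \<bar>z i\<bar> \<le> \<epsilon>) \<longrightarrow> 0 \<le> \<epsilon> \<longrightarrow> (\<forall>j<n. \<bar>S z j\<bar> \<le> K * \<epsilon>)"
    by (rule S_bounded)
  obtain Y where Y: "phase Y (T y)" using surj by blast
  have "\<epsilon> / (2 * K) > 0" using \<epsilon> K(1) by simp
  then obtain u h and \<delta> :: "nat \<Rightarrow> real" where h: "h \<in> G" and \<delta>: "\<forall>i<s. \<bar>\<delta> i\<bar> < \<epsilon> / (2 * K)"
    and c: "\<forall>i<s. T y i = 0 - \<l> u i + coord h i + \<delta> i"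
    by (rule hull_approx[OF X Y])
  have "\<bar>\<sigma> h j - y j\<bar> < \<epsilon>" if "j < n" for j
  proof -
    have "\<bar>S \<delta> j\<bar> \<le> K * (\<epsilon> / (2 * K))"
      using K(2) \<delta> \<open>\<epsilon> / (2 * K) > 0\<close> that by (meson less_imp_le)
    moreover have "y j = \<sigma> h j + S \<delta> j"
      using approx_parts(2)[OF h c that] that by (simp add: S_T internal_0)
    ultimately show ?thesis using K(1) \<epsilon> by simp
  qed
  then show ?thesis using h by blast
qed

section \<open>The window as closure of the internal image of one element\<close>

context
  fixes X1 :: "'a set" and W :: "(nat \<Rightarrow> real) set"
  assumes X1: "phase X1 (\<lambda>_. 0)" "0 \<in> X1"
    and phase_surj: "\<And>c. \<exists>Y. phase Y c"
    and ex_regular: "\<exists>c. regular c"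
  defines "W \<equiv> rn_topology n closure_of (\<sigma> ` X1)"
begin

text \<open>Containing 0 is what makes the points of \<open>X1\<close> differences, hence elements
  of G, where \<sigma> is controlled.\<close>

lemma X1_differences: "X1 \<subseteq> differences \<Lambda>"
  using hull_set_differences[OF phase_in_hull[OF X1(1)] _ X1(2)] by fastforce

lemma X1_in_G: "X1 \<subseteq> G"
  using X1_differences differences_subset_G by blast

lemma sigma_X1: "\<sigma> ` X1 \<subseteq> rn n"
  using X1_in_G sigma_in_rn by blast

lemma W_iff: "w \<in> W \<longleftrightarrow> w \<in> rn n \<and> (\<forall>\<epsilon>>0. \<exists>t\<in>X1. \<forall>j<n. \<bar>\<sigma> t j - w j\<bar> < \<epsilon>)"
  unfolding W_def in_closure_of_rn[OF sigma_X1] by auto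

lemma closed_W: "closedin (rn_topology n) W"
  unfolding W_def by simp

lemma W_rn: "W \<subseteq> rn n"
  using W_iff by blast

lemma compact_W: "compactin (rn_topology n) W"
  unfolding compactin_rn_iff
proof
  obtain B where B: "\<forall>p\<in>differences \<Lambda>. \<forall>j<n. \<bar>\<sigma> p j\<bar> \<le> B" by (rule sigma_differences_bounded)
  have "\<bar>w j\<bar> \<le> B + 1" if w: "w \<in> W" and j: "j < n" for w j
  proof -
    obtain t where t: "t \<in> X1" "\<forall>j<n. \<bar>\<sigma> t j - w j\<bar> < 1" using w W_iff zero_less_one by blast
    have "\<bar>\<sigma> t j\<bar> \<le> B" using B t(1) X1_differences j by blast
    then show ?thesis using t(2)[rule_format, OF j] by linarith
  qed
  then show "\<exists>B. \<forall>w\<in>W. \<forall>i<n. \<bar>w i\<bar> \<le> B" by blast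
qed (rule closed_W)

lemma X1_subset_model: "X1 \<subseteq> model (\<lambda>_. 0) W"
proof -
  have "\<sigma> ` X1 \<subseteq> W" unfolding W_def using sigma_X1 by (simp add: closure_of_subset topspace_rn_topology)
  then show ?thesis unfolding model_0 using X1_in_G by blast
qed

text \<open>For t in \<open>X1\<close> the set \<open>shift t X1\<close> contains 0 and has phase
  \<open>T (\<sigma> t)\<close>; w is a limit of such \<sigma> t, and \<open>hull_limit\<close>
  preserves containing 0.\<close>

lemma ex_phase_window:
  assumes w: "w \<in> W"
  shows "\<exists>Y. phase Y (T w) \<and> 0 \<in> Y"
proof -
  have "\<forall>k. \<exists>t\<in>X1. \<forall>j<n. \<bar>\<sigma> t j - w j\<bar> < inverse (real (Suc k))"
    using w unfolding W_iff by simp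
  then obtain t where t: "\<And>k. t k \<in> X1" "\<And>k. \<forall>j<n. \<bar>\<sigma> (t k) j - w j\<bar> < inverse (real (Suc k))"
    by metis
  have "phase (shift (t k) X1) (T (\<sigma> (t k)))" for k
  proof (rule phase_cong[OF phase_add_coord[OF phase_shift[OF X1(1)]]])
    show "0 - \<l> (t k) i + coord (t k) i = T (\<sigma> (t k)) i" if "i < s" for i
      using coord_decomp[OF subsetD[OF X1_in_G t(1)] that, of k] by simp
  qed
  moreover have "(\<lambda>k. T (\<sigma> (t k)) i) \<longlonglongrightarrow> T w i" if "i < s" for i
  proof -
    have "(\<lambda>k. \<sigma> (t k) j) \<longlonglongrightarrow> w j" if "j < n" for j
      by (rule LIMSEQ_if_close) (rule t(2)[rule_format, OF that])
    then show ?thesis unfolding T_def by (intro tendsto_sum tendsto_mult tendsto_const) simp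
  qed
  moreover have "0 \<in> shift (t k) X1" for k using t(1) by (simp add: mem_shift)
  ultimately show ?thesis by (rule_tac hull_limit[of "\<lambda>k. shift (t k) X1" "\<lambda>k. T (\<sigma> (t k))" "T w"]) auto
qed

lemma phase_zero_in_window:
  assumes Y: "phase Y c" "0 \<in> Y"
  obtains g where "g \<in> G" "rn_add n (S c) (\<sigma> g) \<in> W" "lin c + g = 0"
proof -
  have "0 \<in> model c W" using phase_subset_model[OF compact_W X1(1) X1_subset_model Y(1)] Y(2) by blast
  then show ?thesis unfolding model_def using that by force
qed

text \<open>Suppose points \<open>y k\<close> outside W tend to w. Elements with phases
  \<open>T (y k)\<close> accumulate at an element of phase \<open>T w\<close>, which by uniqueness
  contains 0. So some of them has a point near 0; by discreteness it comes from the lattice point 0,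
  which says that its \<open>y k\<close> lies in W after all.\<close>

lemma regular_interior:
  assumes w: "w \<in> W" and reg: "regular (T w)"
  shows "w \<in> rn_topology n interior_of W"
proof (rule ccontr)
  assume "w \<notin> rn_topology n interior_of W"
  moreover have w': "w \<in> rn n" using w W_iff by blast
  ultimately have "\<forall>k. \<exists>y\<in>rn n - W. \<forall>j<n. \<bar>y j - w j\<bar> < inverse (real (Suc k))"
    by (simp add: rn_interior_iff)
  then obtain y where y: "\<And>k. y k \<in> rn n - W" "\<And>k. \<forall>j<n. \<bar>y k j - w j\<bar> < inverse (real (Suc k))"
    by metis
  have "\<forall>k. \<exists>Y. phase Y (T (y k))" using phase_surj by blast
  then obtain Y where Y: "\<And>k. phase (Y k) (T (y k))" by metis
  have lim: "(\<lambda>k. T (y k) i) \<longlonglongrightarrow> T w i" if "i < s" for i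
  proof -
    have "(\<lambda>k. y k j) \<longlonglongrightarrow> w j" if "j < n" for j
      by (rule LIMSEQ_if_close) (rule y(2)[rule_format, OF that])
    then show ?thesis unfolding T_def by (intro tendsto_sum tendsto_mult tendsto_const) simp
  qed
  obtain B where "\<forall>w\<in>W. \<forall>j<n. \<bar>w j\<bar> \<le> B" using compact_W[unfolded compactin_rn_iff] by blast
  note B = this[rule_format]
  \<comment> \<open>The bound for \<sigma> g, which is a point of W minus y, where y is within 1 of
    w in W.\<close>
  obtain \<delta> where \<delta>: "\<delta> > 0" "\<forall>g\<in>G. norm g < \<delta> \<longrightarrow> (\<forall>j<n. \<bar>\<sigma> g j\<bar> \<le> 2 * \<bar>B\<bar> + 1) \<longrightarrow> g = 0"
    by (rule lattice_discrete)
  obtain Z where Z: "phase Z (T w)" "0 \<in> Z" using ex_phase_window[OF w] by blast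
  obtain r and Z' :: "'a set" where Z': "strict_mono (r :: nat \<Rightarrow> nat)" "phase Z' (T w)"
    "\<forall>x\<in>Z'. \<forall>\<epsilon>>0. \<exists>K. \<forall>k\<ge>K. \<exists>x'\<in>Y (r k). dist x' x < \<epsilon>"
    by (rule hull_limit[of Y "\<lambda>k. T (y k)" "T w"]) (use Y lim in auto)
  have "0 \<in> Z'" using reg Z Z'(2) unfolding regular_def by blast
  then obtain k x' where x': "x' \<in> Y (r k)" "dist x' 0 < \<delta>" using Z'(3) \<delta>(1) by blast
  have "x' \<in> model (T (y (r k))) W"
    using phase_subset_model[OF compact_W X1(1) X1_subset_model Y] x'(1) by blast
  then obtain g where g: "x' = g" "g \<in> G" "rn_add n (S (T (y (r k)))) (\<sigma> g) \<in> W"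
    unfolding model_def by force
  have add: "rn_add n (S (T (y (r k)))) (\<sigma> g) j = y (r k) j + \<sigma> g j" if "j < n" for j
    using that by (simp add: rn_add_def S_T)
  have "\<forall>j<n. \<bar>\<sigma> g j\<bar> \<le> 2 * \<bar>B\<bar> + 1"
  proof (intro allI impI)
    fix j assume j: "j < n"
    have "inverse (real (Suc (r k))) \<le> 1" by (simp add: inverse_le_1_iff)
    then show "\<bar>\<sigma> g j\<bar> \<le> 2 * \<bar>B\<bar> + 1"
      using B[OF w j] B[OF g(3) j] add[OF j] y(2)[rule_format, OF j, of "r k"] by linarith
  qed
  moreover have "norm g < \<delta>" using x'(2) g(1) by simp
  ultimately have "g = 0" using \<delta>(2) g(2) by blast
  then have "rn_add n (S (T (y (r k)))) (\<sigma> g) = y (r k)"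
    using y(1)[of "r k"] add sigma_0 by (intro rn_eqI[of _ n]) auto
  then show False using g(3) y(1) by auto
qed

lemma frontier_not_regular:
  assumes "S c \<in> rn_topology n frontier_of W"
  shows "\<not> regular c"
proof
  assume "regular c"
  then have "regular (T (S c))" by (rule regular_T_S)
  moreover have "S c \<in> W" "S c \<notin> rn_topology n interior_of W"
    using assms closed_W unfolding frontier_of_def by (auto simp: closure_of_closedin)
  ultimately show False using regular_interior by blast
qed

text \<open>For x in the model set, \<open>shift x Y\<close> has phase \<open>T w\<close> with w in
  W. \<open>ex_phase_window\<close> supplies an element of that phase containing 0, and regularity
  identifies the two.\<close>

lemma regular_phase_model:
  assumes Y: "phase Y c" and reg: "regular c"
  shows "model c W \<subseteq> Y"
proof
  fix x assume "x \<in> model c W"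
  then obtain g where g: "x = lin c + g" "g \<in> G" "rn_add n (S c) (\<sigma> g) \<in> W"
    unfolding model_def by blast
  define w where "w = rn_add n (S c) (\<sigma> g)"
  define c' where "c' i = c i - \<l> x i + coord g i" for i
  have "lin c' = 0" unfolding c'_def[abs_def] using g by (simp add: comb_add comb_diff)
  moreover have "S c' = w"
    unfolding c'_def[abs_def] w_def using g(2)
    by (intro rn_eqI[of _ n]) (auto simp: rn_add_def internal_add internal_diff internal_ell S_coord)
  ultimately have c': "c' i = T w i" if "i < s" for i
    using decomp[OF that, of c'] ell_0[OF that] by simp
  have "phase (shift x Y) c'"
    unfolding c'_def[abs_def] by (rule phase_add_coord[OF phase_shift[OF Y]])
  then have Yw: "phase (shift x Y) (T w)" by (rule phase_cong) (rule c')
  have "regular c'"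
    by (rule regular_if_Ints[OF _ regular_shift[OF reg, of x]]) (simp add: c'_def)
  then have "regular (T w)" by (rule regular_if_Ints[rotated]) (simp add: c')
  moreover obtain Z where "phase Z (T w)" "0 \<in> Z" using ex_phase_window g(3) unfolding w_def by blast
  ultimately have "0 \<in> shift x Y" using Yw unfolding regular_def by blast
  then show "x \<in> Y" by (simp add: mem_shift)
qed

text \<open>\<open>X1\<close> itself may fail to be regular. The inclusion is read off for a regular
  element, where even all of W is covered, and is moved to \<open>X1\<close> thanks to openness of
  the interior.\<close>

lemma interior_model_subset: "model (\<lambda>_. 0) (rn_topology n interior_of W) \<subseteq> X1"
proof -
  obtain c where c: "regular c" using ex_regular by blast
  obtain Y where Y: "phase Y c" using phase_surj by blast
  have "model c (rn_topology n interior_of W) \<subseteq> Y"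
    using regular_phase_model[OF Y c] interior_of_subset[of "rn_topology n" W] unfolding model_def by blast
  then show ?thesis
    by (rule model_subset_phase[OF openin_interior_of Y _ X1(1)])
qed

text \<open>Take a translate of a regular element that agrees around 0 with the element Z of phase
  \<open>T w\<close>. It contains 0, so the internal part \<open>S c'\<close> of its phase lies in W
  once the lattice ambiguity g is excluded; regularity then places it in the interior.\<close>

lemma interior_dense:
  assumes w: "w \<in> W" and \<epsilon>: "\<epsilon> > 0"
  shows "\<exists>w'\<in>rn_topology n interior_of W. \<forall>j<n. \<bar>w' j - w j\<bar> < \<epsilon>"
proof -
  obtain K1 where K1: "K1 > 0" "\<And>z \<epsilon>. (\<And>i. i < s \<Longrightarrow> \<bar>z i\<bar> \<le> \<epsilon>) \<Longrightarrow> 0 \<le> \<epsilon> \<Longrightarrow> norm (lin z) \<le> K1 * \<epsilon>"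
    by (rule comb_bounded) blast
  obtain K2 where K2: "K2 > 0" "\<forall>z \<epsilon>. (\<forall>i<s. \<bar>z i\<bar> \<le> \<epsilon>) \<longrightarrow> 0 \<le> \<epsilon> \<longrightarrow> (\<forall>j<n. \<bar>S z j\<bar> \<le> K2 * \<epsilon>)"
    by (rule S_bounded)
  obtain B where "\<forall>w\<in>W. \<forall>j<n. \<bar>w j\<bar> \<le> B" using compact_W[unfolded compactin_rn_iff] by blast
  note B = this[rule_format]
  obtain \<eta> where \<eta>: "\<eta> > 0" "\<forall>g\<in>G. norm g < \<eta> \<longrightarrow> (\<forall>j<n. \<bar>\<sigma> g j\<bar> \<le> 2 * \<bar>B\<bar> + \<epsilon>) \<longrightarrow> g = 0"
    by (rule lattice_discrete)
  obtain Z where Z: "phase Z (T w)" "0 \<in> Z" using ex_phase_window[OF w] by blast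
  obtain c where c: "regular c" using ex_regular by blast
  obtain Y where Y: "phase Y c" using phase_surj by blast
  define e where "e = min (\<epsilon> / (2 * K2)) (\<eta> / (2 * K1))"
  have e: "e > 0" unfolding e_def using \<epsilon> \<eta>(1) K1(1) K2(1) by simp
  have "K2 * e \<le> K2 * (\<epsilon> / (2 * K2))"
    unfolding e_def by (rule mult_left_mono[OF min.cobounded1]) (use K2(1) in simp)
  moreover have "K1 * e \<le> K1 * (\<eta> / (2 * K1))"
    unfolding e_def by (rule mult_left_mono[OF min.cobounded2]) (use K1(1) in simp)
  ultimately have Ke: "K1 * e < \<eta>" "K2 * e < \<epsilon>"
    using K1(1) K2(1) \<epsilon> \<eta>(1) by simp_all
  obtain u h and \<delta> :: "nat \<Rightarrow> real" where h: "h \<in> G" and \<delta>: "\<forall>i<s. \<bar>\<delta> i\<bar> < e"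
    and agree: "Z \<inter> cball 0 1 = shift u Y \<inter> cball 0 1"
    and Tw: "\<forall>i<s. T w i = c i - \<l> u i + coord h i + \<delta> i"
    by (rule hull_approx[OF Y Z(1) e])
  define c' where "c' i = c i - \<l> u i + coord h i" for i
  have ph: "phase (shift u Y) c'"
    unfolding c'_def[abs_def] by (rule phase_add_coord[OF phase_shift[OF Y]])
  have "regular c'"
    by (rule regular_if_Ints[OF _ regular_shift[OF c, of u]]) (simp add: c'_def)
  have "0 \<in> Z \<inter> cball 0 1" using Z(2) by simp
  then have "0 \<in> shift u Y" unfolding agree by simp
  then obtain g where g: "g \<in> G" "rn_add n (S c') (\<sigma> g) \<in> W" "lin c' + g = 0"
    by (rule phase_zero_in_window[OF ph])
  have c'T: "c' i = T w i - \<delta> i" if "i < s" for i using Tw that by (simp add: c'_def)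
  have "lin c' = lin (\<lambda>i. T w i - \<delta> i)" by (rule comb_cong) (rule c'T)
  then have lin: "lin c' = - lin \<delta>" by (simp add: comb_diff)
  have "S c' = S (\<lambda>i. T w i - \<delta> i)" by (rule internal_cong) (rule c'T)
  then have Sc': "S c' j = w j - S \<delta> j" if "j < n" for j using that by (simp add: internal_diff S_T)
  have S\<delta>: "\<bar>S \<delta> j\<bar> < \<epsilon>" if "j < n" for j
  proof -
    have "\<bar>S \<delta> j\<bar> \<le> K2 * e" using K2(2) \<delta> e that by (meson less_imp_le)
    then show ?thesis using Ke(2) by simp
  qed
  \<comment> \<open>g equals \<open>lin \<delta>\<close> and is small, while \<sigma> g is bounded
    as a point of W minus w - S \<delta>; so discreteness applies.\<close>
  have "g = 0"
  proof -
    have "norm (lin \<delta>) \<le> K1 * e" using \<delta> e by (intro K1(2)) (auto intro: less_imp_le)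
    then have "norm g < \<eta>" using g(3) Ke(1) unfolding lin by simp
    moreover have "\<forall>j<n. \<bar>\<sigma> g j\<bar> \<le> 2 * \<bar>B\<bar> + \<epsilon>"
    proof (intro allI impI)
      fix j assume j: "j < n"
      have "rn_add n (S c') (\<sigma> g) j = w j - S \<delta> j + \<sigma> g j" using j by (simp add: rn_add_def Sc')
      then show "\<bar>\<sigma> g j\<bar> \<le> 2 * \<bar>B\<bar> + \<epsilon>" using B[OF g(2) j] B[OF w j] S\<delta>[OF j] by linarith
    qed
    ultimately show ?thesis using \<eta>(2) g(1) by blast
  qed
  have "rn_add n (S c') (\<sigma> g) = S c'"
    unfolding \<open>g = 0\<close> using sigma_0 by (intro rn_eqI[of _ n]) (auto simp: rn_add_def)
  then have "S c' \<in> W" using g(2) by simp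
  then have "S c' \<in> rn_topology n interior_of W"
    by (rule regular_interior) (rule regular_T_S[OF \<open>regular c'\<close>])
  moreover have "\<forall>j<n. \<bar>S c' j - w j\<bar> < \<epsilon>" using S\<delta> Sc' by simp
  ultimately show ?thesis by blast
qed

lemma window_W: "window n W"
  unfolding window_def
proof (intro conjI compact_W subset_antisym)
  have int: "rn_topology n interior_of W \<subseteq> rn n"
    using interior_of_subset[of "rn_topology n" W] W_rn by blast
  show "W \<subseteq> rn_topology n closure_of (rn_topology n interior_of W)"
    using interior_dense W_rn by (auto simp: in_closure_of_rn[OF int])
  show "rn_topology n closure_of (rn_topology n interior_of W) \<subseteq> W"
    by (rule closure_of_minimal[OF interior_of_subset closed_W])
qed

lemma model_set_bounds:
  "proj_set G \<sigma> (rn_topology n interior_of W) \<subseteq> X1" "X1 \<subseteq> proj_set G \<sigma> W"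
  using interior_model_subset X1_subset_model unfolding model_0 proj_set_def by auto

end

section \<open>Null sets of the torus and of internal space\<close>

lemma shift_window_iff_null:
  assumes F: "F \<in> sets (rn_lebesgue n)"
  shows "emeasure (rn_lebesgue s) {v \<in> rn s. S (\<lambda>i. z i - v i) \<in> F} = 0 \<longleftrightarrow> emeasure (rn_lebesgue n) F = 0"
    and "{v \<in> rn s. S (\<lambda>i. z i - v i) \<in> F} \<in> sets (rn_lebesgue s)"
proof -
  let ?H = "\<lambda>v. S (\<lambda>i. z i - v i)"
  have H: "?H \<in> rn_lebesgue s \<rightarrow>\<^sub>M rn_lebesgue n"
  proof (rule measurable_rn_lebesgueI)
    fix j assume j: "j < n"
    have "(\<lambda>v. \<Sum>i<s. (z i - v i) * \<sigma> (b i) j) \<in> borel_measurable (rn_lebesgue s)"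
      by (intro borel_measurable_sum borel_measurable_times borel_measurable_diff borel_measurable_const
          measurable_rn_component) simp_all
    then show "(\<lambda>v. ?H v j) \<in> borel_measurable (rn_lebesgue s)" using j by (simp add: internal_def)
  qed simp
  show "emeasure (rn_lebesgue s) {v \<in> rn s. ?H v \<in> F} = 0 \<longleftrightarrow> emeasure (rn_lebesgue n) F = 0"
  proof (rule null_rn_affine_vimage_iff[OF H _ F])
    fix y assume "y \<in> rn n"
    \<comment> \<open>The translation vector is T of -y: \<open>S\<close> inverts T, and the sign
      compensates that of v in \<open>?H\<close>.\<close>
    have "?H (rn_add s (T (\<lambda>j. - y j)) v) = rn_add n y (?H v)" for v
    proof (rule rn_eqI)
      fix j assume j: "j < n"
      have "?H (rn_add s (T (\<lambda>j. - y j)) v) = S (\<lambda>i. (z i - v i) - T (\<lambda>j. - y j) i)"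
        by (rule internal_cong) (simp add: rn_add_def)
      then show "?H (rn_add s (T (\<lambda>j. - y j)) v) j = rn_add n y (?H v) j"
        using j internal_diff[OF j, of s b \<sigma> "\<lambda>i. z i - v i" "T (\<lambda>j. - y j)"] by (simp add: S_T rn_add_def)
    qed simp_all
    then show "\<exists>u. \<forall>v\<in>rn s. ?H (rn_add s u v) = rn_add n y (?H v)" by blast
  qed
  show "{v \<in> rn s. ?H v \<in> F} \<in> sets (rn_lebesgue s)"
    using measurable_sets[OF H F] by (simp add: vimage_def Int_def space_rn_lebesgue conj_commute)
qed

text \<open>Every v with S (z0 - v) in F has its class in N, so the preimage of F is null; the
  comparison of null sets brings this back to F.\<close>

lemma null_if_not_regular:
  assumes N: "N \<in> null_sets (torus_haar s)" "\<And>c. \<not> regular c \<Longrightarrow> torus_class s (\<lambda>i. z0 i - c i) \<in> N"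
    and F: "F \<in> sets (rn_lebesgue n)" "\<And>c. S c \<in> F \<Longrightarrow> \<not> regular c"
  shows "F \<in> null_sets (rn_lebesgue n)"
proof -
  let ?P = "{v \<in> rn s. torus_class s v \<in> N}"
  have Ns: "N \<in> sets (torus_borel s)" using N(1) by auto
  have "emeasure (rn_lebesgue s) ?P = 0"
    using N(1) torus_haar_null_iff[OF Ns] by auto
  moreover have "?P \<in> sets (rn_lebesgue s)"
    using measurable_sets[OF measurable_torus_class Ns]
    by (simp add: vimage_def Int_def space_rn_lebesgue conj_commute)
  moreover have "{v \<in> rn s. S (\<lambda>i. z0 i - v i) \<in> F} \<subseteq> ?P"
  proof
    fix v assume v: "v \<in> {v \<in> rn s. S (\<lambda>i. z0 i - v i) \<in> F}"
    then have "torus_class s (\<lambda>i. z0 i - (z0 i - v i)) \<in> N" using F(2) N(2) by blast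
    then show "v \<in> ?P" using v by simp
  qed
  ultimately have "emeasure (rn_lebesgue s) {v \<in> rn s. S (\<lambda>i. z0 i - v i) \<in> F} = 0"
    by (metis (no_types, lifting) emeasure_mono le_zero_eq)
  then show ?thesis using shift_window_iff_null(1)[OF F(1), of z0] F(1) by auto
qed

text \<open>The preimage of F need not be periodic, hence need not come from the torus. The union P
  over its integer translates does, and it stays null because there are countably many.\<close>

lemma torus_null_if_null:
  assumes F: "F \<in> null_sets (rn_lebesgue n)"
  obtains N where "N \<in> null_sets (torus_haar s)" "\<forall>c. S c \<in> F \<longrightarrow> torus_class s (\<lambda>i. z0 i - c i) \<in> N"
proof -
  define Z where "Z = Pi\<^sub>E {..<s} (\<lambda>_. \<int> :: real set)"
  have "countable Z" unfolding Z_def Ints_def by (intro countable_PiE) auto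
  have Fs: "F \<in> sets (rn_lebesgue n)" "emeasure (rn_lebesgue n) F = 0" using F by auto
  define P where "P = (\<Union>m\<in>Z. {v \<in> rn s. S (\<lambda>i. (z0 i - m i) - v i) \<in> F})"
  have "{v \<in> rn s. S (\<lambda>i. (z0 i - m i) - v i) \<in> F} \<in> null_sets (rn_lebesgue s)" for m
    using shift_window_iff_null[OF Fs(1), of "\<lambda>i. z0 i - m i"] Fs(2) by auto
  then have P: "P \<in> null_sets (rn_lebesgue s)"
    unfolding P_def using \<open>countable Z\<close> by (intro null_sets_UN') auto
  have P_iff: "v \<in> P \<longleftrightarrow> (\<exists>m. (\<forall>i<s. m i \<in> \<int>) \<and> S (\<lambda>i. z0 i - m i - v i) \<in> F)" if "v \<in> rn s" for v
  proof
    assume "\<exists>m. (\<forall>i<s. m i \<in> \<int>) \<and> S (\<lambda>i. z0 i - m i - v i) \<in> F"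
    then obtain m where m: "\<forall>i<s. m i \<in> \<int>" "S (\<lambda>i. z0 i - m i - v i) \<in> F" by blast
    have "S (\<lambda>i. z0 i - restrict m {..<s} i - v i) = S (\<lambda>i. z0 i - m i - v i)"
      by (rule internal_cong) simp
    then show "v \<in> P" unfolding P_def using m that
      by (intro UN_I[of "restrict m {..<s}"]) (auto simp: Z_def)
  next
    assume "v \<in> P"
    then obtain m where "m \<in> Z" "S (\<lambda>i. z0 i - m i - v i) \<in> F" unfolding P_def by blast
    then show "\<exists>m. (\<forall>i<s. m i \<in> \<int>) \<and> S (\<lambda>i. z0 i - m i - v i) \<in> F"
      unfolding Z_def by (intro exI[of _ m]) auto
  qed
  \<comment> \<open>P is invariant under integer shifts, so it may be tested on the representative
    in the unit cube.\<close>
  have inv: "(\<lambda>i\<in>{..<s}. frac (v i)) \<in> P \<longleftrightarrow> (\<exists>m. (\<forall>i<s. m i \<in> \<int>) \<and> S (\<lambda>i. z0 i - m i - v i) \<in> F)" for v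
  proof -
    have e: "S (\<lambda>i. z0 i - m i - (\<lambda>i\<in>{..<s}. frac (v i)) i) = S (\<lambda>i. z0 i - (m i - real_of_int \<lfloor>v i\<rfloor>) - v i)" for m
      by (rule internal_cong) (simp add: frac_def)
    have e': "S (\<lambda>i. z0 i - (m i + real_of_int \<lfloor>v i\<rfloor>) - (\<lambda>i\<in>{..<s}. frac (v i)) i) = S (\<lambda>i. z0 i - m i - v i)" for m
      by (rule internal_cong) (simp add: frac_def)
    show ?thesis unfolding P_iff[OF rn_restrict]
    proof
      assume "\<exists>m. (\<forall>i<s. m i \<in> \<int>) \<and> S (\<lambda>i. z0 i - m i - (\<lambda>i\<in>{..<s}. frac (v i)) i) \<in> F"
      then obtain m where "\<forall>i<s. m i \<in> \<int>" "S (\<lambda>i. z0 i - (m i - real_of_int \<lfloor>v i\<rfloor>) - v i) \<in> F"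
        unfolding e by blast
      then show "\<exists>m. (\<forall>i<s. m i \<in> \<int>) \<and> S (\<lambda>i. z0 i - m i - v i) \<in> F"
        by (intro exI[of _ "\<lambda>i. m i - real_of_int \<lfloor>v i\<rfloor>"]) simp
    next
      assume "\<exists>m. (\<forall>i<s. m i \<in> \<int>) \<and> S (\<lambda>i. z0 i - m i - v i) \<in> F"
      then obtain m where "\<forall>i<s. m i \<in> \<int>" "S (\<lambda>i. z0 i - m i - v i) \<in> F" by blast
      then show "\<exists>m. (\<forall>i<s. m i \<in> \<int>) \<and> S (\<lambda>i. z0 i - m i - (\<lambda>i\<in>{..<s}. frac (v i)) i) \<in> F"
        by (intro exI[of _ "\<lambda>i. m i + real_of_int \<lfloor>v i\<rfloor>"] conjI allI impI) (simp, simp only: e')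
    qed
  qed
  define N where "N = torus_rep s -` P \<inter> space (torus_borel s)"
  have Ns: "N \<in> sets (torus_borel s)"
    unfolding N_def using P by (intro measurable_sets[OF measurable_torus_rep]) auto
  have N_iff: "torus_class s v \<in> N \<longleftrightarrow> (\<exists>m. (\<forall>i<s. m i \<in> \<int>) \<and> S (\<lambda>i. z0 i - m i - v i) \<in> F)" for v
    unfolding N_def by (simp add: torus_rep_torus_class topspace_torus inv)
  have "{v \<in> rn s. torus_class s v \<in> N} = {v \<in> rn s. v \<in> P}"
    by (rule Collect_cong) (use N_iff P_iff in blast)
  also have "\<dots> = P" unfolding P_def by blast
  finally have "emeasure (torus_haar s) N = 0" using P torus_haar_null_iff[OF Ns] by auto
  then have "N \<in> null_sets (torus_haar s)" using Ns by auto
  moreover have "torus_class s (\<lambda>i. z0 i - c i) \<in> N" if "S c \<in> F" for c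
    unfolding N_iff using that by (intro exI[of _ "\<lambda>_. 0"]) simp
  ultimately show ?thesis using that by blast
qed

end

section \<open>Existence of cut and project data\<close>

lemma internal_sum:
  assumes "j < n"
  shows "internal s n b \<sigma> (\<lambda>i. \<Sum>k<m. y k * \<tau> k i) j = (\<Sum>k<m. y k * internal s n b \<sigma> (\<tau> k) j)"
proof -
  have "(\<Sum>i<s. (\<Sum>k<m. y k * \<tau> k i) * \<sigma> (b i) j) = (\<Sum>i<s. \<Sum>k<m. y k * \<tau> k i * \<sigma> (b i) j)"
    by (simp add: sum_distrib_right)
  also have "\<dots> = (\<Sum>k<m. \<Sum>i<s. y k * \<tau> k i * \<sigma> (b i) j)" by (rule sum.swap)
  finally show ?thesis using assms by (simp add: internal_def sum_distrib_left mult.assoc)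
qed

lemma comb_sum: "comb s b (\<lambda>i. \<Sum>k<m. y k * \<tau> k i) = (\<Sum>k<m. y k *\<^sub>R comb s b (\<tau> k))"
proof -
  have "comb s b (\<lambda>i. \<Sum>k<m. y k * \<tau> k i) = (\<Sum>i<s. \<Sum>k<m. (y k * \<tau> k i) *\<^sub>R b i)"
    by (simp add: comb_def scaleR_sum_left)
  also have "\<dots> = (\<Sum>k<m. \<Sum>i<s. (y k * \<tau> k i) *\<^sub>R b i)" by (rule sum.swap)
  finally show ?thesis by (simp add: comb_def scaleR_sum_right)
qed

text \<open>Any basis of \<open>\<real>\<^sup>d\<close> among the \<open>b i\<close> makes the remaining coordinates a coordinate system on
  the kernel of \<open>lin\<close>, which serves as internal space.\<close>

lemma (in address_system) ex_cut_project:
  assumes "DIM('a) < s"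
  obtains n \<sigma> \<tau> where "n > 0" "cut_project \<Lambda> s b \<l> \<pi> n \<sigma> \<tau>"
proof -
  obtain B where B: "B \<subseteq> b ` {..<s}" "independent B" "b ` {..<s} \<subseteq> span B"
    using maximal_independent_subset by blast
  obtain J where J: "J \<subseteq> {..<s}" "inj_on b J" "B = b ` J"
    using B(1) unfolding subset_image_inj by blast
  have "finite J" using J(1) finite_subset by blast
  have span_B: "span B = UNIV"
    using span_Z_basis B(3) by (metis span_mono span_span top.extremum_uniqueI)
  have "card J = DIM('a)"
    using card_image[OF J(2)] J(3) dim_eq_card_independent[OF B(2)] by (metis dim_span dim_UNIV span_B)
  define I where "I = {..<s} - J"
  define n where "n = card I"
  have "finite I" unfolding I_def by simp
  have "n > 0"
    using \<open>card J = DIM('a)\<close> assms J(1) \<open>finite J\<close> unfolding n_def I_def by (simp add: card_Diff_subset)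
  obtain e where e: "bij_betw e {0..<n} I" using ex_bij_betw_nat_finite[OF \<open>finite I\<close>] unfolding n_def by blast
  have eI: "e j \<in> I" if "j < n" for j using bij_betwE[OF e] that by simp
  have es: "e j < s" "e j \<notin> J" if "j < n" for j using eI[OF that] unfolding I_def by auto
  have e_inj: "e j = e k \<longleftrightarrow> j = k" if "j < n" "k < n" for j k
    using bij_betw_imp_inj_on[OF e] that by (simp add: inj_on_eq_iff)
  \<comment> \<open>\<open>coord g - \<l> g\<close> lies in the kernel of \<open>lin\<close>; its
    coordinates outside J are kept.\<close>
  define \<sigma> where "\<sigma> g = (\<lambda>j\<in>{..<n}. coord g (e j) - \<l> g (e j))" for g
  \<comment> \<open>The unit vector at \<open>e j\<close>, corrected on J by the expansion of
    \<open>b (e j)\<close> in the basis B, so that \<open>lin\<close> kills it.\<close>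
  define \<tau> where "\<tau> j i = (if i = e j then 1 else if i \<in> J then - representation B (b (e j)) (b i) else 0)" for j i
  have S: "internal s n b \<sigma> z j = z (e j) - \<l> (lin z) (e j)" if j: "j < n" for z j
  proof -
    have "(\<Sum>i<s. z i * coord (b i) (e j)) = (\<Sum>i<s. if e j = i then z i else 0)"
      using coord_basis es(1)[OF j] by (intro sum.cong) auto
    also have "\<dots> = z (e j)" using es(1)[OF j] by (simp add: sum.delta)
    finally have 1: "(\<Sum>i<s. z i * coord (b i) (e j)) = z (e j)" .
    have "\<l> (lin z) (e j) = (\<Sum>i<s. z i * \<l> (b i) (e j))"
      unfolding comb_def
      by (simp add: linear_sum[OF linear_address[OF es(1)[OF j]]] linear_scale[OF linear_address[OF es(1)[OF j]]])
    then show ?thesis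
      using j 1 by (simp add: internal_def \<sigma>_def right_diff_distrib sum_subtractf)
  qed
  have lin_T: "lin (\<lambda>i. \<Sum>j<n. y j * \<tau> j i) = 0" for y
  proof -
    have "lin (\<tau> j) = 0" if j: "j < n" for j
    proof -
      have "lin (\<tau> j) = (\<Sum>i\<in>insert (e j) J. \<tau> j i *\<^sub>R b i)"
        unfolding comb_def using J(1) es(1)[OF j] by (intro sum.mono_neutral_right) (auto simp: \<tau>_def)
      also have "\<dots> = b (e j) + (\<Sum>i\<in>J. \<tau> j i *\<^sub>R b i)"
        using es(2)[OF j] \<open>finite J\<close> by (simp add: \<tau>_def)
      also have "(\<Sum>i\<in>J. \<tau> j i *\<^sub>R b i) = (\<Sum>i\<in>J. - (representation B (b (e j)) (b i) *\<^sub>R b i))"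
        using es(2)[OF j] by (intro sum.cong) (auto simp: \<tau>_def)
      also have "\<dots> = - (\<Sum>w\<in>B. representation B (b (e j)) w *\<^sub>R w)"
        unfolding J(3) by (simp add: sum_negf sum.reindex[OF J(2)])
      also have "(\<Sum>w\<in>B. representation B (b (e j)) w *\<^sub>R w) = b (e j)"
        using \<open>finite J\<close> span_B J(3) by (intro sum_representation_eq[OF B(2)]) auto
      finally show ?thesis by simp
    qed
    then show ?thesis unfolding comb_sum by simp
  qed
  have T_e: "(\<Sum>j<n. y j * \<tau> j (e k)) = y k" if k: "k < n" for y k
  proof -
    have "(\<Sum>j<n. y j * \<tau> j (e k)) = (\<Sum>j<n. if k = j then y j else 0)"
      using es(2)[OF k] e_inj k by (intro sum.cong) (auto simp: \<tau>_def)
    then show ?thesis using k by (simp add: sum.delta)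
  qed
  have "cut_project \<Lambda> s b \<l> \<pi> n \<sigma> \<tau>"
  proof (unfold_locales)
    show "\<sigma> g \<in> rn n" if "g \<in> G" for g unfolding \<sigma>_def by simp
    show "\<sigma> (g + h) = rn_add n (\<sigma> g) (\<sigma> h)" if "g \<in> G" "h \<in> G" for g h
      unfolding \<sigma>_def rn_add_def using es(1) that by (intro restrict_ext) (simp add: coord_add ell_add)
    show "internal s n b \<sigma> (\<l> x) j = 0" if "j < n" for x j using S[OF that] by simp
    show "internal s n b \<sigma> (\<lambda>i. \<Sum>j<n. y j * \<tau> j i) j = y j" if "j < n" for j y
      using S[OF that, of "\<lambda>i. \<Sum>j<n. y j * \<tau> j i"] lin_T T_e[OF that] ell_0[OF es(1)[OF that]] by simp
    show "lin (\<lambda>i. \<Sum>j<n. y j * \<tau> j i) = 0" for y by (rule lin_T)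
    show "z i = \<l> (lin z) i + (\<Sum>j<n. internal s n b \<sigma> z j * \<tau> j i)" if i: "i < s" for z i
    proof -
      \<comment> \<open>The defect lies in the kernel of \<open>lin\<close> and vanishes outside J;
        independence of B makes it vanish on J as well.\<close>
      define k where "k i = z i - \<l> (lin z) i - (\<Sum>j<n. internal s n b \<sigma> z j * \<tau> j i)" for i
      have ke: "k (e j) = 0" if "j < n" for j
        unfolding k_def using T_e[OF that] S[OF that] by simp
      have kI: "k i = 0" if "i \<in> I" for i
      proof -
        obtain j where "j < n" "i = e j" using e \<open>i \<in> I\<close> unfolding bij_betw_def by auto
        then show ?thesis using ke by simp
      qed
      have "lin k = lin (\<lambda>i. (z i - \<l> (lin z) i) - (\<Sum>j<n. internal s n b \<sigma> z j * \<tau> j i))"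
        unfolding k_def by simp
      also have "\<dots> = 0" by (simp only: comb_diff lin_T lin_ell) simp
      finally have "lin k = 0" .
      moreover have "lin k = (\<Sum>i\<in>J. k i *\<^sub>R b i)"
        unfolding comb_def using J(1) kI by (intro sum.mono_neutral_right) (auto simp: I_def)
      moreover have "(\<Sum>i\<in>J. k i *\<^sub>R b i) = (\<Sum>w\<in>B. k (the_inv_into J b w) *\<^sub>R w)"
        unfolding J(3) by (simp add: sum.reindex[OF J(2)] the_inv_into_f_f[OF J(2)])
      ultimately have "(\<Sum>w\<in>B. k (the_inv_into J b w) *\<^sub>R w) = 0" by simp
      then have "k (the_inv_into J b w) = 0" if "w \<in> B" for w
        using independentD[OF B(2) _ subset_refl _ that, of "\<lambda>w. k (the_inv_into J b w)"] \<open>finite J\<close> J(3) by simp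
      then have "k i = 0" if "i \<in> J" for i
        using that J(3) the_inv_into_f_f[OF J(2) that] by force
      then have "k i = 0" using kI i unfolding I_def by blast
      then show ?thesis unfolding k_def by simp
    qed
  qed
  with \<open>n > 0\<close> show ?thesis using that by blast
qed

text \<open>What a Euclidean scheme provides once its group is identified as G: discreteness and
  cocompactness of the graph in terms of norms, and boundedness of \<sigma> on differences. The
  section \<tau> is still to be found.\<close>

locale lattice_data = address_system +
  fixes n :: nat and \<sigma> :: "'a \<Rightarrow> nat \<Rightarrow> real"
  assumes sigma_in_rn: "g \<in> G \<Longrightarrow> \<sigma> g \<in> rn n"
    and sigma_add: "g \<in> G \<Longrightarrow> h \<in> G \<Longrightarrow> \<sigma> (g + h) = rn_add n (\<sigma> g) (\<sigma> h)"
    and finite_bounded: "finite {g \<in> G. norm g \<le> B \<and> (\<forall>j<n. \<bar>\<sigma> g j\<bar> \<le> B)}"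
    and cocompact: "\<exists>B. \<forall>x y. \<exists>g\<in>G. norm (x - g) \<le> B \<and> (\<forall>j<n. \<bar>y j - \<sigma> g j\<bar> \<le> B)"
    and sigma_bounded: "\<exists>B. \<forall>p\<in>differences \<Lambda>. \<forall>j<n. \<bar>\<sigma> p j\<bar> \<le> B"
begin

abbreviation S :: "(nat \<Rightarrow> real) \<Rightarrow> (nat \<Rightarrow> real)" where "S \<equiv> internal s n b \<sigma>"

lemma S_coord: "g \<in> G \<Longrightarrow> S (coord g) = \<sigma> g"
  by (rule internal_coord) (auto intro: sigma_in_rn sigma_add)

lemma S_bounded:
  obtains K where "K > 0" "\<forall>z \<epsilon>. (\<forall>i<s. \<bar>z i\<bar> \<le> \<epsilon>) \<longrightarrow> 0 \<le> \<epsilon> \<longrightarrow> (\<forall>j<n. \<bar>S z j\<bar> \<le> K * \<epsilon>)"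
  by (rule matrix_bounded[where s=s and n=n and A="\<lambda>i j. \<sigma> (b i) j"]) (simp add: internal_def)

text \<open>Injectivity of (\<open>lin\<close>, \<open>S\<close>) with a bound on the inverse.
  Rounding z down to a lattice point h changes both images by a bounded amount, so h ranges over a
  finite set when they are at most 1; homogeneity gives every \<rho>.\<close>

lemma lattice_coercive:
  obtains D where "D > 0"
    "\<forall>z \<rho>. norm (lin z) \<le> \<rho> \<longrightarrow> (\<forall>j<n. \<bar>S z j\<bar> \<le> \<rho>) \<longrightarrow> \<rho> > 0 \<longrightarrow> (\<forall>i<s. \<bar>z i\<bar> \<le> D * \<rho>)"
proof -
  obtain K1 where K1: "K1 > 0" "\<And>z \<epsilon>. (\<And>i. i < s \<Longrightarrow> \<bar>z i\<bar> \<le> \<epsilon>) \<Longrightarrow> 0 \<le> \<epsilon> \<Longrightarrow> norm (lin z) \<le> K1 * \<epsilon>"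
    by (rule comb_bounded) blast
  obtain K2 where K2: "K2 > 0" "\<forall>z \<epsilon>. (\<forall>i<s. \<bar>z i\<bar> \<le> \<epsilon>) \<longrightarrow> 0 \<le> \<epsilon> \<longrightarrow> (\<forall>j<n. \<bar>S z j\<bar> \<le> K2 * \<epsilon>)"
    by (rule S_bounded)
  \<comment> \<open>At most 1 for z, plus K1 or K2 for the rounding error r.\<close>
  define B where "B = 1 + K1 + K2"
  define F where "F = {g \<in> G. norm g \<le> B \<and> (\<forall>j<n. \<bar>\<sigma> g j\<bar> \<le> B)}"
  have "finite F" unfolding F_def by (rule finite_bounded)
  define M where "M = (\<Sum>g\<in>F. \<Sum>i<s. \<bar>coord g i\<bar>)"
  have M: "\<bar>coord g i\<bar> \<le> M" if "g \<in> F" "i < s" for g i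
  proof -
    have "\<bar>coord g i\<bar> \<le> (\<Sum>i<s. \<bar>coord g i\<bar>)" using that(2) by (intro member_le_sum) auto
    also have "\<dots> \<le> M" unfolding M_def using that(1) \<open>finite F\<close>
      by (intro member_le_sum) (auto intro: sum_nonneg)
    finally show ?thesis .
  qed
  have "M \<ge> 0" unfolding M_def by (intro sum_nonneg) auto
  have unit: "\<bar>z i\<bar> \<le> M + 1" if z: "norm (lin z) \<le> 1" "\<forall>j<n. \<bar>S z j\<bar> \<le> 1" and i: "i < s" for z i
  proof -
    obtain h where h: "h \<in> G" "\<And>i. i < s \<Longrightarrow> coord h i = real_of_int \<lfloor>z i\<rfloor>"
      using Ints_coord[of "\<lambda>i. real_of_int \<lfloor>z i\<rfloor>"] by auto
    define r where "r i = z i - coord h i" for i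
    have r: "\<bar>r i\<bar> \<le> 1" if "i < s" for i unfolding r_def h(2)[OF that] by linarith
    have "lin r = lin z - h" unfolding r_def comb_diff using h(1) by simp
    moreover have "norm (lin r) \<le> K1" using K1(2)[of r 1] r by simp
    ultimately have "norm h \<le> 1 + K1"
      using norm_triangle_ineq4[of "lin z" "lin r"] z(1) by simp
    moreover have "\<bar>\<sigma> h j\<bar> \<le> 1 + K2" if j: "j < n" for j
    proof -
      have "S r j = S z j - \<sigma> h j" unfolding r_def internal_diff[OF j] using h(1) by (simp add: S_coord)
      moreover have "\<bar>S r j\<bar> \<le> K2" using K2(2)[rule_format, of r 1 j] r j by simp
      moreover have "\<bar>S z j\<bar> \<le> 1" using z(2) j by blast
      ultimately show ?thesis by linarith
    qed
    moreover have "1 + K1 \<le> B" "1 + K2 \<le> B" unfolding B_def using K1(1) K2(1) by auto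
    ultimately have "h \<in> F" unfolding F_def using h(1) by force
    then show ?thesis using M[OF _ i] r[OF i] unfolding r_def by fastforce
  qed
  have "\<bar>z i\<bar> \<le> (M + 1) * \<rho>" if z: "norm (lin z) \<le> \<rho>" "\<forall>j<n. \<bar>S z j\<bar> \<le> \<rho>" "\<rho> > 0" "i < s" for z \<rho> i
  proof -
    have "norm (lin (\<lambda>i. inverse \<rho> * z i)) \<le> 1"
      unfolding comb_scale using z(1,3) by (simp add: field_simps)
    moreover have "\<forall>j<n. \<bar>S (\<lambda>i. inverse \<rho> * z i) j\<bar> \<le> 1"
    proof (intro allI impI)
      fix j assume j: "j < n"
      have "\<bar>inverse \<rho> * S z j\<bar> \<le> 1" using z(2,3) j by (simp add: abs_mult field_simps)
      then show "\<bar>S (\<lambda>i. inverse \<rho> * z i) j\<bar> \<le> 1" unfolding internal_scale[OF j] .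
    qed
    ultimately have "\<bar>inverse \<rho> * z i\<bar> \<le> M + 1" using unit z(4) by blast
    then show ?thesis using z(3) by (simp add: abs_mult field_simps)
  qed
  then have "\<forall>z \<rho>. norm (lin z) \<le> \<rho> \<longrightarrow> (\<forall>j<n. \<bar>S z j\<bar> \<le> \<rho>) \<longrightarrow> \<rho> > 0 \<longrightarrow> (\<forall>i<s. \<bar>z i\<bar> \<le> (M + 1) * \<rho>)"
    by blast
  moreover have "M + 1 > 0" using \<open>M \<ge> 0\<close> by simp
  ultimately show ?thesis using that by blast
qed

lemma lattice_kernel:
  assumes "lin z = 0" "\<And>j. j < n \<Longrightarrow> S z j = 0" "i < s"
  shows "z i = 0"
proof -
  obtain D where D: "D > 0"
    "\<forall>z \<rho>. norm (lin z) \<le> \<rho> \<longrightarrow> (\<forall>j<n. \<bar>S z j\<bar> \<le> \<rho>) \<longrightarrow> \<rho> > 0 \<longrightarrow> (\<forall>i<s. \<bar>z i\<bar> \<le> D * \<rho>)"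
    by (rule lattice_coercive)
  have "\<bar>z i\<bar> \<le> 0 + e" if "e > 0" for e
  proof -
    have "norm (lin z) \<le> e / D" "\<forall>j<n. \<bar>S z j\<bar> \<le> e / D" "e / D > 0" using assms(1,2) that D(1) by auto
    then have "\<bar>z i\<bar> \<le> D * (e / D)" using D(2) assms(3) by blast
    then show ?thesis using D(1) by simp
  qed
  then have "\<bar>z i\<bar> \<le> 0" by (rule field_le_epsilon)
  then show ?thesis by simp
qed

text \<open>Cocompactness puts lattice points at bounded distance from the multiples of (x, y).
  Dividing by the factor makes the error tend to 0, coercivity bounds the quotients, and a limit
  point z solves the equations.\<close>

lemma lattice_span:
  "\<exists>z. lin z = x \<and> (\<forall>j<n. S z j = y j)"
proof -
  obtain D where D: "D > 0"
    "\<forall>z \<rho>. norm (lin z) \<le> \<rho> \<longrightarrow> (\<forall>j<n. \<bar>S z j\<bar> \<le> \<rho>) \<longrightarrow> \<rho> > 0 \<longrightarrow> (\<forall>i<s. \<bar>z i\<bar> \<le> D * \<rho>)"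
    by (rule lattice_coercive)
  obtain B where B: "\<forall>x y. \<exists>g\<in>G. norm (x - g) \<le> B \<and> (\<forall>j<n. \<bar>y j - \<sigma> g j\<bar> \<le> B)"
    using cocompact by blast
  have "\<exists>g. \<forall>k. g k \<in> G \<and> norm (real (Suc k) *\<^sub>R x - g k) \<le> B \<and>
      (\<forall>j<n. \<bar>real (Suc k) * y j - \<sigma> (g k) j\<bar> \<le> B)"
  proof (rule choice, rule allI)
    fix k
    show "\<exists>g. g \<in> G \<and> norm (real (Suc k) *\<^sub>R x - g) \<le> B \<and> (\<forall>j<n. \<bar>real (Suc k) * y j - \<sigma> g j\<bar> \<le> B)"
      using B[THEN spec, THEN spec, of "real (Suc k) *\<^sub>R x" "\<lambda>j. real (Suc k) * y j"] by blast
  qed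
  then obtain g where g: "\<And>k. g k \<in> G" "\<And>k. norm (real (Suc k) *\<^sub>R x - g k) \<le> B"
    "\<And>k j. j < n \<Longrightarrow> \<bar>real (Suc k) * y j - \<sigma> (g k) j\<bar> \<le> B" by blast
  have "B \<ge> 0" using g(2)[of 0] norm_ge_zero order_trans by blast
  define w where "w k i = inverse (real (Suc k)) * coord (g k) i" for k i
  have lw: "norm (x - lin (w k)) \<le> B * inverse (real (Suc k))" for k
  proof -
    have "x - lin (w k) = inverse (real (Suc k)) *\<^sub>R (real (Suc k) *\<^sub>R x - g k)"
      unfolding w_def[abs_def] comb_scale using g(1) by (simp add: scaleR_diff_right del: of_nat_Suc)
    then have "norm (x - lin (w k)) = inverse (real (Suc k)) * norm (real (Suc k) *\<^sub>R x - g k)"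
      by (simp only: norm_scaleR abs_inverse abs_of_nat)
    moreover have "inverse (real (Suc k)) * norm (real (Suc k) *\<^sub>R x - g k) \<le> inverse (real (Suc k)) * B"
      by (rule mult_left_mono[OF g(2)]) (rule inverse_nonnegative_iff_nonnegative[THEN iffD2], rule of_nat_0_le_iff)
    ultimately show ?thesis by (simp only: mult.commute)
  qed
  have Sw: "\<bar>y j - S (w k) j\<bar> \<le> B * inverse (real (Suc k))" if j: "j < n" for k j
  proof -
    have "y j - S (w k) j = inverse (real (Suc k)) * (real (Suc k) * y j - \<sigma> (g k) j)"
      unfolding w_def[abs_def] internal_scale[OF j] using g(1) by (simp add: right_diff_distrib S_coord del: of_nat_Suc)
    then have "\<bar>y j - S (w k) j\<bar> = inverse (real (Suc k)) * \<bar>real (Suc k) * y j - \<sigma> (g k) j\<bar>"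
      by (simp only: abs_mult abs_inverse abs_of_nat)
    moreover have "inverse (real (Suc k)) * \<bar>real (Suc k) * y j - \<sigma> (g k) j\<bar> \<le> inverse (real (Suc k)) * B"
      by (rule mult_left_mono[OF g(3)[OF j]]) (rule inverse_nonnegative_iff_nonnegative[THEN iffD2], rule of_nat_0_le_iff)
    ultimately show ?thesis by (simp only: mult.commute)
  qed
  define \<rho> where "\<rho> = 1 + norm x + (\<Sum>j<n. \<bar>y j\<bar>) + B"
  have y0: "0 \<le> (\<Sum>j<n. \<bar>y j\<bar>)" by (intro sum_nonneg) auto
  have "\<rho> > 0" unfolding \<rho>_def using y0 \<open>B \<ge> 0\<close> norm_ge_zero[of x] by linarith
  have wb: "\<bar>w k i\<bar> \<le> D * \<rho>" if i: "i < s" for k i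
  proof -
    have "inverse (real (Suc k)) \<le> 1" by (simp add: inverse_le_1_iff)
    from mult_left_mono[OF this \<open>B \<ge> 0\<close>] have Bk: "B * inverse (real (Suc k)) \<le> B" by simp
    have "norm (lin (w k)) \<le> norm x + norm (x - lin (w k))"
      using norm_triangle_ineq4[of x "x - lin (w k)"] by simp
    then have "norm (lin (w k)) \<le> \<rho>"
      using lw[of k] Bk y0 unfolding \<rho>_def by linarith
    moreover have "\<bar>S (w k) j\<bar> \<le> \<rho>" if j: "j < n" for j
    proof -
      have "\<bar>y j\<bar> \<le> (\<Sum>j<n. \<bar>y j\<bar>)" using j by (intro member_le_sum) auto
      then show ?thesis using Sw[OF j, of k] Bk norm_ge_zero[of x] unfolding \<rho>_def by linarith
    qed
    ultimately show ?thesis using D(2) \<open>\<rho> > 0\<close> i by blast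
  qed
  have "\<exists>r l. strict_mono (r :: nat \<Rightarrow> nat) \<and> (\<forall>i<s. (\<lambda>k. w (r k) i) \<longlonglongrightarrow> l i)"
    by (rule rn_bounded_convergent_subsequence) (rule wb)
  then obtain r z where r: "strict_mono (r :: nat \<Rightarrow> nat)" and z: "\<forall>i<s. (\<lambda>k. w (r k) i) \<longlonglongrightarrow> z i" by blast
  have inv0: "(\<lambda>k. B * inverse (real (Suc (r k)))) \<longlonglongrightarrow> 0"
    using LIMSEQ_subseq_LIMSEQ[OF tendsto_mult_right_zero[OF LIMSEQ_inverse_real_of_nat, of B] r] by (simp add: o_def)
  have "(\<lambda>k. lin (w (r k))) \<longlonglongrightarrow> lin z"
    unfolding comb_def using z by (intro tendsto_sum tendsto_scaleR tendsto_const) simp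
  moreover have "(\<lambda>k. lin (w (r k))) \<longlonglongrightarrow> x"
  proof -
    have "(\<lambda>k. lin (w (r k)) - x) \<longlonglongrightarrow> 0"
      by (rule Lim_null_comparison[OF _ inv0]) (use lw in \<open>simp add: norm_minus_commute del: of_nat_Suc\<close>)
    then show ?thesis by (simp add: LIM_zero_iff)
  qed
  ultimately have "lin z = x" by (rule LIMSEQ_unique)
  moreover have "S z j = y j" if j: "j < n" for j
  proof -
    have "(\<lambda>k. S (w (r k)) j) \<longlonglongrightarrow> S z j"
      unfolding internal_def using z j by (simp, intro tendsto_sum tendsto_mult tendsto_const) simp
    moreover have "(\<lambda>k. S (w (r k)) j) \<longlonglongrightarrow> y j"
    proof -
      have "(\<lambda>k. S (w (r k)) j - y j) \<longlonglongrightarrow> 0"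
        by (rule Lim_null_comparison[OF _ inv0]) (use Sw[OF j] in \<open>simp add: abs_minus_commute del: of_nat_Suc\<close>)
      then show ?thesis by (simp add: LIM_zero_iff)
    qed
    ultimately show ?thesis by (rule LIMSEQ_unique)
  qed
  ultimately show ?thesis by blast
qed

lemma internal_ell_0:
  assumes j: "j < n" shows "S (\<l> x) j = 0"
proof -
  have "linear (\<lambda>x. S (\<l> x) j)"
  proof (rule linearI)
    fix x y and r :: real
    have "S (\<l> (x + y)) = S (\<lambda>i. \<l> x i + \<l> y i)" by (intro internal_cong) (simp add: ell_add)
    then show "S (\<l> (x + y)) j = S (\<l> x) j + S (\<l> y) j" using internal_add[OF j] by simp
    have "S (\<l> (r *\<^sub>R x)) = S (\<lambda>i. r * \<l> x i)"
      by (intro internal_cong) (simp add: linear_scale[OF linear_address])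
    then show "S (\<l> (r *\<^sub>R x)) j = r *\<^sub>R S (\<l> x) j" using internal_scale[OF j] by simp
  qed
  moreover have "relatively_dense (differences \<Lambda>)"
    using delone_differences unfolding delone_def by blast
  moreover obtain C where C: "\<And>p i. p \<in> differences \<Lambda> \<Longrightarrow> i < s \<Longrightarrow> \<bar>coord p i - \<l> p i\<bar> \<le> C"
    by (rule coord_ell_bounded) blast
  obtain B where B: "\<forall>p\<in>differences \<Lambda>. \<forall>j<n. \<bar>\<sigma> p j\<bar> \<le> B" using sigma_bounded by blast
  obtain K where K: "K > 0" "\<forall>z \<epsilon>. (\<forall>i<s. \<bar>z i\<bar> \<le> \<epsilon>) \<longrightarrow> 0 \<le> \<epsilon> \<longrightarrow> (\<forall>j<n. \<bar>S z j\<bar> \<le> K * \<epsilon>)"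
    by (rule S_bounded)
  have "norm (S (\<l> p) j) \<le> B + K * \<bar>C\<bar>" if p: "p \<in> differences \<Lambda>" for p
  proof -
    have "\<forall>i<s. \<bar>coord p i - \<l> p i\<bar> \<le> \<bar>C\<bar>" using C[OF p] by fastforce
    then have "\<bar>S (\<lambda>i. coord p i - \<l> p i) j\<bar> \<le> K * \<bar>C\<bar>" using K(2) j by simp
    moreover have "p \<in> G" using p differences_subset_G by blast
    then have "S (\<lambda>i. coord p i - \<l> p i) j = \<sigma> p j - S (\<l> p) j"
      using internal_diff[OF j, of s b \<sigma> "coord p" "\<l> p"] by (simp add: S_coord)
    moreover have "\<bar>\<sigma> p j\<bar> \<le> B" using B p j by blast
    ultimately show ?thesis by simp
  qed
  ultimately show ?thesis by (rule linear_eq_0_if_bounded_on_relatively_dense)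
qed

text \<open>\<tau> k is a preimage of 0 and the k-th unit vector. The defect of the decomposition is
  killed by \<open>lin\<close> and by \<open>S\<close>, hence vanishes by
  \<open>lattice_kernel\<close>.\<close>

lemma ex_section: obtains \<tau> where "cut_project \<Lambda> s b \<l> \<pi> n \<sigma> \<tau>"
proof -
  have "\<exists>\<tau>. \<forall>k. lin (\<tau> k) = 0 \<and> (\<forall>j<n. S (\<tau> k) j = (if j = k then 1 else 0))"
    by (rule choice, rule allI) (rule lattice_span)
  then obtain \<tau> where \<tau>: "\<And>k. lin (\<tau> k) = 0" "\<And>k j. j < n \<Longrightarrow> S (\<tau> k) j = (if j = k then 1 else 0)"
    by blast
  have lin_T: "lin (\<lambda>i. \<Sum>j<n. y j * \<tau> j i) = 0" for y
    unfolding comb_sum by (simp add: \<tau>(1))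
  have S_T: "S (\<lambda>i. \<Sum>j<n. y j * \<tau> j i) j = y j" if "j < n" for j y
  proof -
    have "(\<Sum>k<n. y k * S (\<tau> k) j) = (\<Sum>k<n. if j = k then y k else 0)"
      by (intro sum.cong refl) (simp only: \<tau>(2)[OF that], simp)
    then show ?thesis unfolding internal_sum[OF that] using that by (simp add: sum.delta)
  qed
  have "cut_project \<Lambda> s b \<l> \<pi> n \<sigma> \<tau>"
  proof (unfold_locales)
    show "\<sigma> g \<in> rn n" if "g \<in> G" for g using that by (rule sigma_in_rn)
    show "\<sigma> (g + h) = rn_add n (\<sigma> g) (\<sigma> h)" if "g \<in> G" "h \<in> G" for g h using that by (rule sigma_add)
    show "S (\<l> x) j = 0" if "j < n" for x j using that by (rule internal_ell_0)
    show "S (\<lambda>i. \<Sum>j<n. y j * \<tau> j i) j = y j" if "j < n" for j y using that by (rule S_T)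
    show "lin (\<lambda>i. \<Sum>j<n. y j * \<tau> j i) = 0" for y by (rule lin_T)
    show "z i = \<l> (lin z) i + (\<Sum>j<n. S z j * \<tau> j i)" if i: "i < s" for z i
    proof -
      define k where "k = (\<lambda>i. (z i - \<l> (lin z) i) - (\<Sum>j<n. S z j * \<tau> j i))"
      have "lin k = 0" unfolding k_def comb_diff lin_T lin_ell by simp
      moreover have "S k j = 0" if "j < n" for j
        unfolding k_def internal_diff[OF that] S_T[OF that] internal_ell_0[OF that] by simp
      ultimately have "k i = 0" using i by (rule lattice_kernel)
      then show ?thesis unfolding k_def by simp
    qed
  qed
  then show ?thesis by (rule that)
qed

text \<open>If s were at most the dimension, the spanning vectors \<open>b i\<close> would be a
  basis and \<open>lin\<close> injective. But \<open>lattice_span\<close> provides z in its kernel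
  for which all coordinates of \<open>S z\<close> are 1.\<close>

lemma rank_gt_dim:
  assumes "n > 0" shows "DIM('a) < s"
proof (rule ccontr)
  assume "\<not> DIM('a) < s"
  then have le: "card (b ` {..<s}) \<le> DIM('a)" "s \<le> DIM('a)" using card_image_le[of "{..<s}" b] by auto
  have ind: "independent (b ` {..<s})"
    by (rule card_le_dim_spanning[of _ UNIV]) (use span_Z_basis le(1) in simp_all)
  have "dim (b ` {..<s}) = DIM('a)" by (metis dim_span dim_UNIV span_Z_basis)
  then have "card (b ` {..<s}) = DIM('a)" using dim_eq_card_independent[OF ind] by linarith
  then have inj: "inj_on b {..<s}"
    using le(2) card_image_le[of "{..<s}" b] by (intro eq_card_imp_inj_on) simp_all
  obtain z where z: "lin z = 0" "\<forall>j<n. S z j = 1" using lattice_span[of 0 "\<lambda>_. 1"] by blast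
  have "(\<Sum>w\<in>b ` {..<s}. z (the_inv_into {..<s} b w) *\<^sub>R w) = 0"
    using z(1) unfolding comb_def by (simp add: sum.reindex[OF inj] the_inv_into_f_f[OF inj])
  then have "z (the_inv_into {..<s} b w) = 0" if "w \<in> b ` {..<s}" for w
    using independentD[OF ind _ subset_refl _ that, of "\<lambda>w. z (the_inv_into {..<s} b w)"]
    by simp
  then have "z i = 0" if "i < s" for i
    using the_inv_into_f_f[OF inj, of i] that by force
  then have "S z 0 = 0" using assms by (simp add: internal_def)
  then show False using z(2) assms by simp
qed

end

section \<open>Euclidean cut and project schemes\<close>

lemma rn_translate_iff:
  assumes "V \<subseteq> rn n"
  shows "x \<in> rn_translate n w V \<longleftrightarrow> x \<in> rn n \<and> (\<lambda>i\<in>{..<n}. x i - w i) \<in> V"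
proof
  assume "x \<in> rn_translate n w V"
  then obtain v where v: "v \<in> V" "x = rn_add n w v" unfolding rn_translate_def by blast
  have "(\<lambda>i\<in>{..<n}. x i - w i) = v"
    using v assms by (intro rn_eqI[of _ n]) (auto simp: rn_add_def)
  then show "x \<in> rn n \<and> (\<lambda>i\<in>{..<n}. x i - w i) \<in> V" using v by simp
next
  assume x: "x \<in> rn n \<and> (\<lambda>i\<in>{..<n}. x i - w i) \<in> V"
  then have "x = rn_add n w (\<lambda>i\<in>{..<n}. x i - w i)"
    by (intro rn_eqI[of _ n]) (auto simp: rn_add_def)
  then show "x \<in> rn_translate n w V" unfolding rn_translate_def using x by blast
qed

lemma rn_translate_subset: "rn_translate n w V \<subseteq> rn n"
  unfolding rn_translate_def by auto

lemma openin_rn_translate: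
  assumes "openin (rn_topology n) V" shows "openin (rn_topology n) (rn_translate n w V)"
proof -
  have V: "V \<subseteq> rn n" using openin_subset[OF assms] by (simp add: topspace_rn_topology)
  show ?thesis
    unfolding openin_rn
  proof (intro conjI ballI rn_translate_subset)
    fix x assume x: "x \<in> rn_translate n w V"
    then have "(\<lambda>i\<in>{..<n}. x i - w i) \<in> V" using rn_translate_iff[OF V] by blast
    then obtain \<epsilon> where \<epsilon>: "\<epsilon> > 0"
      "\<forall>y\<in>rn n. (\<forall>i<n. \<bar>y i - (\<lambda>i\<in>{..<n}. x i - w i) i\<bar> < \<epsilon>) \<longrightarrow> y \<in> V"
      using assms unfolding openin_rn by blast
    have "y \<in> rn_translate n w V" if y: "y \<in> rn n" "\<forall>i<n. \<bar>y i - x i\<bar> < \<epsilon>" for y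
    proof -
      have "(\<lambda>i\<in>{..<n}. y i - w i) \<in> V"
        using \<epsilon>(2)[THEN bspec, THEN mp, of "\<lambda>i\<in>{..<n}. y i - w i"] y(2) by simp
      then show ?thesis using rn_translate_iff[OF V] y(1) by blast
    qed
    then show "\<exists>\<epsilon>>0. \<forall>y\<in>rn n. (\<forall>i<n. \<bar>y i - x i\<bar> < \<epsilon>) \<longrightarrow> y \<in> rn_translate n w V"
      using \<epsilon>(1) by blast
  qed
qed

lemma compactin_rn_translate:
  assumes "compactin (rn_topology n) W" shows "compactin (rn_topology n) (rn_translate n w W)"
proof -
  have W: "closedin (rn_topology n) W" using assms[unfolded compactin_rn_iff] by blast
  obtain B where B: "\<forall>v\<in>W. \<forall>i<n. \<bar>v i\<bar> \<le> B" using assms[unfolded compactin_rn_iff] by blast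
  have sub: "W \<subseteq> rn n" using closedin_subset[OF W] by (simp add: topspace_rn_topology)
  have "openin (rn_topology n) (rn n - W)" using W by (simp add: closedin_def topspace_rn_topology)
  from openin_rn_translate[OF this, of w]
  have "openin (rn_topology n) (rn n - rn_translate n w W)"
  proof (rule back_subst[of "openin (rn_topology n)"])
    show "rn_translate n w (rn n - W) = rn n - rn_translate n w W"
      using rn_translate_iff[OF sub, of _ w] rn_translate_iff[of "rn n - W" n _ w] by auto
  qed
  then have "closedin (rn_topology n) (rn_translate n w W)"
    by (simp add: closedin_def topspace_rn_topology rn_translate_subset)
  moreover have "\<forall>v\<in>rn_translate n w W. \<forall>i<n. \<bar>v i\<bar> \<le> (\<Sum>i<n. \<bar>w i\<bar>) + B"
  proof (intro ballI allI impI)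
    fix v i assume v: "v \<in> rn_translate n w W" and i: "i < n"
    then obtain v' where v': "v' \<in> W" "v = rn_add n w v'" unfolding rn_translate_def by blast
    have "\<bar>w i\<bar> \<le> (\<Sum>i<n. \<bar>w i\<bar>)" using i by (intro member_le_sum) auto
    moreover have "\<bar>v' i\<bar> \<le> B" using B v'(1) i by blast
    ultimately show "\<bar>v i\<bar> \<le> (\<Sum>i<n. \<bar>w i\<bar>) + B" using i unfolding v'(2) rn_add_def by simp
  qed
  ultimately show ?thesis unfolding compactin_rn_iff by blast
qed

text \<open>Moving the interior of the translated window back gives an open subset of W, so
  translation does not enlarge the interior.\<close>

lemma rn_translate_diff_frontier:
  assumes "compactin (rn_topology n) W"
  shows "rn_translate n w W - rn_translate n w (rn_topology n interior_of W)
    \<subseteq> rn_topology n frontier_of (rn_translate n w W)"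
proof
  let ?V = "rn_topology n interior_of (rn_translate n w W)"
  fix x assume x: "x \<in> rn_translate n w W - rn_translate n w (rn_topology n interior_of W)"
  have "W \<subseteq> rn n" using compactin_subset_topspace[OF assms] by (simp add: topspace_rn_topology)
  have int: "rn_topology n interior_of W \<subseteq> rn n"
    using interior_of_subset_topspace[of "rn_topology n" W] by (simp add: topspace_rn_topology)
  have V: "?V \<subseteq> rn n" using interior_of_subset_topspace[of "rn_topology n"] by (simp add: topspace_rn_topology)
  have "closedin (rn_topology n) (rn_translate n w W)"
    using compactin_rn_translate[OF assms, of w, unfolded compactin_rn_iff] by blast
  then have "x \<in> rn_topology n closure_of (rn_translate n w W)" using x by (simp add: closure_of_closedin)
  moreover have "x \<notin> ?V"
  proof
    assume xV: "x \<in> ?V"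
    have "openin (rn_topology n) (rn_translate n (\<lambda>i. - w i) ?V)"
      by (rule openin_rn_translate[OF openin_interior_of])
    moreover have "rn_translate n (\<lambda>i. - w i) ?V \<subseteq> W"
    proof
      fix y assume "y \<in> rn_translate n (\<lambda>i. - w i) ?V"
      then have yV: "y \<in> rn n \<and> (\<lambda>i\<in>{..<n}. y i - - w i) \<in> ?V" by (rule iffD1[OF rn_translate_iff[OF V]])
      note y = conjunct1[OF yV] conjunct2[OF yV]
      have "(\<lambda>i\<in>{..<n}. y i - - w i) \<in> rn_translate n w W"
        by (rule subsetD[OF interior_of_subset y(2)])
      then have "(\<lambda>i\<in>{..<n}. (\<lambda>i\<in>{..<n}. y i - - w i) i - w i) \<in> W"
        by (rule iffD1[OF rn_translate_iff[OF \<open>W \<subseteq> rn n\<close>], THEN conjunct2])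
      moreover have "(\<lambda>i\<in>{..<n}. (\<lambda>i\<in>{..<n}. y i - - w i) i - w i) = y"
        using y(1) by (intro rn_eqI[of _ n]) auto
      ultimately show "y \<in> W" by simp
    qed
    ultimately have "rn_translate n (\<lambda>i. - w i) ?V \<subseteq> rn_topology n interior_of W"
      by (intro interior_of_maximal)
    moreover have "(\<lambda>i\<in>{..<n}. x i - w i) \<in> rn_translate n (\<lambda>i. - w i) ?V"
    proof -
      have "(\<lambda>i\<in>{..<n}. (\<lambda>i\<in>{..<n}. x i - w i) i - - w i) = x"
        using xV V by (intro rn_eqI[of _ n]) auto
      then show ?thesis using rn_translate_iff[OF V] xV by simp
    qed
    ultimately have "x \<in> rn_translate n w (rn_topology n interior_of W)"
      using rn_translate_iff[OF int] xV V by blast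
    then show False using x by blast
  qed
  ultimately show "x \<in> rn_topology n frontier_of (rn_translate n w W)"
    unfolding frontier_of_def by blast
qed

section \<open>Discreteness, cocompactness and generators of a given scheme\<close>

locale euclidean_cps_data =
  fixes n :: nat and \<Gamma> :: "'a::euclidean_space set" and \<sigma> :: "'a \<Rightarrow> nat \<Rightarrow> real"
  assumes cps: "euclidean_cps n \<Gamma> \<sigma>"
begin

lemma Gamma_0: "0 \<in> \<Gamma>" and Gamma_diff: "x \<in> \<Gamma> \<Longrightarrow> y \<in> \<Gamma> \<Longrightarrow> x - y \<in> \<Gamma>"
  and sigma_in_rn: "x \<in> \<Gamma> \<Longrightarrow> \<sigma> x \<in> rn n"
  and sigma_add: "x \<in> \<Gamma> \<Longrightarrow> y \<in> \<Gamma> \<Longrightarrow> \<sigma> (x + y) = rn_add n (\<sigma> x) (\<sigma> y)"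
  and sigma_closure: "rn_topology n closure_of (\<sigma> ` \<Gamma>) = rn n"
  using cps unfolding euclidean_cps_def by blast+

lemma Gamma_add: "x \<in> \<Gamma> \<Longrightarrow> y \<in> \<Gamma> \<Longrightarrow> x + y \<in> \<Gamma>"
  using Gamma_diff[of x "0 - y"] Gamma_diff[OF Gamma_0, of y] by simp

lemma sigma_diff: "x \<in> \<Gamma> \<Longrightarrow> y \<in> \<Gamma> \<Longrightarrow> j < n \<Longrightarrow> \<sigma> (x - y) j = \<sigma> x j - \<sigma> y j"
  using sigma_add[of "x - y" y] Gamma_diff[of x y] by (simp add: rn_add_def)

lemma sigma_0: "j < n \<Longrightarrow> \<sigma> 0 j = 0"
  using sigma_diff[OF Gamma_0 Gamma_0, of j] by simp

lemma sigma_dense: assumes "\<epsilon> > 0" shows "\<exists>h\<in>\<Gamma>. \<forall>j<n. \<bar>\<sigma> h j - y j\<bar> < \<epsilon>"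
proof -
  have "\<sigma> ` \<Gamma> \<subseteq> rn n" using sigma_in_rn by blast
  moreover have "(\<lambda>j\<in>{..<n}. y j) \<in> rn_topology n closure_of (\<sigma> ` \<Gamma>)" unfolding sigma_closure by simp
  ultimately have "(\<lambda>j\<in>{..<n}. y j) \<in> rn n \<and> (\<forall>\<epsilon>>0. \<exists>v\<in>\<sigma> ` \<Gamma>. \<forall>j<n. \<bar>v j - (\<lambda>j\<in>{..<n}. y j) j\<bar> < \<epsilon>)"
    by (rule iffD1[OF in_closure_of_rn])
  then show ?thesis using assms by fastforce
qed

text \<open>Only the graph point over 0 is isolated explicitly; the graph being a subgroup, this
  separates all its points.\<close>

lemma graph_separated:
  obtains \<delta> where "\<delta> > 0" "\<forall>g\<in>\<Gamma>. norm g < \<delta> \<longrightarrow> (\<forall>j<n. \<bar>\<sigma> g j\<bar> < \<delta>) \<longrightarrow> g = 0"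
proof -
  let ?X = "prod_topology euclidean (rn_topology n) :: ('a \<times> (nat \<Rightarrow> real)) topology"
  have p: "(0, \<sigma> 0) \<in> graph_on \<Gamma> \<sigma>" unfolding graph_on_def using Gamma_0 by blast
  have "subtopology ?X (graph_on \<Gamma> \<sigma>) = discrete_topology (graph_on \<Gamma> \<sigma>)"
    using cps unfolding euclidean_cps_def by blast
  then have nd: "(0, \<sigma> 0) \<notin> ?X derived_set_of (graph_on \<Gamma> \<sigma>)"
    unfolding subtopology_eq_discrete_topology_eq using p by blast
  have top: "(0, \<sigma> 0) \<in> topspace ?X" using sigma_in_rn[OF Gamma_0] by (simp add: topspace_rn_topology)
  have "\<not> (\<forall>T. (0, \<sigma> 0) \<in> T \<and> openin ?X T \<longrightarrow> (\<exists>y\<noteq>(0, \<sigma> 0). y \<in> graph_on \<Gamma> \<sigma> \<and> y \<in> T))"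
    using nd unfolding in_derived_set_of by (rule contrapos_nn) (rule conjI[OF top])
  then obtain T where T: "(0, \<sigma> 0) \<in> T" "openin ?X T"
    "\<not> (\<exists>y\<noteq>(0, \<sigma> 0). y \<in> graph_on \<Gamma> \<sigma> \<and> y \<in> T)"
    unfolding not_all not_imp by (elim exE conjE)
  from T(2)[unfolded openin_prod_topology_alt, THEN spec, THEN spec, THEN mp, OF T(1)]
  obtain U V where UV: "openin euclidean U" "openin (rn_topology n) V" "0 \<in> U" "\<sigma> 0 \<in> V" "U \<times> V \<subseteq> T"
    by (elim exE conjE)
  then have "open U" by (simp only: open_openin)
  then obtain d1 where d1: "d1 > 0" "ball 0 d1 \<subseteq> U" using UV(3) open_contains_ball by blast
  obtain d2 where d2: "d2 > 0" "\<forall>y\<in>rn n. (\<forall>j<n. \<bar>y j - \<sigma> 0 j\<bar> < d2) \<longrightarrow> y \<in> V"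
    using conjunct2[OF UV(2)[unfolded openin_rn], THEN bspec, OF UV(4)] by blast
  have "g = 0" if g: "g \<in> \<Gamma>" "norm g < min d1 d2" "\<forall>j<n. \<bar>\<sigma> g j\<bar> < min d1 d2" for g
  proof -
    have "g \<in> U" using g(2) d1(2) by auto
    moreover have "\<sigma> g \<in> V" using d2(2) sigma_in_rn[OF g(1)] g(3) sigma_0 by simp
    ultimately have "(g, \<sigma> g) \<in> T" using UV(5) by blast
    moreover have "(g, \<sigma> g) \<in> graph_on \<Gamma> \<sigma>" unfolding graph_on_def using g(1) by blast
    ultimately show ?thesis using T(3) by blast
  qed
  moreover have "min d1 d2 > 0" using d1(1) d2(1) by simp
  ultimately show ?thesis using that by blast
qed

text \<open>An infinite bounded set of graph points would contain a convergent sequence of distinct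
  ones, and differences of late successive terms would be nonzero graph points too close to
  0.\<close>

lemma finite_bounded: "finite {g \<in> \<Gamma>. norm g \<le> B \<and> (\<forall>j<n. \<bar>\<sigma> g j\<bar> \<le> B)}" (is "finite ?F")
proof (rule ccontr)
  assume "infinite ?F"
  then obtain f :: "nat \<Rightarrow> 'a" where f: "inj f" "range f \<subseteq> ?F" using infinite_countable_subset by blast
  have fF: "f k \<in> \<Gamma>" "f k \<in> cball 0 B" "\<And>j. j < n \<Longrightarrow> \<bar>\<sigma> (f k) j\<bar> \<le> B" for k using f(2) by auto
  obtain x r1 where r1: "strict_mono (r1 :: nat \<Rightarrow> nat)" "(f \<circ> r1) \<longlonglongrightarrow> x"
    using compact_cball[of "0::'a" B] fF(2) unfolding compact_def by meson
  have "\<exists>r l. strict_mono (r :: nat \<Rightarrow> nat) \<and> (\<forall>j<n. (\<lambda>k. \<sigma> (f (r1 (r k))) j) \<longlonglongrightarrow> l j)"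
    by (rule rn_bounded_convergent_subsequence[of n "\<lambda>k. \<sigma> (f (r1 k))" B]) (rule fF(3))
  then obtain r2 y where r2: "strict_mono (r2 :: nat \<Rightarrow> nat)"
    and y: "\<forall>j<n. (\<lambda>k. \<sigma> (f (r1 (r2 k))) j) \<longlonglongrightarrow> y j" by blast
  obtain \<delta> where \<delta>: "\<delta> > 0" "\<forall>g\<in>\<Gamma>. norm g < \<delta> \<longrightarrow> (\<forall>j<n. \<bar>\<sigma> g j\<bar> < \<delta>) \<longrightarrow> g = 0"
    by (rule graph_separated)
  define a where "a k = f (r1 (r2 k))" for k
  have "a \<longlonglongrightarrow> x" using LIMSEQ_subseq_LIMSEQ[OF r1(2) r2] by (simp add: a_def[abs_def] o_def)
  then have "\<forall>\<^sub>F k in sequentially. dist (a k) x < \<delta> / 2" using \<delta>(1) by (intro tendstoD) simp_all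
  moreover have "\<forall>\<^sub>F k in sequentially. \<forall>j\<in>{..<n}. dist (\<sigma> (a k) j) (y j) < \<delta> / 2"
    using y \<delta>(1) by (intro eventually_ball_finite ballI tendstoD) (simp_all add: a_def)
  ultimately have "\<forall>\<^sub>F k in sequentially. dist (a k) x < \<delta> / 2 \<and> (\<forall>j\<in>{..<n}. dist (\<sigma> (a k) j) (y j) < \<delta> / 2)"
    by (rule eventually_conj)
  then obtain N where N: "\<And>k. k \<ge> N \<Longrightarrow> dist (a k) x < \<delta> / 2"
    "\<And>k j. k \<ge> N \<Longrightarrow> j < n \<Longrightarrow> dist (\<sigma> (a k) j) (y j) < \<delta> / 2"
    unfolding eventually_sequentially by auto
  have aG: "a k \<in> \<Gamma>" for k unfolding a_def by (rule fF(1))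
  have "dist (a N) (a (Suc N)) < \<delta>"
    using N(1)[of N] N(1)[of "Suc N"] dist_triangle_half_l[of "a N" x \<delta> "a (Suc N)"] by simp
  then have "norm (a N - a (Suc N)) < \<delta>" by (simp add: dist_norm)
  moreover have "\<forall>j<n. \<bar>\<sigma> (a N - a (Suc N)) j\<bar> < \<delta>"
  proof (intro allI impI)
    fix j assume j: "j < n"
    have "dist (\<sigma> (a N) j) (\<sigma> (a (Suc N)) j) < \<delta>"
      using N(2)[of N j] N(2)[of "Suc N" j] j dist_triangle_half_l[of "\<sigma> (a N) j" "y j" \<delta> "\<sigma> (a (Suc N)) j"] by simp
    then show "\<bar>\<sigma> (a N - a (Suc N)) j\<bar> < \<delta>" unfolding sigma_diff[OF aG aG j] by (simp add: dist_real_def)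
  qed
  ultimately have "a N - a (Suc N) = 0" using \<delta>(2) Gamma_diff[OF aG aG] by blast
  then have "r1 (r2 N) = r1 (r2 (Suc N))" using f(1) by (simp add: a_def inj_eq)
  then show False using r1(1) r2 by (simp add: strict_mono_eq)
qed

text \<open>The sets \<open>Q k\<close> of points within k of the graph are open, increasing and
  saturated, so their images form an open cover of the compact quotient, and a single one is
  everything.\<close>

lemma cocompact: "\<exists>B. \<forall>x y. \<exists>g\<in>\<Gamma>. norm (x - g) \<le> B \<and> (\<forall>j<n. \<bar>y j - \<sigma> g j\<bar> \<le> B)"
proof -
  let ?X = "prod_topology euclidean (rn_topology n) :: ('a \<times> (nat \<Rightarrow> real)) topology"
  let ?f = "graph_coset n \<Gamma> \<sigma>"
  let ?Y = "quotient_topology ?X ?f"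
  define Q where "Q k = (\<Union>g\<in>\<Gamma>. ball g (real k) \<times> {y \<in> rn n. \<forall>j<n. \<bar>y j - \<sigma> g j\<bar> < real k})" for k
  have Q_open: "openin ?X (Q k)" for k
    unfolding Q_def by (intro openin_Union ballI) (auto simp: openin_prod_Times_iff openin_rn_box)
  have Q_top: "Q k \<subseteq> topspace ?X" for k unfolding Q_def by (auto simp: topspace_rn_topology)
  \<comment> \<open>A point in the coset of q is q moved by some h; moving the nearby graph point by
    h as well keeps the distance.\<close>
  have Q_sat: "p \<in> Q k" if p: "p \<in> topspace ?X" and q: "q \<in> Q k" "?f p = ?f q" for p q k
  proof -
    have "p = (fst p + 0, rn_add n (snd p) (\<sigma> 0))"
    proof (rule prod_eqI)
      have "snd p \<in> rn n" using p by (auto simp: topspace_rn_topology)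
      then show "snd p = snd (fst p + 0, rn_add n (snd p) (\<sigma> 0))"
        by (simp, intro rn_eqI[of _ n]) (auto simp: rn_add_def sigma_0)
    qed simp
    then have "p \<in> ?f p" unfolding graph_coset_def graph_on_def using Gamma_0 by force
    then have "p \<in> ?f q" by (simp only: q(2))
    then obtain h where h: "h \<in> \<Gamma>" "p = (fst q + h, rn_add n (snd q) (\<sigma> h))"
      unfolding graph_coset_def graph_on_def by force
    obtain g where g: "g \<in> \<Gamma>" "dist g (fst q) < real k" "\<forall>j<n. \<bar>snd q j - \<sigma> g j\<bar> < real k"
      using q(1) unfolding Q_def by auto
    have "dist (g + h) (fst p) < real k" using g(2) h(2) by (simp add: dist_norm)
    moreover have "\<forall>j<n. \<bar>snd p j - \<sigma> (g + h) j\<bar> < real k"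
      using g(3) h(2) by (simp add: sigma_add[OF g(1) h(1)] rn_add_def)
    moreover have "snd p \<in> rn n" using h(2) by simp
    ultimately have "p \<in> ball (g + h) (real k) \<times> {y \<in> rn n. \<forall>j<n. \<bar>y j - \<sigma> (g + h) j\<bar> < real k}"
      by (simp add: mem_Times_iff)
    then show ?thesis unfolding Q_def using Gamma_add[OF g(1) h(1)] by blast
  qed
  have Q_mono: "Q k \<subseteq> Q m" if "k \<le> m" for k m
  proof -
    have km: "real k \<le> real m" using that by simp
    show ?thesis
    proof
      fix p assume "p \<in> Q k"
      then obtain g where g: "g \<in> \<Gamma>" "p \<in> ball g (real k) \<times> {y \<in> rn n. \<forall>j<n. \<bar>y j - \<sigma> g j\<bar> < real k}"
        unfolding Q_def by blast
      have "\<forall>j<n. \<bar>snd p j - \<sigma> g j\<bar> < real m"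
        using g(2) less_le_trans[OF _ km] by (simp add: mem_Times_iff)
      moreover have "dist g (fst p) < real m" using g(2) less_le_trans[OF _ km] by (simp add: mem_Times_iff)
      ultimately have "p \<in> ball g (real m) \<times> {y \<in> rn n. \<forall>j<n. \<bar>y j - \<sigma> g j\<bar> < real m}"
        using g(2) by (simp add: mem_Times_iff)
      then show "p \<in> Q m" unfolding Q_def using g(1) by blast
    qed
  qed
  have V_open: "openin ?Y (?f ` Q k)" for k
  proof -
    have "{x \<in> topspace ?X. ?f x \<in> ?f ` Q k} = Q k"
    proof
      show "{x \<in> topspace ?X. ?f x \<in> ?f ` Q k} \<subseteq> Q k" using Q_sat by auto
      show "Q k \<subseteq> {x \<in> topspace ?X. ?f x \<in> ?f ` Q k}" using Q_top by blast
    qed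
    then show ?thesis
      unfolding openin_quotient_topology using Q_open image_mono[OF Q_top] by simp
  qed
  have cover: "topspace ?Y \<subseteq> \<Union>(range (\<lambda>k. ?f ` Q k))"
  proof
    fix q assume "q \<in> topspace ?Y"
    then obtain p where p: "p \<in> topspace ?X" "q = ?f p" unfolding topspace_quotient_topology by blast
    have p2: "snd p \<in> rn n" using p(1) by (auto simp: topspace_rn_topology)
    define M where "M = norm (fst p) + (\<Sum>j<n. \<bar>snd p j\<bar>)"
    obtain k :: nat where k: "M < real k" using reals_Archimedean2 by blast
    have "0 \<le> (\<Sum>j<n. \<bar>snd p j\<bar>)" by (intro sum_nonneg) simp
    then have "norm (fst p) < real k" using k unfolding M_def by linarith
    moreover have "\<bar>snd p j - \<sigma> 0 j\<bar> < real k" if j: "j < n" for j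
    proof -
      have "\<bar>snd p j\<bar> \<le> (\<Sum>j<n. \<bar>snd p j\<bar>)" using j by (intro member_le_sum) auto
      then show ?thesis using k norm_ge_zero[of "fst p"] sigma_0[OF j] unfolding M_def by linarith
    qed
    ultimately have "p \<in> ball 0 (real k) \<times> {y \<in> rn n. \<forall>j<n. \<bar>y j - \<sigma> 0 j\<bar> < real k}"
      using p2 by (simp add: mem_Times_iff)
    then have "p \<in> Q k" unfolding Q_def using Gamma_0 by blast
    then show "q \<in> \<Union>(range (\<lambda>k. ?f ` Q k))" using p(2) by blast
  qed
  have "compactin ?Y (topspace ?Y)" using cps unfolding euclidean_cps_def compact_space_def by blast
  then have "\<exists>\<F>. finite \<F> \<and> \<F> \<subseteq> range (\<lambda>k. ?f ` Q k) \<and> topspace ?Y \<subseteq> \<Union>\<F>"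
    using V_open cover by (intro compactinD) auto
  then obtain \<F> where \<F>: "finite \<F>" "\<F> \<subseteq> range (\<lambda>k. ?f ` Q k)" "topspace ?Y \<subseteq> \<Union>\<F>" by blast
  obtain I where I: "finite I" "\<F> = (\<lambda>k. ?f ` Q k) ` I" using finite_subset_image[OF \<F>(1,2)] by blast
  define K where "K = Max (insert 0 I)"
  have K: "k \<le> K" if "k \<in> I" for k unfolding K_def using that I(1) by simp
  have "\<exists>g\<in>\<Gamma>. norm (x - g) \<le> real K \<and> (\<forall>j<n. \<bar>y j - \<sigma> g j\<bar> \<le> real K)" for x y
  proof -
    define p where "p = (x, \<lambda>j\<in>{..<n}. y j)"
    have p: "p \<in> topspace ?X" unfolding p_def by (simp add: topspace_rn_topology)
    then have "?f p \<in> topspace ?Y" unfolding topspace_quotient_topology by blast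
    then obtain k where k: "k \<in> I" "?f p \<in> ?f ` Q k" using \<F>(3) I(2) by blast
    then have "p \<in> Q k" using Q_sat[OF p] by blast
    then have "p \<in> Q K" using Q_mono[OF K[OF k(1)]] by blast
    then obtain g where g: "g \<in> \<Gamma>" "p \<in> ball g (real K) \<times> {y \<in> rn n. \<forall>j<n. \<bar>y j - \<sigma> g j\<bar> < real K}"
      unfolding Q_def by blast
    have "norm (x - g) \<le> real K" "\<forall>j<n. \<bar>y j - \<sigma> g j\<bar> \<le> real K"
      using g(2) unfolding p_def by (simp_all add: dist_norm norm_minus_commute less_eq_real_def)
    then show ?thesis using g(1) by blast
  qed
  then show ?thesis by blast
qed

text \<open>Elements with small \<open>\<sigma>\<close> are differences of two
  points of the model set, and every \<open>g\<close> is \<open>(g - N h) + N h\<close> with \<open>\<sigma> h\<close> close to \<open>\<sigma> g / N\<close>.\<close>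

lemma Gamma_subset_generated:
  assumes U: "openin (rn_topology n) U" "U \<noteq> {}"
    and H: "0 \<in> H" "\<And>x y. x \<in> H \<Longrightarrow> y \<in> H \<Longrightarrow> x - y \<in> H"
    and gen: "\<And>x y. x \<in> proj_set \<Gamma> \<sigma> U \<Longrightarrow> y \<in> proj_set \<Gamma> \<sigma> U \<Longrightarrow> x - y \<in> H"
  shows "\<Gamma> \<subseteq> H"
proof
  fix g assume g: "g \<in> \<Gamma>"
  obtain u where u: "u \<in> U" using U(2) by blast
  obtain \<epsilon> where \<epsilon>: "\<epsilon> > 0" "\<forall>y\<in>rn n. (\<forall>j<n. \<bar>y j - u j\<bar> < \<epsilon>) \<longrightarrow> y \<in> U"
    using U(1) u unfolding openin_rn by blast
  have small: "h \<in> H" if h: "h \<in> \<Gamma>" "\<forall>j<n. \<bar>\<sigma> h j\<bar> < \<epsilon> / 2" for h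
  proof -
    have "\<epsilon> / 2 > 0" using \<epsilon>(1) by simp
    from sigma_dense[OF this, of u]
    obtain k where k: "k \<in> \<Gamma>" "\<forall>j<n. \<bar>\<sigma> k j - u j\<bar> < \<epsilon> / 2" by blast
    have "\<sigma> k \<in> U"
    proof (rule \<epsilon>(2)[THEN bspec, THEN mp, OF sigma_in_rn[OF k(1)]], intro allI impI)
      fix j assume "j < n"
      then show "\<bar>\<sigma> k j - u j\<bar> < \<epsilon>" using k(2)[rule_format, of j] \<epsilon>(1) by linarith
    qed
    moreover have "\<sigma> (h + k) \<in> U"
    proof (rule \<epsilon>(2)[THEN bspec, THEN mp])
      show "\<sigma> (h + k) \<in> rn n" by (rule sigma_in_rn[OF Gamma_add[OF h(1) k(1)]])
      show "\<forall>j<n. \<bar>\<sigma> (h + k) j - u j\<bar> < \<epsilon>"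
      proof (intro allI impI)
        fix j assume "j < n"
        then have "\<bar>\<sigma> h j\<bar> < \<epsilon> / 2" "\<bar>\<sigma> k j - u j\<bar> < \<epsilon> / 2" "\<sigma> (h + k) j = \<sigma> h j + \<sigma> k j"
          using h k by (auto simp: sigma_add rn_add_def)
        then show "\<bar>\<sigma> (h + k) j - u j\<bar> < \<epsilon>" by linarith
      qed
    qed
    ultimately have "(h + k) - k \<in> H"
      using gen[of "h + k" k] k(1) Gamma_add[OF h(1) k(1)] by (simp add: proj_set_def)
    then show ?thesis by simp
  qed
  have addH: "x + y \<in> H" if "x \<in> H" "y \<in> H" for x y
    using H(2)[OF that(1) H(2)[OF H(1) that(2)]] by simp
  have mulH: "real N *\<^sub>R x \<in> H" if "x \<in> H" for N x
    using that by (induction N) (simp_all add: H(1) scaleR_add_left addH)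
  have mulG: "real N *\<^sub>R x \<in> \<Gamma> \<and> (\<forall>j<n. \<sigma> (real N *\<^sub>R x) j = real N * \<sigma> x j)" if "x \<in> \<Gamma>" for N x
  proof (induction N)
    case 0
    then show ?case by (simp add: Gamma_0 sigma_0)
  next
    case (Suc N)
    then show ?case using that
      by (simp add: scaleR_add_left Gamma_add sigma_add rn_add_def algebra_simps)
  qed
  define M where "M = (\<Sum>j<n. \<bar>\<sigma> g j\<bar>)"
  have M0: "M \<ge> 0" unfolding M_def by (intro sum_nonneg) auto
  obtain N0 :: nat where N0: "4 * M / \<epsilon> < real N0" using reals_Archimedean2 by blast
  define N where "N = Suc N0"
  have Npos: "real N > 0" unfolding N_def by simp
  have "4 * M / \<epsilon> < real N" using N0 unfolding N_def by simp
  then have N: "M / real N < \<epsilon> / 4" using \<epsilon>(1) Npos by (simp add: field_simps)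
  \<comment> \<open>Splits \<epsilon>/2: the coordinates of \<sigma> g / N are below \<epsilon>/4 in
    absolute value by the choice of N, and N times the error e is \<epsilon>/4.\<close>
  define e where "e = \<epsilon> / (4 * real N)"
  have e: "e > 0" "e \<le> \<epsilon> / 4" "real N * e = \<epsilon> / 4"
    unfolding e_def using \<epsilon>(1) Npos by (simp_all add: field_simps N_def)
  obtain h where h: "h \<in> \<Gamma>" "\<forall>j<n. \<bar>\<sigma> h j - \<sigma> g j / real N\<bar> < e"
    using sigma_dense[OF e(1), of "\<lambda>j. \<sigma> g j / real N"] by blast
  have "h \<in> H"
  proof (rule small[OF h(1)], intro allI impI)
    fix j assume j: "j < n"
    have "\<bar>\<sigma> g j\<bar> \<le> M" unfolding M_def using j by (intro member_le_sum) auto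
    then have "\<bar>\<sigma> g j / real N\<bar> \<le> M / real N" using Npos by (simp add: divide_right_mono)
    then show "\<bar>\<sigma> h j\<bar> < \<epsilon> / 2" using h(2)[rule_format, OF j] e(2) N by linarith
  qed
  moreover have "g - real N *\<^sub>R h \<in> H"
  proof (rule small)
    show "g - real N *\<^sub>R h \<in> \<Gamma>" using mulG[OF h(1)] g Gamma_diff by blast
    show "\<forall>j<n. \<bar>\<sigma> (g - real N *\<^sub>R h) j\<bar> < \<epsilon> / 2"
    proof (intro allI impI)
      fix j assume j: "j < n"
      have "\<sigma> (g - real N *\<^sub>R h) j = \<sigma> g j - real N * \<sigma> h j"
        using sigma_diff[OF g _ j] mulG[OF h(1)] j by simp
      also have "\<dots> = - (real N * (\<sigma> h j - \<sigma> g j / real N))" using Npos by (simp add: field_simps)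
      finally have "\<bar>\<sigma> (g - real N *\<^sub>R h) j\<bar> = real N * \<bar>\<sigma> h j - \<sigma> g j / real N\<bar>" by (simp add: abs_mult)
      also have "\<dots> < real N * e" using h(2)[rule_format, OF j] Npos by (rule mult_strict_left_mono)
      also have "\<dots> < \<epsilon> / 2" using e(3) \<epsilon>(1) by simp
      finally show "\<bar>\<sigma> (g - real N *\<^sub>R h) j\<bar> < \<epsilon> / 2" .
    qed
  qed
  ultimately have "(g - real N *\<^sub>R h) + real N *\<^sub>R h \<in> H" by (intro addH mulH)
  then show "g \<in> H" by simp
qed

end

section \<open>Characterization of regular inter-model sets\<close>

context address_system
begin

lemma ex_phase_origin:
  assumes "X \<in> hull_set \<Lambda>"
  obtains z where "\<pi> X = torus_class s z"
proof -
  have "\<pi> X \<in> range (torus_class s)"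
    using continuous_pi assms unfolding continuous_map_def
    by (auto simp: topspace_hull_topology topspace_torus)
  then show ?thesis using that by blast
qed

lemma phase_iff_pi: "phase X (\<lambda>i. z0 i - z i) \<longleftrightarrow> X \<in> hull_set \<Lambda> \<and> \<pi> X = torus_class s z"
  unfolding phase_def by simp

lemma factor_map_iff:
  "factor_map (hull_topology \<Lambda>) shift (torus_topology s) (address_action s \<l>) \<pi> \<longleftrightarrow> (\<forall>c. \<exists>Y. phase Y c)"
proof -
  have "\<pi> ` hull_set \<Lambda> = range (torus_class s) \<longleftrightarrow> (\<forall>c. \<exists>Y. phase Y c)"
  proof
    assume *: "\<pi> ` hull_set \<Lambda> = range (torus_class s)"
    show "\<forall>c. \<exists>Y. phase Y c"
    proof
      fix c
      have "torus_class s (\<lambda>i. z0 i - c i) \<in> \<pi> ` hull_set \<Lambda>" unfolding * by blast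
      then show "\<exists>Y. phase Y c" unfolding phase_def by force
    qed
  next
    assume *: "\<forall>c. \<exists>Y. phase Y c"
    have "torus_class s z \<in> \<pi> ` hull_set \<Lambda>" for z
    proof -
      obtain Y where "phase Y (\<lambda>i. z0 i - z i)" using * by blast
      then show ?thesis unfolding phase_iff_pi by blast
    qed
    moreover have "\<pi> X \<in> range (torus_class s)" if "X \<in> hull_set \<Lambda>" for X
      by (rule ex_phase_origin[OF that]) simp
    ultimately show "\<pi> ` hull_set \<Lambda> = range (torus_class s)" by blast
  qed
  then show ?thesis
    using homomorphism unfolding factor_map_def address_homomorphism_def
    by (simp add: topspace_hull_topology topspace_torus)
qed

lemma unique_preimage_iff:
  assumes "\<exists>Y. phase Y c"
  shows "(\<exists>!X. X \<in> hull_set \<Lambda> \<and> \<pi> X = torus_class s (\<lambda>i. z0 i - c i)) \<longleftrightarrow>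
    (\<forall>X Y. phase X c \<longrightarrow> phase Y c \<longrightarrow> X = Y)"
  using assms unfolding phase_def by blast

lemma regular_inter_model_set_imp:
  assumes cps: "euclidean_cps n \<Gamma> \<sigma>" and W: "window n W"
    and lower: "proj_set \<Gamma> \<sigma> (rn_translate n w (rn_topology n interior_of W)) \<subseteq> shift u \<Lambda>"
    and upper: "shift u \<Lambda> \<subseteq> proj_set \<Gamma> \<sigma> (rn_translate n w W)"
    and null: "rn_topology n frontier_of (rn_translate n w W) \<in> null_sets (rn_lebesgue n)"
    and phase: "phase (shift u \<Lambda>) (\<lambda>_. 0)"
  shows "DIM('a) < s" "\<forall>c. \<exists>Y. phase Y c"
    "unique_ergodic_measure (torus_topology s) (address_action s \<l>) (torus_haar s)"
    "\<exists>N\<in>null_sets (torus_haar s). \<forall>c. \<not> (\<forall>X Y. phase X c \<longrightarrow> phase Y c \<longrightarrow> X = Y) \<longrightarrow>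
       torus_class s (\<lambda>i. z0 i - c i) \<in> N"
proof -
  interpret E: euclidean_cps_data n \<Gamma> \<sigma> by standard (rule cps)
  define U1 where "U1 = rn_translate n w (rn_topology n interior_of W)"
  define W1 where "W1 = rn_translate n w W"
  have cW: "compactin (rn_topology n) W" and W_int: "W = rn_topology n closure_of (rn_topology n interior_of W)"
    using W unfolding window_def by blast+
  have W1: "compactin (rn_topology n) W1" unfolding W1_def by (rule compactin_rn_translate[OF cW])
  have U1: "openin (rn_topology n) U1" unfolding U1_def by (rule openin_rn_translate[OF openin_interior_of])
  obtain R where R: "\<And>X x. X \<in> hull_set \<Lambda> \<Longrightarrow> X \<inter> cball x R \<noteq> {}"
    by (rule hull_set_uniformly_relatively_dense[OF delone]) blast
  then have "shift u \<Lambda> \<noteq> {}" using phase_in_hull[OF phase] by blast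
  then have "W \<noteq> {}" using upper unfolding proj_set_def rn_translate_def by blast
  then have "rn_topology n interior_of W \<noteq> {}" using W_int by (metis closure_of_empty)
  then have "U1 \<noteq> {}" unfolding U1_def rn_translate_def by blast
  have diff_shift: "x - y \<in> differences \<Lambda>" if "x \<in> shift u \<Lambda>" "y \<in> shift u \<Lambda>" for x y
    by (rule hull_set_differences[OF phase_in_hull[OF phase] that])
  have diffE: "\<exists>x\<in>shift u \<Lambda>. \<exists>y\<in>shift u \<Lambda>. p = x - y" if "p \<in> differences \<Lambda>" for p
  proof -
    obtain x y where "p = x - y" "x \<in> \<Lambda>" "y \<in> \<Lambda>" using \<open>p \<in> differences \<Lambda>\<close> unfolding differences_def by blast
    then show ?thesis by (intro bexI[of _ "x - u"] bexI[of _ "y - u"]) (simp_all add: mem_shift)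
  qed
  have "\<Gamma> \<subseteq> G"
  proof (rule E.Gamma_subset_generated[OF U1 \<open>U1 \<noteq> {}\<close> G_0 G_diff])
    fix x y assume "x \<in> proj_set \<Gamma> \<sigma> U1" "y \<in> proj_set \<Gamma> \<sigma> U1"
    then have "x \<in> shift u \<Lambda>" "y \<in> shift u \<Lambda>" using lower unfolding U1_def by blast+
    then show "x - y \<in> G" by (rule subsetD[OF differences_subset_G diff_shift])
  qed
  have sub: "differences \<Lambda> \<subseteq> \<Gamma>"
    using diffE upper E.Gamma_diff unfolding proj_set_def by blast
  have "x \<in> \<Gamma>" if "x \<in> group_closure (differences \<Lambda>)" for x
    using that by (induction rule: group_closure.induct) (use sub E.Gamma_0 E.Gamma_diff in auto)
  with \<open>\<Gamma> \<subseteq> G\<close> have GG: "\<Gamma> = G" unfolding G_def by blast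
  obtain B where B: "\<forall>w\<in>W1. \<forall>j<n. \<bar>w j\<bar> \<le> B" using W1[unfolded compactin_rn_iff] by blast
  interpret D: lattice_data \<Lambda> s b \<l> \<pi> z0 n \<sigma>
  proof (unfold_locales, fold GG)
    show "\<sigma> g \<in> rn n" if "g \<in> \<Gamma>" for g by (rule E.sigma_in_rn[OF that])
    show "\<sigma> (g + h) = rn_add n (\<sigma> g) (\<sigma> h)" if "g \<in> \<Gamma>" "h \<in> \<Gamma>" for g h by (rule E.sigma_add[OF that])
    show "finite {g \<in> \<Gamma>. norm g \<le> B \<and> (\<forall>j<n. \<bar>\<sigma> g j\<bar> \<le> B)}" for B by (rule E.finite_bounded)
    show "\<exists>B. \<forall>x y. \<exists>g\<in>\<Gamma>. norm (x - g) \<le> B \<and> (\<forall>j<n. \<bar>y j - \<sigma> g j\<bar> \<le> B)" by (rule E.cocompact)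
    have "\<bar>\<sigma> p j\<bar> \<le> 2 * B" if p: "p \<in> differences \<Lambda>" and j: "j < n" for p j
    proof -
      obtain x y where xy: "x \<in> shift u \<Lambda>" "y \<in> shift u \<Lambda>" "p = x - y" using diffE[OF p] by blast
      then have "x \<in> \<Gamma>" "\<sigma> x \<in> W1" "y \<in> \<Gamma>" "\<sigma> y \<in> W1" using upper unfolding proj_set_def W1_def by blast+
      then show ?thesis unfolding xy(3) using E.sigma_diff[of x y j] B j by (smt (verit))
    qed
    then show "\<exists>B. \<forall>p\<in>differences \<Lambda>. \<forall>j<n. \<bar>\<sigma> p j\<bar> \<le> B" by blast
  qed
  have "n > 0" using cps unfolding euclidean_cps_def by blast
  then show "DIM('a) < s" by (rule D.rank_gt_dim)
  obtain \<tau> where "cut_project \<Lambda> s b \<l> \<pi> n \<sigma> \<tau>" by (rule D.ex_section)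
  then interpret C: cut_project \<Lambda> s b \<l> \<pi> z0 n \<sigma> \<tau> .
  have dense: "\<exists>h\<in>G. \<forall>j<n. \<bar>\<sigma> h j - y j\<bar> < \<epsilon>" if "\<epsilon> > 0" for y and \<epsilon> :: real
    using E.sigma_dense[OF that, of y] unfolding GG .
  show "\<forall>c. \<exists>Y. phase Y c" by (intro allI C.phase_surj[OF dense])
  show "unique_ergodic_measure (torus_topology s) (address_action s \<l>) (torus_haar s)"
  proof (rule unique_ergodic_torus_haar)
    fix v and \<epsilon> :: real assume "\<epsilon> > 0"
    then obtain t h where "\<forall>i<s. \<bar>\<l> t i + coord h i - v i\<bar> < \<epsilon>" using C.dense_orbit[OF dense] by blast
    then show "\<exists>t m. \<forall>i<s. m i \<in> \<int> \<and> \<bar>\<l> t i + m i - v i\<bar> < \<epsilon>"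
      by (intro exI[of _ t] exI[of _ "coord h"]) simp
  qed
  obtain N where N: "N \<in> null_sets (torus_haar s)"
    "\<forall>c. C.S c \<in> rn_topology n frontier_of W1 \<longrightarrow> torus_class s (\<lambda>i. z0 i - c i) \<in> N"
    by (rule C.torus_null_if_null[OF null[folded W1_def]])
  have "torus_class s (\<lambda>i. z0 i - c i) \<in> N" if c: "\<not> (\<forall>X Y. phase X c \<longrightarrow> phase Y c \<longrightarrow> X = Y)" for c
  proof -
    \<comment> \<open>Every element of phase c lies between the model sets of the open and of the
      closed window; two different elements therefore force a lattice point over W1 - U1.\<close>
    have up: "Y \<subseteq> C.model c W1" if "phase Y c" for Y
      by (rule C.phase_subset_model[OF W1 phase _ that]) (use upper in \<open>simp add: C.model_0 proj_set_def W1_def GG\<close>)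
    have low: "C.model c U1 \<subseteq> Y" if "phase Y c" for Y
      by (rule C.model_subset_phase[OF U1 phase _ that]) (use lower in \<open>simp add: C.model_0 proj_set_def U1_def GG\<close>)
    have "C.model c W1 \<noteq> C.model c U1" using c up low by blast
    moreover have "U1 \<subseteq> W1"
      unfolding U1_def W1_def rn_translate_def by (rule image_mono[OF interior_of_subset])
    then have "C.model c U1 \<subseteq> C.model c W1" unfolding C.model_def by blast
    ultimately obtain x where "x \<in> C.model c W1" "x \<notin> C.model c U1" by blast
    then obtain g where g: "g \<in> G" "rn_add n (C.S c) (\<sigma> g) \<in> W1 - U1"
      unfolding C.model_def by blast
    \<comment> \<open>Adding \<open>coord g\<close> puts the internal part on the frontier without
      changing the class in the torus.\<close>
    have "C.S (\<lambda>i. c i + coord g i) = rn_add n (C.S c) (\<sigma> g)"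
      using g(1) by (intro rn_eqI[of _ n]) (auto simp: rn_add_def internal_add C.S_coord)
    then have "C.S (\<lambda>i. c i + coord g i) \<in> rn_topology n frontier_of W1"
      using g(2) rn_translate_diff_frontier[OF cW] unfolding U1_def W1_def by auto
    then have "torus_class s (\<lambda>i. z0 i - (c i + coord g i)) \<in> N" using N(2) by blast
    moreover have "torus_class s (\<lambda>i. z0 i - (c i + coord g i)) = torus_class s (\<lambda>i. z0 i - c i)"
      by (simp add: torus_class_eq_iff)
    ultimately show ?thesis by simp
  qed
  then show "\<exists>N\<in>null_sets (torus_haar s). \<forall>c. \<not> (\<forall>X Y. phase X c \<longrightarrow> phase Y c \<longrightarrow> X = Y) \<longrightarrow>
       torus_class s (\<lambda>i. z0 i - c i) \<in> N" using N(1) by blast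
qed

lemma regular_inter_model_set_if:
  assumes dim: "DIM('a) < s" and surj: "\<forall>c. \<exists>Y. phase Y c"
    and p: "p \<in> \<Lambda>" "phase (shift p \<Lambda>) (\<lambda>_. 0)"
    and N: "N \<in> null_sets (torus_haar s)"
      "\<forall>c. \<not> (\<forall>X Y. phase X c \<longrightarrow> phase Y c \<longrightarrow> X = Y) \<longrightarrow> torus_class s (\<lambda>i. z0 i - c i) \<in> N"
  shows "regular_inter_model_set \<Lambda>"
proof -
  obtain n \<sigma> \<tau> where "n > 0" "cut_project \<Lambda> s b \<l> \<pi> n \<sigma> \<tau>" by (rule ex_cut_project[OF dim])
  then interpret C: cut_project \<Lambda> s b \<l> \<pi> z0 n \<sigma> \<tau> by simp
  have N': "torus_class s (\<lambda>i. z0 i - c i) \<in> N" if "\<not> C.regular c" for c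
    using N(2) that unfolding C.regular_def by blast
  have X: "0 \<in> shift p \<Lambda>" using p(1) by (simp add: mem_shift)
  have surj': "\<exists>Y. phase Y c" for c using surj by blast
  \<comment> \<open>Were no phase regular, N would be the whole torus, which has measure 1.\<close>
  have "\<exists>c. C.regular c"
  proof (rule ccontr)
    assume "\<nexists>c. C.regular c"
    then have "torus_class s (\<lambda>i. z0 i - (z0 i - z i)) \<in> N" for z
      using N'[of "\<lambda>i. z0 i - z i"] by blast
    then have "torus_class s z \<in> N" for z by simp
    then have "space (torus_haar s) \<subseteq> N" by (auto simp: topspace_torus)
    moreover have "N \<subseteq> space (torus_haar s)" using N(1) sets.sets_into_space by blast
    ultimately have "emeasure (torus_haar s) (space (torus_haar s)) = 0" using N(1) by auto
    moreover have "prob_space (torus_haar s)"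
      using invariant_probability_torus_haar[of s \<l>] unfolding invariant_probability_def by blast
    ultimately show False using prob_space.emeasure_space_1 by fastforce
  qed
  note prems = p(2) X surj' this
  define W where "W = rn_topology n closure_of (\<sigma> ` shift p \<Lambda>)"
  have Wrn: "W \<subseteq> rn n" "rn_topology n interior_of W \<subseteq> rn n"
    unfolding W_def using closure_of_subset_topspace[of "rn_topology n"] interior_of_subset_topspace[of "rn_topology n"]
    by (simp_all add: topspace_rn_topology)
  have tr: "rn_translate n (\<lambda>i\<in>{..<n}. 0) V = V" if "V \<subseteq> rn n" for V
  proof -
    have "rn_add n (\<lambda>i\<in>{..<n}. 0) v = v" if "v \<in> V" for v
      using that \<open>V \<subseteq> rn n\<close> by (intro rn_eqI[of _ n]) (auto simp: rn_add_def)
    then show ?thesis unfolding rn_translate_def by auto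
  qed
  have "euclidean_cps n G \<sigma>"
    by (rule C.euclidean_cps_if_dense[OF \<open>n > 0\<close> C.dense_if_phase_surj[OF p(2) surj']])
  moreover have "window n W" unfolding W_def by (rule C.window_W[OF prems])
  moreover have "rn_topology n frontier_of W \<in> null_sets (rn_lebesgue n)"
  proof (rule C.null_if_not_regular[OF N(1) N'])
    show "rn_topology n frontier_of W \<in> sets (rn_lebesgue n)"
      by (rule closedin_rn_sets[OF closedin_frontier_of])
    show "\<not> C.regular c" if "C.S c \<in> rn_topology n frontier_of W" for c
      using C.frontier_not_regular[OF prems] that unfolding W_def by blast
  qed
  moreover have "shift (- p) (proj_set G \<sigma> (rn_topology n interior_of W)) \<subseteq> \<Lambda>" "\<Lambda> \<subseteq> shift (- p) (proj_set G \<sigma> W)"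
  proof -
    have mono: "shift (- p) A \<subseteq> shift (- p) B" if "A \<subseteq> B" for A B using that by (auto simp: mem_shift)
    show "shift (- p) (proj_set G \<sigma> (rn_topology n interior_of W)) \<subseteq> \<Lambda>"
      using mono[OF C.model_set_bounds(1)[OF prems]] unfolding W_def by simp
    show "\<Lambda> \<subseteq> shift (- p) (proj_set G \<sigma> W)"
      using mono[OF C.model_set_bounds(2)[OF prems]] unfolding W_def by simp
  qed
  \<comment> \<open>The window needs no displacement because \<open>shift p \<Lambda>\<close> has
    phase 0; the shift by -p returns to \<Lambda>.\<close>
  ultimately show ?thesis
    unfolding regular_inter_model_set_def using delone
    by (intro conjI exI[of _ n] exI[of _ G] exI[of _ \<sigma>] exI[of _ W] exI[of _ "- p"] exI[of _ "\<lambda>i\<in>{..<n}. 0"])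
      (simp_all add: tr Wrn)
qed

end

theorem theorem2:
  fixes \<Lambda> :: "'a::euclidean_space set"
    and s :: nat
    and b :: "nat \<Rightarrow> 'a"
    and \<l> :: "'a \<Rightarrow> nat \<Rightarrow> real"
    and \<pi> :: "'a set \<Rightarrow> (nat \<Rightarrow> real) set"
  assumes "meyer \<Lambda>" and "repetitive \<Lambda>"
    and "s = Z_rank (group_closure (differences \<Lambda>))"
    and "is_Z_basis s b (group_closure (differences \<Lambda>))"
    and "address_linear_map \<Lambda> s b \<l>"
    and "address_homomorphism \<Lambda> s \<l> \<pi>"
  shows "regular_inter_model_set \<Lambda> \<longleftrightarrow>
     Z_rank (group_closure (differences \<Lambda>)) > DIM('a) \<and>
     factor_map (hull_topology \<Lambda>) shift (torus_topology s) (address_action s \<l>) \<pi> \<and>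
     (\<exists>\<mu>. unique_ergodic_measure (torus_topology s) (address_action s \<l>) \<mu> \<and>
          (AE w in \<mu>. \<exists>!\<Lambda>'. \<Lambda>' \<in> hull_set \<Lambda> \<and> \<pi> \<Lambda>' = w))"
proof -
  have loc: "address_system \<Lambda> s b \<l> \<pi>" by standard (rule assms)+
  then interpret A0: address_system \<Lambda> s b \<l> \<pi> "\<lambda>_. 0" .
  have hull: "shift u \<Lambda> \<in> hull_set \<Lambda>" for u
    by (rule shift_in_hull_set[OF hull_set_self[OF A0.delone]])
  show ?thesis
    unfolding assms(3)[symmetric]
  proof (intro iffI; (elim conjE exE)?)
    assume "regular_inter_model_set \<Lambda>"
    then obtain n \<Gamma> \<sigma> W t w where cps: "euclidean_cps n \<Gamma> \<sigma>" and W: "window n W"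
      and lower: "shift t (proj_set \<Gamma> \<sigma> (rn_translate n w (rn_topology n interior_of W))) \<subseteq> \<Lambda>"
      and upper: "\<Lambda> \<subseteq> shift t (proj_set \<Gamma> \<sigma> (rn_translate n w W))"
      and null: "rn_topology n frontier_of (rn_translate n w W) \<in> null_sets (rn_lebesgue n)"
      unfolding regular_inter_model_set_def by blast
    obtain z where z: "\<pi> (shift (- t) \<Lambda>) = torus_class s z" by (rule A0.ex_phase_origin[OF hull])
    \<comment> \<open>This base point gives phase 0 to the translate that the scheme
      describes.\<close>
    from loc interpret A: address_system \<Lambda> s b \<l> \<pi> z .
    have ph: "A.phase (shift (- t) \<Lambda>) (\<lambda>_. 0)" unfolding A.phase_def using hull z by simp
    have mono: "shift (- t) A \<subseteq> shift (- t) B" if "A \<subseteq> B" for A B using that by (auto simp: mem_shift)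
    note imp = A.regular_inter_model_set_imp[OF cps W _ _ null ph]
    have l: "proj_set \<Gamma> \<sigma> (rn_translate n w (rn_topology n interior_of W)) \<subseteq> shift (- t) \<Lambda>"
      using mono[OF lower] by simp
    have u: "shift (- t) \<Lambda> \<subseteq> proj_set \<Gamma> \<sigma> (rn_translate n w W)"
      using mono[OF upper] by simp
    note imp = imp[OF l u]
    from imp(4) obtain N where N: "N \<in> null_sets (torus_haar s)"
      "\<forall>c. \<not> (\<forall>X Y. A.phase X c \<longrightarrow> A.phase Y c \<longrightarrow> X = Y) \<longrightarrow> torus_class s (\<lambda>i. z i - c i) \<in> N"
      by (rule bexE)
    have "AE w in torus_haar s. \<exists>!\<Lambda>'. \<Lambda>' \<in> hull_set \<Lambda> \<and> \<pi> \<Lambda>' = w"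
    proof (rule AE_I'[OF N(1)], rule subsetI)
      fix w assume "w \<in> {w \<in> space (torus_haar s). \<not> (\<exists>!\<Lambda>'. \<Lambda>' \<in> hull_set \<Lambda> \<and> \<pi> \<Lambda>' = w)}"
      then have w: "w \<in> range (torus_class s)" "\<not> (\<exists>!\<Lambda>'. \<Lambda>' \<in> hull_set \<Lambda> \<and> \<pi> \<Lambda>' = w)"
        by (simp_all only: mem_Collect_eq space_torus_haar topspace_torus not_False_eq_True)
      from w(1) obtain y where yw: "w = torus_class s y" by (rule rangeE)
      note y = yw w(2)[unfolded yw]
      define c where "c i = z i - y i" for i
      have c: "torus_class s (\<lambda>i. z i - c i) = torus_class s y" by (simp add: c_def)
      have "\<not> (\<forall>X Y. A.phase X c \<longrightarrow> A.phase Y c \<longrightarrow> X = Y)"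
        using y(2) unfolding A.unique_preimage_iff[OF imp(2)[THEN spec], of c, unfolded c] .
      then have "torus_class s (\<lambda>i. z i - c i) \<in> N" by (rule N(2)[THEN spec, THEN mp])
      then show "w \<in> N" unfolding c y(1) .
    qed
    then show "DIM('a) < s \<and> factor_map (hull_topology \<Lambda>) shift (torus_topology s) (address_action s \<l>) \<pi> \<and>
      (\<exists>\<mu>. unique_ergodic_measure (torus_topology s) (address_action s \<l>) \<mu> \<and>
        (AE w in \<mu>. \<exists>!\<Lambda>'. \<Lambda>' \<in> hull_set \<Lambda> \<and> \<pi> \<Lambda>' = w))"
      using imp(1,3) A.factor_map_iff[THEN iffD2, OF imp(2)] by blast
  next
    fix \<mu>
    assume dim: "DIM('a) < s"
      and factor: "factor_map (hull_topology \<Lambda>) shift (torus_topology s) (address_action s \<l>) \<pi>"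
      and \<mu>: "unique_ergodic_measure (torus_topology s) (address_action s \<l>) \<mu>"
      and AE: "AE w in \<mu>. \<exists>!\<Lambda>'. \<Lambda>' \<in> hull_set \<Lambda> \<and> \<pi> \<Lambda>' = w"
    \<comment> \<open>Haar measure is invariant for every \<l>, so the uniqueness contained in the
      assumption on \<mu> identifies it.\<close>
    have "torus_haar s = \<mu>"
      using \<mu> invariant_probability_torus_haar[of s \<l>] unfolding unique_ergodic_measure_def by blast
    then have "AE w in torus_haar s. \<exists>!\<Lambda>'. \<Lambda>' \<in> hull_set \<Lambda> \<and> \<pi> \<Lambda>' = w" using AE by (simp only:)
    then obtain N where N: "{w \<in> space (torus_haar s). \<not> (\<exists>!\<Lambda>'. \<Lambda>' \<in> hull_set \<Lambda> \<and> \<pi> \<Lambda>' = w)} \<subseteq> N"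
      "emeasure (torus_haar s) N = 0" "N \<in> sets (torus_haar s)"
      by (rule AE_E)
    obtain R where "\<And>X x. X \<in> hull_set \<Lambda> \<Longrightarrow> X \<inter> cball x R \<noteq> {}"
      by (rule hull_set_uniformly_relatively_dense[OF A0.delone]) blast
    then obtain p where p: "p \<in> \<Lambda>" using hull_set_self[OF A0.delone] by blast
    obtain z where z: "\<pi> (shift p \<Lambda>) = torus_class s z" by (rule A0.ex_phase_origin[OF hull])
    from loc interpret A: address_system \<Lambda> s b \<l> \<pi> z .
    have ph: "A.phase (shift p \<Lambda>) (\<lambda>_. 0)" unfolding A.phase_def using hull z by simp
    have surj: "\<forall>c. \<exists>Y. A.phase Y c" using factor unfolding A.factor_map_iff .
    show "regular_inter_model_set \<Lambda>"
    proof (rule A.regular_inter_model_set_if[OF dim surj p ph])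
      show "N \<in> null_sets (torus_haar s)" using N(2,3) by blast
      show "\<forall>c. \<not> (\<forall>X Y. A.phase X c \<longrightarrow> A.phase Y c \<longrightarrow> X = Y) \<longrightarrow> torus_class s (\<lambda>i. z i - c i) \<in> N"
      proof (intro allI impI)
        fix c assume c: "\<not> (\<forall>X Y. A.phase X c \<longrightarrow> A.phase Y c \<longrightarrow> X = Y)"
        have "\<exists>Y. A.phase Y c" using surj by blast
        then have "\<not> (\<exists>!\<Lambda>'. \<Lambda>' \<in> hull_set \<Lambda> \<and> \<pi> \<Lambda>' = torus_class s (\<lambda>i. z i - c i))"
          using c by (simp only: A.unique_preimage_iff not_False_eq_True)
        moreover have "torus_class s (\<lambda>i. z i - c i) \<in> space (torus_haar s)" by (simp add: topspace_torus)
        ultimately show "torus_class s (\<lambda>i. z i - c i) \<in> N" using N(1) by blast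
      qed
    qed
  qed
qed

end
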